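(* Let $K$ be a closed convex subset of $H$ with $0\in K$, and let $P_K:H\to K$ be the projection operator onto $K$. Let $m$ be the characteristic function of a finite set $\omega\subset\mathbb N$ such that $P_K(mu)=mP_K(u)$ for all $u\in H$. Assume $u^0\in D(A)$ with $mu^0\in K$, and $f\in W^{1,2}([0,T],H)$. Then for each $\lambda>0$ there exists a feedback controller $$g_\lambda=-\frac1\lambda\big(mu_\lambda-mP_K(u_\lambda)\big)$$ such that the solution $u_\lambda$ of the closed loop system $$\frac{du}{dt}+\nu Au+B(u)=f+g_\lambda,\qquad u(0)=u^0,$$ satisfies $u_\lambda\in W^{1,\infty}([0,T],H)\cap L^\infty([0,T],D(A))$. Moreover, there exists a constant $C>0$ such that $$\frac1\lambda\int_0^Td_K^2(mu_\lambda(t))\,dt\le C\qquad\text{for all }\lambda>0 .$$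
   Context: Fix $T>0$, $\nu>0$, $k_0>0$, $q>1$, real constants $a,b,c$ with $a+b+c=0$, and put $k_n=k_0q^n$. $H=\ell^2(\mathbb C)$ (sequences indexed by $n\ge1$) with $(u,v)=\sum_{n\ge1}u_nv_n^*$ ($^*$ = complex conjugation), norm $|u|$, and canonical basis $(\phi_n)$. $A$ is the diagonal operator $A\phi_n=k_n^2\phi_n$ with domain $D(A)=\{u\in H:\ |Au|<\infty\}$ normed by $|Au|$. The map $B$ is $$B(u,v)=-i\sum_{n=1}^\infty\big(ak_{n+1}v_{n+2}u_{n+1}^*+bk_nv_{n+1}u_{n-1}^*+ak_{n-1}u_{n-1}v_{n-2}+bk_{n-1}v_{n-1}u_{n-2}\big)\phi_n,$$ where components with index $\le 0$ are $0$ (sabra shell model), and $B(u)=B(u,u)$. $P_K(u)$ is the unique nearest point of $K$ to $u$ in $H$, and $d_K(u)=|u-P_K(u)|$ is the $H$-distance from $u$ to $K$. Multiplication by $m$ acts componentwise: $(mu)_n=u_n$ if $n\in\omega$ and $(mu)_n=0$ otherwise. The equation holds in $H$ for a.e. $t\in[0,T]$. The constant $C$ is independent of $\lambda$. *)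

theory Defs
  imports "HOL-Analysis.Analysis"
begin

section \<open>The space of square-summable complex sequences\<close>

text \<open>
  Sequences indexed by \<open>n \<ge> 1\<close> are represented as functions on \<open>nat\<close> that vanish at \<open>0\<close>.
  Since subtraction on \<open>nat\<close> truncates, \<open>u (n - 1)\<close> and \<open>u (n - 2)\<close> are then \<open>0\<close> whenever
  the integer index is \<open>\<le> 0\<close>, which is the convention of the shell model.
\<close>

definition ell2_seqs :: "(nat \<Rightarrow> complex) set" where
  "ell2_seqs = {x. x 0 = 0 \<and> summable (\<lambda>n. (cmod (x n))\<^sup>2)}"

lemma ell2_seqs_zero: "(\<lambda>n. 0) \<in> ell2_seqs"
  by (simp add: ell2_seqs_def)

lemma ell2_seqs_comparison:
  assumes "x \<in> ell2_seqs" "y 0 = 0" "\<And>n. cmod (y n) \<le> M * cmod (x n)"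
  shows "y \<in> ell2_seqs"
proof -
  have "(cmod (y n))\<^sup>2 \<le> M\<^sup>2 * (cmod (x n))\<^sup>2" for n
    using power_mono[OF assms(3)[of n] norm_ge_zero, of 2] by (simp add: power_mult_distrib)
  moreover have "summable (\<lambda>n. M\<^sup>2 * (cmod (x n))\<^sup>2)"
    using assms(1) by (auto simp: ell2_seqs_def intro: summable_mult)
  ultimately have "summable (\<lambda>n. (cmod (y n))\<^sup>2)"
    by - (rule summable_comparison_test'[where N = 0 and g = "\<lambda>n. M\<^sup>2 * (cmod (x n))\<^sup>2"], auto)
  then show ?thesis using assms(2) by (simp add: ell2_seqs_def)
qed

lemma ell2_seqs_add:
  assumes "x \<in> ell2_seqs" "y \<in> ell2_seqs"
  shows "(\<lambda>n. x n + y n) \<in> ell2_seqs"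
proof -
  have "(cmod (x n + y n))\<^sup>2 \<le> 2 * (cmod (x n))\<^sup>2 + 2 * (cmod (y n))\<^sup>2" for n
  proof -
    have "(cmod (x n + y n))\<^sup>2 \<le> (cmod (x n) + cmod (y n))\<^sup>2"
      by (intro power_mono norm_triangle_ineq) auto
    also have "\<dots> \<le> 2 * (cmod (x n))\<^sup>2 + 2 * (cmod (y n))\<^sup>2"
      using sum_squares_bound[of "cmod (x n)" "cmod (y n)"]
      by (simp add: power2_eq_square algebra_simps)
    finally show ?thesis .
  qed
  moreover have "summable (\<lambda>n. 2 * (cmod (x n))\<^sup>2 + 2 * (cmod (y n))\<^sup>2)"
    using assms by (auto simp: ell2_seqs_def intro!: summable_add summable_mult)
  ultimately have "summable (\<lambda>n. (cmod (x n + y n))\<^sup>2)"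
    by - (rule summable_comparison_test'[where N = 0
          and g = "\<lambda>n. 2 * (cmod (x n))\<^sup>2 + 2 * (cmod (y n))\<^sup>2"], auto)
  then show ?thesis using assms by (simp add: ell2_seqs_def)
qed

lemma ell2_seqs_cmult:
  assumes "x \<in> ell2_seqs"
  shows "(\<lambda>n. z * x n) \<in> ell2_seqs"
  by (rule ell2_seqs_comparison[OF assms, where M = "cmod z"])
     (use assms in \<open>auto simp: ell2_seqs_def norm_mult\<close>)

lemma ell2_seqs_scaleR:
  assumes "x \<in> ell2_seqs"
  shows "(\<lambda>n. r *\<^sub>R x n) \<in> ell2_seqs"
  using ell2_seqs_cmult[OF assms, of "of_real r"] by (simp add: scaleR_conv_of_real)

lemma ell2_seqs_uminus:
  assumes "x \<in> ell2_seqs"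
  shows "(\<lambda>n. - x n) \<in> ell2_seqs"
  using ell2_seqs_cmult[OF assms, of "-1"] by simp

lemma ell2_seqs_diff:
  assumes "x \<in> ell2_seqs" "y \<in> ell2_seqs"
  shows "(\<lambda>n. x n - y n) \<in> ell2_seqs"
  using ell2_seqs_add[OF assms(1) ell2_seqs_uminus[OF assms(2)]] by simp

typedef ell2 = ell2_seqs
  morphisms coord Abs_ell2
  using ell2_seqs_zero by blast

lemma coord_mem: "coord u \<in> ell2_seqs"
  by (rule coord)

lemma coord_0 [simp]: "coord u 0 = 0"
  using coord[of u] by (simp add: ell2_seqs_def)

lemma summable_coord: "summable (\<lambda>n. (cmod (coord u n))\<^sup>2)"
  using coord[of u] by (simp add: ell2_seqs_def)

lemma coord_Abs: "x \<in> ell2_seqs \<Longrightarrow> coord (Abs_ell2 x) = x"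
  by (rule Abs_ell2_inverse)

lemma ell2_eqI: "(\<And>n. coord u n = coord v n) \<Longrightarrow> u = v"
  by (metis coord_inject ext)

lemma summable_coord_prod: "summable (\<lambda>n. Re (coord u n * cnj (coord v n)))"
proof (rule summable_comparison_test'[where N = 0])
  show "summable (\<lambda>n. (cmod (coord u n))\<^sup>2 + (cmod (coord v n))\<^sup>2)"
    by (intro summable_add summable_coord)
  fix n
  have "norm (Re (coord u n * cnj (coord v n))) \<le> cmod (coord u n) * cmod (coord v n)"
    using abs_Re_le_cmod[of "coord u n * cnj (coord v n)"] by (simp add: norm_mult)
  also have "\<dots> \<le> (cmod (coord u n))\<^sup>2 + (cmod (coord v n))\<^sup>2"
    using sum_squares_bound[of "cmod (coord u n)" "cmod (coord v n)"]
      mult_nonneg_nonneg[OF norm_ge_zero norm_ge_zero, of "coord u n" "coord v n"]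
    by linarith
  finally show "norm (Re (coord u n * cnj (coord v n))) \<le> \<dots>" .
qed

text \<open>
  The real inner product is the real part of \<open>(u, v) = (\<Sum>n. u n * cnj (v n))\<close>; it induces the
  same norm, and the notions used below (convexity, time derivatives, time integrals, nearest
  points) only involve the underlying real Hilbert space.
\<close>

instantiation ell2 :: real_inner
begin

definition "zero_ell2 = Abs_ell2 (\<lambda>n. 0)"
definition "plus_ell2 u v = Abs_ell2 (\<lambda>n. coord u n + coord v n)"
definition "minus_ell2 u v = Abs_ell2 (\<lambda>n. coord u n - coord v n)"
definition "uminus_ell2 u = Abs_ell2 (\<lambda>n. - coord u n)"
definition "scaleR_ell2 r u = Abs_ell2 (\<lambda>n. r *\<^sub>R coord u n)"
definition "inner_ell2 u v = (\<Sum>n. Re (coord u n * cnj (coord v n)))"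
definition "norm_ell2 u = sqrt (\<Sum>n. (cmod (coord u n))\<^sup>2)"
definition "sgn_ell2 (u :: ell2) = scaleR (inverse (norm u)) u"
definition "dist_ell2 (u :: ell2) v = norm (u - v)"
definition [code del]:
  "(uniformity :: (ell2 \<times> ell2) filter) = (INF e\<in>{0 <..}. principal {(x, y). dist x y < e})"
definition [code del]:
  "open (U :: ell2 set) \<longleftrightarrow> (\<forall>x\<in>U. eventually (\<lambda>(x', y). x' = x \<longrightarrow> y \<in> U) uniformity)"

lemma coord_zero [simp]: "coord 0 n = 0"
  by (simp add: zero_ell2_def coord_Abs ell2_seqs_zero)

lemma coord_add [simp]: "coord (u + v) n = coord u n + coord v n"
  by (simp add: plus_ell2_def coord_Abs ell2_seqs_add coord_mem)

lemma coord_diff [simp]: "coord (u - v) n = coord u n - coord v n"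
  by (simp add: minus_ell2_def coord_Abs ell2_seqs_diff coord_mem)

lemma coord_uminus [simp]: "coord (- u) n = - coord u n"
  by (simp add: uminus_ell2_def coord_Abs ell2_seqs_uminus coord_mem)

lemma coord_scaleR [simp]: "coord (r *\<^sub>R u) n = r *\<^sub>R coord u n"
  by (simp add: scaleR_ell2_def coord_Abs ell2_seqs_scaleR coord_mem)

lemma Re_mult_cnj_self: "Re (z * cnj z) = (cmod z)\<^sup>2"
  by (simp add: cmod_power2) (simp add: power2_eq_square)

instance
proof
  fix u v w :: ell2 and r s :: real
  show "u + v + w = u + (v + w)" "u + v = v + u" "0 + u = u" "- u + u = 0" "u - v = u + - v"
    by (rule ell2_eqI; simp)+
  show "r *\<^sub>R (u + v) = r *\<^sub>R u + r *\<^sub>R v" "(r + s) *\<^sub>R u = r *\<^sub>R u + s *\<^sub>R u"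
    "r *\<^sub>R s *\<^sub>R u = (r * s) *\<^sub>R u" "1 *\<^sub>R u = u"
    by (rule ell2_eqI; simp add: algebra_simps)+
  show "sgn u = scaleR (inverse (norm u)) u" by (fact sgn_ell2_def)
  show "dist u v = norm (u - v)" by (fact dist_ell2_def)
  show "(uniformity :: (ell2 \<times> ell2) filter) = (INF e\<in>{0 <..}. principal {(x, y). dist x y < e})"
    by (fact uniformity_ell2_def)
  show "open U \<longleftrightarrow> (\<forall>x\<in>U. eventually (\<lambda>(x', y). x' = x \<longrightarrow> y \<in> U) uniformity)" for U :: "ell2 set"
    by (fact open_ell2_def)
  show "inner u v = inner v u"
    by (simp add: inner_ell2_def algebra_simps)
  show "inner (u + v) w = inner u w + inner v w"
    unfolding inner_ell2_def using suminf_add[OF summable_coord_prod[of u w] summable_coord_prod[of v w]]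
    by (simp add: algebra_simps)
  show "inner (r *\<^sub>R u) v = r * inner u v"
    unfolding inner_ell2_def using suminf_mult[OF summable_coord_prod[of u v], of r]
    by (simp add: algebra_simps)
  have self: "inner u u = (\<Sum>n. (cmod (coord u n))\<^sup>2)"
    by (simp only: inner_ell2_def Re_mult_cnj_self)
  show "0 \<le> inner u u"
    unfolding self by (intro suminf_nonneg summable_coord) auto
  show "inner u u = 0 \<longleftrightarrow> u = 0"
    unfolding self using suminf_eq_zero_iff[OF summable_coord[of u]]
    by (auto intro: ell2_eqI)
  show "norm u = sqrt (inner u u)"
    unfolding self norm_ell2_def ..
qed

end

lemma ell2_norm_power2: "(norm u)\<^sup>2 = (\<Sum>n. (cmod (coord u n))\<^sup>2)" for u :: ell2
  by (simp add: norm_ell2_def suminf_nonneg summable_coord)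

lemma ell2_partial_le: "(\<Sum>n<N. (cmod (coord u n))\<^sup>2) \<le> (norm u)\<^sup>2" for u :: ell2
  unfolding ell2_norm_power2 by (intro sum_le_suminf summable_coord) auto

lemma cmod_coord_le: "cmod (coord u n) \<le> norm u" for u :: ell2
proof -
  have "(cmod (coord u n))\<^sup>2 \<le> (\<Sum>i<Suc n. (cmod (coord u i))\<^sup>2)"
    by (simp add: sum_nonneg)
  also have "\<dots> \<le> (norm u)\<^sup>2" by (rule ell2_partial_le)
  finally show ?thesis by (rule power2_le_imp_le) simp
qed

lemma ell2_of_partial_bounds:
  assumes "x 0 = 0" "\<And>N. (\<Sum>n<N. (cmod (x n))\<^sup>2) \<le> B\<^sup>2" "0 \<le> B"
  shows "x \<in> ell2_seqs" "norm (Abs_ell2 x) \<le> B"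
proof -
  have s: "summable (\<lambda>n. (cmod (x n))\<^sup>2)"
    by (rule summableI_nonneg_bounded[where x = "B\<^sup>2"]) (use assms in auto)
  then show m: "x \<in> ell2_seqs" using assms by (simp add: ell2_seqs_def)
  have "(norm (Abs_ell2 x))\<^sup>2 \<le> B\<^sup>2"
    unfolding ell2_norm_power2 coord_Abs[OF m]
    by (rule suminf_le_const[OF s]) (use assms in auto)
  then show "norm (Abs_ell2 x) \<le> B" using assms(3) by (rule power2_le_imp_le)
qed

instance ell2 :: complete_space
proof
  fix X :: "nat \<Rightarrow> ell2"
  assume X: "Cauchy X"
  have "Cauchy (\<lambda>m. coord (X m) n)" for n
  proof (rule CauchyI)
    fix e :: real assume e: "0 < e"
    obtain M where M: "\<And>m k. m \<ge> M \<Longrightarrow> k \<ge> M \<Longrightarrow> norm (X m - X k) < e"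
      using CauchyD[OF X e] by blast
    have "norm (coord (X m) n - coord (X k) n) < e" if "m \<ge> M" "k \<ge> M" for m k
      using cmod_coord_le[of "X m - X k" n] M[OF that] by simp
    then show "\<exists>M. \<forall>m\<ge>M. \<forall>k\<ge>M. norm (coord (X m) n - coord (X k) n) < e" by blast
  qed
  then have "\<exists>y. \<forall>n. (\<lambda>m. coord (X m) n) \<longlonglongrightarrow> y n"
    by (intro choice) (auto simp: Cauchy_convergent_iff convergent_def)
  then obtain y where y: "\<And>n. (\<lambda>m. coord (X m) n) \<longlonglongrightarrow> y n" by blast
  have y0: "y 0 = 0"
    using y[of 0] by (simp add: LIMSEQ_const_iff)
  have key: "\<exists>M. \<forall>m\<ge>M. \<forall>N. (\<Sum>n<N. (cmod (coord (X m) n - y n))\<^sup>2) \<le> e\<^sup>2" if e: "0 < e" for e :: real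
  proof -
    obtain M where M: "\<And>m k. m \<ge> M \<Longrightarrow> k \<ge> M \<Longrightarrow> norm (X m - X k) < e"
      using CauchyD[OF X e] by blast
    have "(\<Sum>n<N. (cmod (coord (X m) n - y n))\<^sup>2) \<le> e\<^sup>2" if m: "m \<ge> M" for m N
    proof (rule tendsto_upperbound)
      show "(\<lambda>k. \<Sum>n<N. (cmod (coord (X m) n - coord (X k) n))\<^sup>2)
          \<longlonglongrightarrow> (\<Sum>n<N. (cmod (coord (X m) n - y n))\<^sup>2)"
        by (intro tendsto_intros y)
      have "(\<Sum>n<N. (cmod (coord (X m) n - coord (X k) n))\<^sup>2) \<le> e\<^sup>2" if "k \<ge> M" for k
      proof -
        have "(\<Sum>n<N. (cmod (coord (X m) n - coord (X k) n))\<^sup>2) \<le> (norm (X m - X k))\<^sup>2"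
          using ell2_partial_le[of "X m - X k" N] by simp
        also have "\<dots> \<le> e\<^sup>2"
          using M[OF m that] by (intro power_mono) auto
        finally show ?thesis .
      qed
      then show "\<forall>\<^sub>F k in sequentially. (\<Sum>n<N. (cmod (coord (X m) n - coord (X k) n))\<^sup>2) \<le> e\<^sup>2"
        unfolding eventually_sequentially by blast
    qed simp
    then show ?thesis by blast
  qed
  have mem: "y \<in> ell2_seqs"
  proof -
    obtain M where M: "\<And>N. (\<Sum>n<N. (cmod (coord (X M) n - y n))\<^sup>2) \<le> 1\<^sup>2"
      using key[of 1] by auto
    have "(\<lambda>n. coord (X M) n - y n) \<in> ell2_seqs"
      by (rule ell2_of_partial_bounds(1)[where B = 1]) (use M y0 in auto)
    from ell2_seqs_diff[OF coord_mem[of "X M"] this] show ?thesis by simp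
  qed
  have "X \<longlonglongrightarrow> Abs_ell2 y"
  proof (rule LIMSEQ_I)
    fix r :: real assume "0 < r"
    then obtain M where M: "\<And>m N. m \<ge> M \<Longrightarrow> (\<Sum>n<N. (cmod (coord (X m) n - y n))\<^sup>2) \<le> (r / 2)\<^sup>2"
      using key[of "r / 2"] by auto
    have "norm (X m - Abs_ell2 y) < r" if "m \<ge> M" for m
    proof -
      have "X m - Abs_ell2 y = Abs_ell2 (\<lambda>n. coord (X m) n - y n)"
        by (simp add: minus_ell2_def coord_Abs[OF mem])
      moreover have "norm (Abs_ell2 (\<lambda>n. coord (X m) n - y n)) \<le> r / 2"
        by (rule ell2_of_partial_bounds(2)) (use M[OF that] y0 \<open>0 < r\<close> in auto)
      ultimately show ?thesis using \<open>0 < r\<close> by simp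
    qed
    then show "\<exists>no. \<forall>n\<ge>no. norm (X n - Abs_ell2 y) < r" by blast
  qed
  then show "convergent X" by (auto simp: convergent_def)
qed

instance ell2 :: banach ..

lemma ell2_countable_dense: "\<exists>D :: ell2 set. countable D \<and> (\<forall>u. \<forall>e>0. \<exists>d\<in>D. dist d u < e)"
proof -
  obtain C :: "complex set" where C: "countable C" "\<And>X. open X \<Longrightarrow> X \<noteq> {} \<Longrightarrow> \<exists>d\<in>C. d \<in> X"
    using countable_dense_exists[where 'a = complex] by blast
  have Cd: "\<exists>d\<in>C. cmod (d - z) < e" if "e > 0" for z e
    using C(2)[of "ball z e"] that by (auto simp: dist_norm norm_minus_commute)
  define F where "F = (\<lambda>l :: complex list. \<lambda>n. if n = 0 \<or> n \<ge> length l then 0 else l ! n)"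
  have Fm: "F l \<in> ell2_seqs" for l
  proof -
    have "summable (\<lambda>n. (cmod (F l n))\<^sup>2)"
      by (rule summable_finite[of "{..<length l}"]) (auto simp: F_def)
    then show ?thesis by (simp add: ell2_seqs_def F_def)
  qed
  have "\<exists>d\<in>(\<lambda>l. Abs_ell2 (F l)) ` lists C. dist d u < e" if e: "0 < e" for u :: ell2 and e
  proof -
    have "\<exists>N. \<forall>n\<ge>N. norm (\<Sum>i. (cmod (coord u (i + n)))\<^sup>2) < e\<^sup>2 / 4"
      using suminf_exist_split[OF _ summable_coord[of u], of "e\<^sup>2 / 4"] e by auto
    then obtain N where "norm (\<Sum>i. (cmod (coord u (i + N)))\<^sup>2) < e\<^sup>2 / 4"
      by blast
    then have N: "(\<Sum>i. (cmod (coord u (i + N)))\<^sup>2) < e\<^sup>2 / 4"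
      by (simp only: real_norm_def abs_less_iff)
    define h where "h = e / (2 * sqrt (real (Suc N)))"
    have h: "h > 0" using e by (simp add: h_def)
    have "\<forall>n. \<exists>d. d \<in> C \<and> cmod (d - coord u n) < h" using Cd[OF h] by blast
    then obtain g where g: "\<And>n. g n \<in> C" "\<And>n. cmod (g n - coord u n) < h" by metis
    define l where "l = map g [0..<N]"
    have ll: "l \<in> lists C" using g by (auto simp: l_def)
    let ?x = "\<lambda>n. F l n - coord u n"
    have xm: "?x \<in> ell2_seqs" by (rule ell2_seqs_diff[OF Fm coord_mem])
    have sm: "summable (\<lambda>n. (cmod (?x n))\<^sup>2)" using xm by (simp add: ell2_seqs_def)
    have tail: "(\<Sum>i. (cmod (?x (i + N)))\<^sup>2) = (\<Sum>i. (cmod (coord u (i + N)))\<^sup>2)"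
      by (intro suminf_cong) (simp add: F_def l_def)
    have hsq: "real (Suc N) * h\<^sup>2 = e\<^sup>2 / 4"
      using e by (simp add: h_def power_divide power_mult_distrib del: of_nat_Suc)
    have head: "(\<Sum>n<N. (cmod (?x n))\<^sup>2) \<le> (\<Sum>n<N. h\<^sup>2)"
    proof (rule sum_mono)
      fix n assume "n \<in> {..<N}"
      then have "cmod (?x n) \<le> h"
        using g(2)[of n] h by (cases "n = 0") (auto simp: F_def l_def)
      then show "(cmod (?x n))\<^sup>2 \<le> h\<^sup>2" by (intro power_mono) auto
    qed
    have "(\<Sum>n<N. h\<^sup>2) \<le> e\<^sup>2 / 4"
      using hsq mult_right_mono[of "real N" "real (Suc N)" "h\<^sup>2"] by simp
    then have "(\<Sum>n. (cmod (?x n))\<^sup>2) < e\<^sup>2"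
      using suminf_split_initial_segment[OF sm, of N] tail head N zero_less_power[OF e, of 2]
      by linarith
    moreover have "dist (Abs_ell2 (F l)) u = sqrt (\<Sum>n. (cmod (?x n))\<^sup>2)"
      by (simp add: dist_norm norm_ell2_def coord_Abs[OF Fm])
    ultimately have "dist (Abs_ell2 (F l)) u < sqrt (e\<^sup>2)"
      by (simp only: real_sqrt_less_iff)
    then show ?thesis using ll e by auto
  qed
  moreover have "countable ((\<lambda>l. Abs_ell2 (F l)) ` lists C)"
    using C(1) by blast
  ultimately show ?thesis by blast
qed

text \<open>Separability is what makes Borel measurability agree with strong measurability, and what the
  Bochner integral of the library requires.\<close>

instance ell2 :: second_countable_topology
proof
  obtain D :: "ell2 set" where D: "countable D" "\<And>u e. e > 0 \<Longrightarrow> \<exists>d\<in>D. dist d u < e"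
    using ell2_countable_dense by blast
  define B where "B = (\<lambda>(d, n). ball d (1 / real (Suc n))) ` (D \<times> (UNIV :: nat set))"
  have "countable B" unfolding B_def using D(1) by auto
  moreover have "topological_basis B"
  proof (rule topological_basisI)
    fix b assume "b \<in> B" then show "open b" by (auto simp: B_def)
  next
    fix U :: "ell2 set" and u assume U: "open U" "u \<in> U"
    then obtain e where e: "e > 0" "ball u e \<subseteq> U" using open_contains_ball by blast
    obtain n where n: "1 / real (Suc n) < e / 2"
      using e(1) nat_approx_posE[of "e / 2"] by (metis half_gt_zero)
    obtain d where d: "d \<in> D" "dist d u < 1 / real (Suc n)"
      using D(2)[of "1 / real (Suc n)" u] by auto
    have "ball d (1 / real (Suc n)) \<subseteq> ball u e"
    proof
      fix y assume "y \<in> ball d (1 / real (Suc n))"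
      then have "dist d y < 1 / real (Suc n)" by simp
      then have "dist u y < e"
        using dist_triangle[of u y d] d(2) n by (simp add: dist_commute)
      then show "y \<in> ball u e" by simp
    qed
    moreover have "ball d (1 / real (Suc n)) \<in> B" using d(1) by (force simp: B_def)
    moreover have "u \<in> ball d (1 / real (Suc n))" using d(2) by simp
    ultimately show "\<exists>B'\<in>B. u \<in> B' \<and> B' \<subseteq> U" using e(2) by blast
  qed
  ultimately show "\<exists>B :: ell2 set set. countable B \<and> open = generate_topology B"
    using topological_basis_imp_subbasis by blast
qed

text \<open>The default value \<open>0\<close> is never used for the arguments occurring in the equation: see
  \<open>coord_shell_A\<close>, \<open>coord_mult_ind\<close> and \<open>coord_shell_B\<close> below.\<close>

definition ell2_of :: "(nat \<Rightarrow> complex) \<Rightarrow> ell2" where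
  "ell2_of x = (if x \<in> ell2_seqs then Abs_ell2 x else 0)"

lemma coord_ell2_of: "x \<in> ell2_seqs \<Longrightarrow> coord (ell2_of x) = x"
  by (simp add: ell2_of_def coord_Abs)


section \<open>The sabra shell model\<close>

definition wavenumber :: "real \<Rightarrow> real \<Rightarrow> nat \<Rightarrow> real" where
  "wavenumber k0 q n = k0 * q ^ n"

definition shell_A_seq :: "real \<Rightarrow> real \<Rightarrow> ell2 \<Rightarrow> nat \<Rightarrow> complex" where
  "shell_A_seq k0 q u n = of_real ((wavenumber k0 q n)\<^sup>2) * coord u n"

definition dom_A :: "real \<Rightarrow> real \<Rightarrow> ell2 set" where
  "dom_A k0 q = {u. summable (\<lambda>n. (cmod (shell_A_seq k0 q u n))\<^sup>2)}"

definition shell_A :: "real \<Rightarrow> real \<Rightarrow> ell2 \<Rightarrow> ell2" where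
  "shell_A k0 q u = ell2_of (shell_A_seq k0 q u)"

lemma coord_shell_A: "u \<in> dom_A k0 q \<Longrightarrow> coord (shell_A k0 q u) = shell_A_seq k0 q u"
  by (simp add: shell_A_def coord_ell2_of ell2_seqs_def dom_A_def shell_A_seq_def)

text \<open>The third constant \<open>c\<close> of the model has been eliminated through \<open>a + b + c = 0\<close>, so it does
  not occur in the nonlinearity.\<close>

definition shell_B_seq ::
  "real \<Rightarrow> real \<Rightarrow> real \<Rightarrow> real \<Rightarrow> ell2 \<Rightarrow> ell2 \<Rightarrow> nat \<Rightarrow> complex" where
  "shell_B_seq k0 q a b u v n =
    (if n = 0 then 0
     else - \<i> *
       (of_real (a * wavenumber k0 q (n + 1)) * coord v (n + 2) * cnj (coord u (n + 1))
      + of_real (b * wavenumber k0 q n) * coord v (n + 1) * cnj (coord u (n - 1))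
      + of_real (a * wavenumber k0 q (n - 1)) * coord u (n - 1) * coord v (n - 2)
      + of_real (b * wavenumber k0 q (n - 1)) * coord v (n - 1) * coord u (n - 2)))"

definition shell_B :: "real \<Rightarrow> real \<Rightarrow> real \<Rightarrow> real \<Rightarrow> ell2 \<Rightarrow> ell2 \<Rightarrow> ell2" where
  "shell_B k0 q a b u v = ell2_of (shell_B_seq k0 q a b u v)"

lemma wavenumber_coord_bounded:
  assumes "k0 > 0" "q > 1" "u \<in> dom_A k0 q"
  obtains M where "M \<ge> 0" "\<And>n. wavenumber k0 q n * cmod (coord u n) \<le> M"
proof
  let ?M = "norm (shell_A k0 q u) / k0"
  show "?M \<ge> 0" using assms(1) by simp
  fix n
  let ?k = "wavenumber k0 q n"
  have k: "k0 \<le> ?k" using assms by (simp add: wavenumber_def)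
  have "?k * (k0 * cmod (coord u n)) \<le> ?k * (?k * cmod (coord u n))"
    using k assms(1) by (intro mult_left_mono mult_right_mono) auto
  also have "\<dots> = cmod (coord (shell_A k0 q u) n)"
    by (simp add: coord_shell_A[OF assms(3)] shell_A_seq_def norm_mult norm_power power2_eq_square)
  also have "\<dots> \<le> norm (shell_A k0 q u)" by (rule cmod_coord_le)
  finally show "?k * cmod (coord u n) \<le> ?M"
    using assms(1) by (simp add: field_simps)
qed

lemma coord_shell_B:
  assumes "k0 > 0" "q > 1" "u \<in> dom_A k0 q"
  shows "coord (shell_B k0 q a b u v) = shell_B_seq k0 q a b u v"
proof -
  let ?k = "wavenumber k0 q"
  obtain M where M: "M \<ge> 0" "\<And>n. ?k n * cmod (coord u n) \<le> M"
    by (rule wavenumber_coord_bounded[OF assms]) blast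
  have kpos: "?k n \<ge> 0" for n using assms by (simp add: wavenumber_def)
  have kS: "?k (Suc n) = q * ?k n" for n by (simp add: wavenumber_def)
  have M1: "?k n * cmod (coord u (n - 1)) \<le> q * M" for n
  proof (cases n)
    case 0 then show ?thesis using M assms by simp
  next
    case (Suc m) then show ?thesis
      using mult_left_mono[OF M(2)[of m], of q] assms by (simp add: kS mult.assoc)
  qed
  define w1 where "w1 = (\<lambda>n. if n = 0 then 0 else coord v (n + 2))"
  define w2 where "w2 = (\<lambda>n. if n = 0 then 0 else coord v (n + 1))"
  define w3 where "w3 = (\<lambda>n. coord v (n - 2))"
  define w4 where "w4 = (\<lambda>n. coord v (n - 1))"
  have shift_up: "(\<lambda>n. if n = 0 then 0 else coord v (n + j)) \<in> ell2_seqs" for j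
  proof -
    have "summable (\<lambda>n. (cmod (coord v (n + j)))\<^sup>2)"
      using summable_iff_shift[of "\<lambda>n. (cmod (coord v n))\<^sup>2" j] summable_coord by simp
    then have "summable (\<lambda>n. (cmod (if n = 0 then 0 else coord v (n + j)))\<^sup>2)"
      by (rule summable_comparison_test'[where N = 0]) auto
    then show ?thesis by (simp add: ell2_seqs_def)
  qed
  have shift_down: "(\<lambda>n. coord v (n - j)) \<in> ell2_seqs" for j
  proof -
    have "summable (\<lambda>n. (cmod (coord v (n + j - j)))\<^sup>2)"
      using summable_coord by simp
    then have "summable (\<lambda>n. (cmod (coord v (n - j)))\<^sup>2)"
      using summable_iff_shift[of "\<lambda>n. (cmod (coord v (n - j)))\<^sup>2" j] by simp
    then show ?thesis by (simp add: ell2_seqs_def)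
  qed
  have t1: "(\<lambda>n. of_real (a * ?k (n + 1)) * w1 n * cnj (coord u (n + 1))) \<in> ell2_seqs"
  proof (rule ell2_seqs_comparison[OF shift_up[of 2], where M = "\<bar>a\<bar> * M"])
    fix n
    have "\<bar>a\<bar> * (?k (n + 1) * cmod (coord u (n + 1))) * cmod (w1 n) \<le> \<bar>a\<bar> * M * cmod (w1 n)"
      by (intro mult_right_mono mult_left_mono M) auto
    then show "cmod (of_real (a * ?k (n + 1)) * w1 n * cnj (coord u (n + 1)))
        \<le> \<bar>a\<bar> * M * cmod (if n = 0 then 0 else coord v (n + 2))"
      using kpos by (simp add: norm_mult w1_def abs_mult algebra_simps)
  qed (simp add: w1_def)
  have t2: "(\<lambda>n. of_real (b * ?k n) * w2 n * cnj (coord u (n - 1))) \<in> ell2_seqs"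
  proof (rule ell2_seqs_comparison[OF shift_up[of 1], where M = "\<bar>b\<bar> * (q * M)"])
    fix n
    have "\<bar>b\<bar> * (?k n * cmod (coord u (n - 1))) * cmod (w2 n) \<le> \<bar>b\<bar> * (q * M) * cmod (w2 n)"
      by (intro mult_right_mono mult_left_mono M1) auto
    then show "cmod (of_real (b * ?k n) * w2 n * cnj (coord u (n - 1)))
        \<le> \<bar>b\<bar> * (q * M) * cmod (if n = 0 then 0 else coord v (n + 1))"
      using kpos by (simp add: norm_mult w2_def abs_mult algebra_simps)
  qed (simp add: w2_def)
  have t3: "(\<lambda>n. of_real (a * ?k (n - 1)) * coord u (n - 1) * w3 n) \<in> ell2_seqs"
  proof (rule ell2_seqs_comparison[OF shift_down[of 2], where M = "\<bar>a\<bar> * M"])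
    fix n
    have "\<bar>a\<bar> * (?k (n - 1) * cmod (coord u (n - 1))) * cmod (w3 n) \<le> \<bar>a\<bar> * M * cmod (w3 n)"
      by (intro mult_right_mono mult_left_mono M) auto
    then show "cmod (of_real (a * ?k (n - 1)) * coord u (n - 1) * w3 n)
        \<le> \<bar>a\<bar> * M * cmod (coord v (n - 2))"
      using kpos by (simp add: norm_mult w3_def abs_mult algebra_simps)
  qed (simp add: w3_def)
  have t4: "(\<lambda>n. of_real (b * ?k (n - 1)) * w4 n * coord u (n - 2)) \<in> ell2_seqs"
  proof (rule ell2_seqs_comparison[OF shift_down[of 1], where M = "\<bar>b\<bar> * (q * M)"])
    fix n
    have "\<bar>b\<bar> * (?k (n - 1) * cmod (coord u (n - 1 - 1))) * cmod (w4 n)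
        \<le> \<bar>b\<bar> * (q * M) * cmod (w4 n)"
      by (intro mult_right_mono mult_left_mono M1) auto
    then show "cmod (of_real (b * ?k (n - 1)) * w4 n * coord u (n - 2))
        \<le> \<bar>b\<bar> * (q * M) * cmod (coord v (n - 1))"
      using kpos by (simp add: norm_mult w4_def abs_mult algebra_simps numeral_2_eq_2)
  qed (simp add: w4_def)
  have "shell_B_seq k0 q a b u v = (\<lambda>n. - \<i> *
       (of_real (a * ?k (n + 1)) * w1 n * cnj (coord u (n + 1))
      + of_real (b * ?k n) * w2 n * cnj (coord u (n - 1))
      + of_real (a * ?k (n - 1)) * coord u (n - 1) * w3 n
      + of_real (b * ?k (n - 1)) * w4 n * coord u (n - 2)))"
    by (rule ext) (simp add: shell_B_seq_def w1_def w2_def w3_def w4_def)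
  also have "\<dots> \<in> ell2_seqs"
    by (intro ell2_seqs_cmult ell2_seqs_add t1 t2 t3 t4)
  finally show ?thesis by (simp add: shell_B_def coord_ell2_of)
qed


section \<open>Projections, the multiplication operator and the feedback law\<close>

text \<open>The library's \<open>closest_point\<close> is restricted to spaces satisfying the Heine-Borel property,
  which \<open>ell2\<close> does not.\<close>

definition proj_on :: "ell2 set \<Rightarrow> ell2 \<Rightarrow> ell2" where
  "proj_on K u = (THE v. v \<in> K \<and> (\<forall>w\<in>K. dist u v \<le> dist u w))"

definition dist_to :: "ell2 set \<Rightarrow> ell2 \<Rightarrow> real" where
  "dist_to K u = norm (u - proj_on K u)"

definition mult_ind :: "nat set \<Rightarrow> ell2 \<Rightarrow> ell2" where
  "mult_ind \<omega> u = ell2_of (\<lambda>n. if n \<in> \<omega> then coord u n else 0)"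

lemma coord_mult_ind: "coord (mult_ind \<omega> u) = (\<lambda>n. if n \<in> \<omega> then coord u n else 0)"
  unfolding mult_ind_def
  by (intro coord_ell2_of ell2_seqs_comparison[OF coord_mem[of u], where M = 1]) auto

definition feedback :: "ell2 set \<Rightarrow> nat set \<Rightarrow> real \<Rightarrow> ell2 \<Rightarrow> ell2" where
  "feedback K \<omega> lam u = - (1 / lam) *\<^sub>R (mult_ind \<omega> u - mult_ind \<omega> (proj_on K u))"


section \<open>Vector-valued Lebesgue and Sobolev spaces on a time interval\<close>

definition in_Lp :: "ennreal \<Rightarrow> real \<Rightarrow> (real \<Rightarrow> ell2) \<Rightarrow> bool" where
  "in_Lp p T u \<longleftrightarrow> u \<in> borel_measurable (lebesgue_on {0..T}) \<and>
    (if p = \<infinity> then \<exists>M. AE t in lebesgue_on {0..T}. norm (u t) \<le> M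
     else (\<integral>\<^sup>+ t. ennreal (norm (u t) powr enn2real p) \<partial>lebesgue_on {0..T}) < \<infinity>)"

text \<open>
  \<open>u'\<close> is the derivative \<open>du/dt\<close> of the absolutely continuous function \<open>u\<close> on \<open>[0, T]\<close>: \<open>u\<close> is the
  primitive of the Bochner integrable \<open>u'\<close>, and \<open>u'\<close> is also its strong derivative almost
  everywhere.
\<close>

definition ac_deriv :: "real \<Rightarrow> (real \<Rightarrow> ell2) \<Rightarrow> (real \<Rightarrow> ell2) \<Rightarrow> bool" where
  "ac_deriv T u u' \<longleftrightarrow>
     set_integrable lebesgue {0..T} u' \<and>
     (\<forall>t\<in>{0..T}. u t = u 0 + (LINT s:{0..t}|lebesgue. u' s)) \<and>
     (AE t in lebesgue_on {0..T}. (u has_vector_derivative u' t) (at t within {0..T}))"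

text \<open>Elements of \<open>W\<^sup>1\<^sup>,\<^sup>p([0, T], H)\<close> are identified with their absolutely continuous
  representatives, so that point values such as \<open>u 0\<close> make sense.\<close>

definition in_W1p :: "ennreal \<Rightarrow> real \<Rightarrow> (real \<Rightarrow> ell2) \<Rightarrow> bool" where
  "in_W1p p T u \<longleftrightarrow> (\<exists>u'. ac_deriv T u u' \<and> in_Lp p T u \<and> in_Lp p T u')"

text \<open>\<open>D(A)\<close> is normed by \<open>|A u|\<close>, so \<open>A\<close> is an isometry of \<open>D(A)\<close> onto \<open>H\<close>, and the measurability
  and norm bound of a \<open>D(A)\<close>-valued function are those of its image under \<open>A\<close>.\<close>

definition in_Linf_dom_A :: "real \<Rightarrow> real \<Rightarrow> real \<Rightarrow> (real \<Rightarrow> ell2) \<Rightarrow> bool" where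
  "in_Linf_dom_A k0 q T u \<longleftrightarrow>
     (AE t in lebesgue_on {0..T}. u t \<in> dom_A k0 q) \<and>
     in_Lp \<infinity> T (\<lambda>t. shell_A k0 q (u t))"

text \<open>Strong solutions: absolutely continuous, the equation holding in \<open>H\<close> almost everywhere
  (in particular the solution lies in \<open>D(A)\<close> almost everywhere).\<close>

definition closed_loop_solution ::
  "real \<Rightarrow> real \<Rightarrow> real \<Rightarrow> real \<Rightarrow> real \<Rightarrow> real \<Rightarrow> (ell2 \<Rightarrow> ell2) \<Rightarrow> (real \<Rightarrow> ell2) \<Rightarrow> ell2
     \<Rightarrow> (real \<Rightarrow> ell2) \<Rightarrow> bool" where
  "closed_loop_solution T \<nu> k0 q a b g f u0 u \<longleftrightarrow>
     u 0 = u0 \<and>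
     (\<exists>u'. ac_deriv T u u' \<and>
       (AE t in lebesgue_on {0..T}. u t \<in> dom_A k0 q \<and>
          u' t + \<nu> *\<^sub>R shell_A k0 q (u t) + shell_B k0 q a b (u t) (u t) = f t + g (u t)))"

end

theory Submission
  imports Defs
begin

text \<open>
  Writing \<open>B u = A\<^sup>1\<^sup>/\<^sup>2 \<beta>(u, u)\<close> with \<open>\<beta>\<close> bounded and bilinear on \<open>H\<close>, the equation becomes mode by mode
  \<open>u\<^sub>n' = - \<nu> k\<^sub>n\<^sup>2 u\<^sub>n + k\<^sub>n N\<^sub>n(t, u)\<close>, and Young's inequality in each mode shows that this evolution is a
  contraction in \<open>C([0, \<tau>]; H)\<close> for small \<open>\<tau>\<close> as soon as \<open>N\<close> is Lipschitz on \<open>H\<close>; so after a radial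
  truncation of \<open>\<beta>\<close> the Picard iterates converge, without any Galerkin approximation. The same estimate
  applied to time increments makes the solution Lipschitz in time, and reading the equation mode by mode turns
  this into a bound of \<open>A u\<close> in \<open>H\<close>. Then \<open>Re (B u, u) = 0\<close> holds, and \<open>0 \<in> K\<close> together with
  \<open>P\<^sub>K m = m P\<^sub>K\<close> gives \<open>Re (g\<^sub>\<lambda> u, u) \<le> - d\<^sub>K(m u)\<^sup>2 / \<lambda>\<close>. Hence the energy bound, which is uniform in \<open>\<lambda>\<close>,
  both removes the truncation and controls the penalty term.
\<close>

section \<open>The sequence space\<close>

text \<open>In general \<open>B\<close> does not map \<open>H\<close> into \<open>H\<close>: it
  costs one factor \<open>k n\<close>, so the equation is not an ordinary differential equation in
  \<open>H\<close> with a locally Lipschitz right side. The dissipation pays for exactly one such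
  factor, with a remainder that does not depend on the mode; this is the origin of the
  \<open>1 / (2 * \<nu>)\<close> below. The price is that the cancellation in the energy is out of
  reach at this level, because it needs \<open>A\<^sup>1\<^sup>/\<^sup>2 u\<close> in
  \<open>H\<close>. Regularity therefore has to precede the energy bound. It is proved for the
  truncated equation with constants that may depend on \<lambda> and on the radius, and the
  truncation is a scalar factor so that the cancellation survives it. The data enter through time
  increments: \<open>u0\<close> in \<open>D(A)\<close> makes the initial velocity an element of
  \<open>H\<close>, and \<open>f\<close> in \<open>W\<^sup>1\<^sup>,\<^sup>2\<close> makes the
  squared increments of \<open>f\<close> over a step \<open>h\<close> integrate to order
  \<open>h\<^sup>2\<close>.\<close>

lemma Abs_coord [simp]: "Abs_ell2 (coord u) = u"
  by (rule coord_inverse)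

lemma bounded_linear_coord: "bounded_linear (\<lambda>u. coord u n)"
  by (rule bounded_linear_intro[where K = 1]) (auto simp: cmod_coord_le)

lemmas continuous_on_coord [continuous_intros] =
  bounded_linear.continuous_on[OF bounded_linear_coord]

lemma inner_ell2_sums: "(\<lambda>n. inner (coord u n) (coord v n)) sums inner u v" for u v :: ell2
proof -
  have "inner (coord u n) (coord v n) = Re (coord u n * cnj (coord v n))" for n
    by (simp add: inner_complex_def)
  then show ?thesis
    unfolding inner_ell2_def using summable_sums[OF summable_coord_prod[of u v]] by simp
qed

lemma norm_ell2_sums: "(\<lambda>n. (cmod (coord u n))\<^sup>2) sums (norm u)\<^sup>2" for u :: ell2
  unfolding ell2_norm_power2 by (rule summable_sums[OF summable_coord])

lemma norm_leI:
  assumes "\<And>N. (\<Sum>n<N. (cmod (coord u n))\<^sup>2) \<le> B\<^sup>2" "0 \<le> B"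
  shows "norm (u :: ell2) \<le> B"
  using ell2_of_partial_bounds(2)[of "coord u" B] assms by simp

lemma norm_le_coordwise:
  assumes "\<And>n. cmod (coord u n) \<le> c * cmod (coord v n)" "0 \<le> c"
  shows "norm (u :: ell2) \<le> c * norm v"
proof (rule norm_leI)
  fix N
  have "(\<Sum>n<N. (cmod (coord u n))\<^sup>2) \<le> (\<Sum>n<N. c\<^sup>2 * (cmod (coord v n))\<^sup>2)"
    by (intro sum_mono) (metis assms(1) norm_ge_zero power_mono power_mult_distrib)
  also have "\<dots> = c\<^sup>2 * (\<Sum>n<N. (cmod (coord v n))\<^sup>2)" by (simp add: sum_distrib_left)
  also have "\<dots> \<le> c\<^sup>2 * (norm v)\<^sup>2" by (intro mult_left_mono ell2_partial_le) auto
  finally show "(\<Sum>n<N. (cmod (coord u n))\<^sup>2) \<le> (c * norm v)\<^sup>2" by (simp add: power_mult_distrib)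
qed (use assms in auto)

text \<open>\<open>mult_ind\<close> has a second role besides the control region: with
  \<open>{..<N}\<close> it cuts off all but the first modes, so that finite sums over modes become
  norms in \<open>H\<close>.\<close>

lemma norm_mult_ind_finite:
  assumes "finite S"
  shows "(norm (mult_ind S u))\<^sup>2 = (\<Sum>n\<in>S. (cmod (coord u n))\<^sup>2)"
proof -
  have "(\<Sum>n. (cmod (coord (mult_ind S u) n))\<^sup>2) = (\<Sum>n\<in>S. (cmod (coord (mult_ind S u) n))\<^sup>2)"
    by (rule suminf_finite) (use assms in \<open>auto simp: coord_mult_ind\<close>)
  then show ?thesis by (simp add: ell2_norm_power2 coord_mult_ind)
qed

lemma bounded_linear_mult_ind: "bounded_linear (mult_ind S)"
proof (rule bounded_linear_intro[where K = 1])
  show "norm (mult_ind S u) \<le> norm u * 1" for u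
    using norm_le_coordwise[of "mult_ind S u" 1 u] by (simp add: coord_mult_ind)
qed (auto intro!: ell2_eqI simp: coord_mult_ind)

lemma norm_mult_ind_le: "norm (mult_ind S u) \<le> norm u"
  using norm_le_coordwise[of "mult_ind S u" 1 u] by (simp add: coord_mult_ind)

lemma mult_ind_diff: "mult_ind S (u - v) = mult_ind S u - mult_ind S v"
  using bounded_linear_mult_ind by (rule bounded_linear.linear[THEN linear_diff])

lemma inner_mult_ind_finite:
  assumes "finite S"
  shows "inner (mult_ind S u) v = (\<Sum>n\<in>S. inner (coord u n) (coord v n))"
proof -
  have "(\<lambda>n. inner (coord (mult_ind S u) n) (coord v n)) sums
      (\<Sum>n\<in>S. inner (coord (mult_ind S u) n) (coord v n))"
    by (rule sums_finite) (use assms in \<open>auto simp: coord_mult_ind\<close>)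
  then have "inner (mult_ind S u) v = (\<Sum>n\<in>S. inner (coord (mult_ind S u) n) (coord v n))"
    using inner_ell2_sums sums_unique2 by blast
  then show ?thesis by (simp add: coord_mult_ind)
qed

lemma inner_mult_ind_left: "inner (mult_ind S u) (mult_ind S v) = inner (mult_ind S u) v"
proof -
  have "(\<lambda>n. inner (coord (mult_ind S u) n) (coord (mult_ind S v) n)) =
      (\<lambda>n. inner (coord (mult_ind S u) n) (coord v n))"
    by (auto simp: coord_mult_ind)
  then show ?thesis
    using sums_unique2[OF inner_ell2_sums[of "mult_ind S u" "mult_ind S v"]]
      inner_ell2_sums[of "mult_ind S u" v] by simp
qed

lemma norm_diff_sq: "(norm (u - v))\<^sup>2 = (norm u)\<^sup>2 + (norm v)\<^sup>2 - 2 * inner u v"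
  for u v :: "'a :: real_inner"
proof -
  have "inner (u - v) (u - v) = inner u u + inner v v - 2 * inner u v"
    using inner_commute[of v u] by (simp only: inner_diff_left inner_diff_right)
  then show ?thesis by (simp only: power2_norm_eq_inner)
qed

text \<open>By Pythagoras the squared error is the tail of the series for
  \<open>(norm u)\<^sup>2\<close>.\<close>

lemma mult_ind_lessThan_tendsto: "(\<lambda>N. mult_ind {..<N} u) \<longlonglongrightarrow> u"
proof -
  have eq: "(norm (mult_ind {..<N} u - u))\<^sup>2 = (norm u)\<^sup>2 - (\<Sum>n<N. (cmod (coord u n))\<^sup>2)" for N
  proof -
    have "inner (mult_ind {..<N} u) u = (\<Sum>n<N. (cmod (coord u n))\<^sup>2)"
      by (simp add: inner_mult_ind_finite dot_square_norm)
    then show ?thesis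
      using norm_diff_sq[of "mult_ind {..<N} u" u] norm_mult_ind_finite[of "{..<N}" u, OF finite_lessThan] by linarith
  qed
  have "(\<lambda>N. (norm u)\<^sup>2 - (\<Sum>n<N. (cmod (coord u n))\<^sup>2)) \<longlonglongrightarrow> (norm u)\<^sup>2 - (norm u)\<^sup>2"
    using norm_ell2_sums[of u] unfolding sums_def by (intro tendsto_intros)
  then have "(\<lambda>N. (norm (mult_ind {..<N} u - u))\<^sup>2) \<longlonglongrightarrow> 0" by (simp add: eq)
  from tendsto_real_sqrt[OF this] have "(\<lambda>N. norm (mult_ind {..<N} u - u)) \<longlonglongrightarrow> 0" by simp
  then show ?thesis by (rule LIM_zero_cancel[OF tendsto_norm_zero_cancel])
qed

lemma continuous_on_mult_ind_finite:
  assumes "\<And>n. continuous_on X (\<lambda>t. coord (w t) n)" "finite S"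
  shows "continuous_on X (\<lambda>t. mult_ind S (w t))"
  unfolding continuous_on_def
proof
  fix s assume s: "s \<in> X"
  have "((\<lambda>t. \<Sum>n\<in>S. (cmod (coord (w t) n - coord (w s) n))\<^sup>2) \<longlongrightarrow>
      (\<Sum>n\<in>S. (cmod (coord (w s) n - coord (w s) n))\<^sup>2)) (at s within X)"
    by (intro tendsto_intros) (use assms(1) s in \<open>auto simp: continuous_on_def\<close>)
  moreover have "(\<Sum>n\<in>S. (cmod (coord (w t) n - coord (w s) n))\<^sup>2)
      = (norm (mult_ind S (w t) - mult_ind S (w s)))\<^sup>2" for t
    using norm_mult_ind_finite[OF assms(2), of "w t - w s"] by (simp add: mult_ind_diff)
  ultimately have "((\<lambda>t. (norm (mult_ind S (w t) - mult_ind S (w s)))\<^sup>2) \<longlongrightarrow> 0) (at s within X)"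
    by simp
  from tendsto_real_sqrt[OF this]
  have "((\<lambda>t. norm (mult_ind S (w t) - mult_ind S (w s))) \<longlongrightarrow> 0) (at s within X)" by simp
  then show "((\<lambda>t. mult_ind S (w t)) \<longlongrightarrow> mult_ind S (w s)) (at s within X)"
    by (rule LIM_zero_cancel[OF tendsto_norm_zero_cancel])
qed

text \<open>\<open>A u\<close> and the velocity will be known to be continuous mode by mode only,
  which does not give continuity in norm. Measurability survives: the truncations are norm
  continuous and converge pointwise.\<close>

lemma borel_measurable_coordwise:
  assumes "\<And>n. continuous_on {0..T} (\<lambda>t. coord (w t) n)"
  shows "w \<in> borel_measurable (lebesgue_on {0..T::real})"
proof (rule borel_measurable_LIMSEQ_metric)
  show "(\<lambda>t. mult_ind {..<N} (w t)) \<in> borel_measurable (lebesgue_on {0..T})" for N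
    by (intro continuous_imp_measurable_on_sets_lebesgue continuous_on_mult_ind_finite assms) auto
qed (rule mult_ind_lessThan_tendsto)

section \<open>Projection onto a closed convex set\<close>

text \<open>Two points of \<open>K\<close> that are both nearly nearest to \<open>u\<close> must be
  close to each other, because their midpoint lies in \<open>K\<close> and cannot be much
  nearer.\<close>

lemma parallelogram_midpoint:
  fixes u v w :: "'a :: real_inner"
  shows "(norm (v - w))\<^sup>2 = 2 * (norm (u - v))\<^sup>2 + 2 * (norm (u - w))\<^sup>2
    - 4 * (norm (u - (1/2) *\<^sub>R (v + w)))\<^sup>2"
proof -
  have "u - (1/2) *\<^sub>R (v + w) = (1/2) *\<^sub>R ((u - v) + (u - w))"
  proof -
    have "u = (1/2) *\<^sub>R (u + u)" by simp
    then show ?thesis by (simp add: scaleR_add_right scaleR_diff_right)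
  qed
  then have "4 * (norm (u - (1/2) *\<^sub>R (v + w)))\<^sup>2 = (norm ((u - v) + (u - w)))\<^sup>2"
    by (simp add: power2_eq_square)
  moreover have "(norm (v - w))\<^sup>2 = (norm ((u - v) - (u - w)))\<^sup>2"
    by (simp add: norm_minus_commute)
  ultimately show ?thesis
    using norm_diff_sq[of "u - v" "u - w"] dot_norm[of "u - v" "u - w"] by (simp add: field_simps)
qed

lemma convex_midpoint:
  assumes "convex K" "v \<in> K" "w \<in> K"
  shows "(1/2) *\<^sub>R (v + w) \<in> K"
  using convexD[OF assms, of "1/2" "1/2"] by (simp add: scaleR_add_right)

lemma ex1_nearest_point:
  fixes K :: "'a :: {real_inner, complete_space} set"
  assumes "closed K" "convex K" "K \<noteq> {}"
  shows "\<exists>!v. v \<in> K \<and> (\<forall>w\<in>K. dist u v \<le> dist u w)"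
proof (rule ex_ex1I)
  define d where "d = Inf ((\<lambda>w. norm (u - w)) ` K)"
  have bdd: "bdd_below ((\<lambda>w. norm (u - w)) ` K)" by (rule bdd_belowI2[where m = 0]) simp
  have d_le: "d \<le> norm (u - w)" if "w \<in> K" for w
    unfolding d_def by (rule cINF_lower[OF bdd that])
  have d0: "0 \<le> d" unfolding d_def by (rule cINF_greatest) (use assms in auto)
  have "\<exists>w\<in>K. norm (u - w) < d + 1 / Suc n" for n
  proof -
    have "Inf ((\<lambda>w. norm (u - w)) ` K) < d + 1 / Suc n" by (simp add: d_def)
    then show ?thesis using cINF_less_iff[OF assms(3) bdd] by blast
  qed
  then obtain X where X: "\<And>n. X n \<in> K" "\<And>n. norm (u - X n) < d + 1 / Suc n" by metis
  \<comment> \<open>Being within \<open>1 / Suc N\<close> of the infimum, each point has squared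
    distance at most \<open>d\<^sup>2 + (2 * d + 1) / Suc N\<close>; the parallelogram identity
    multiplies the excess by 4.\<close>
  have est: "(norm (X m - X n))\<^sup>2 \<le> (8 * d + 4) / Suc N" if "N \<le> m" "N \<le> n" for m n N
  proof -
    have sq: "(norm (u - X j))\<^sup>2 \<le> d\<^sup>2 + (2 * d + 1) / Suc N" if "N \<le> j" for j
    proof -
      define e where "e = 1 / real (Suc N)"
      have "1 / Suc j \<le> e" using that by (simp add: e_def frac_le)
      then have "norm (u - X j) \<le> d + e" using X(2)[of j] by linarith
      then have "(norm (u - X j))\<^sup>2 \<le> (d + e)\<^sup>2" by (intro power_mono) auto
      also have "\<dots> = d\<^sup>2 + 2 * d * e + e * e" by (simp add: power2_eq_square algebra_simps)
      also have "e * e \<le> 1 * e" by (intro mult_right_mono) (auto simp: e_def)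
      also have "d\<^sup>2 + 2 * d * e + 1 * e = d\<^sup>2 + (2 * d + 1) / Suc N" by (simp add: e_def add_divide_distrib)
      finally show ?thesis by simp
    qed
    have "d\<^sup>2 \<le> (norm (u - (1/2) *\<^sub>R (X m + X n)))\<^sup>2"
      using d_le[OF convex_midpoint[OF assms(2) X(1) X(1)]] d0 by (intro power_mono) auto
    moreover have "(8 * d + 4) / Suc N = 4 * ((2 * d + 1) / Suc N)" by (simp add: algebra_simps)
    ultimately show ?thesis
      using sq[OF that(1)] sq[OF that(2)] parallelogram_midpoint[of "X m" "X n" u] by linarith
  qed
  have "Cauchy X"
  proof (rule metric_CauchyI)
    fix e :: real assume e: "0 < e"
    obtain N where N: "(8 * d + 4) / Suc N < e\<^sup>2"
    proof -
      obtain N where "(8 * d + 4) / e\<^sup>2 < real N" using reals_Archimedean2 by blast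
      then have "8 * d + 4 < e\<^sup>2 * real N" using e by (simp add: divide_less_eq mult.commute)
      also have "\<dots> \<le> e\<^sup>2 * real (Suc N)" by (intro mult_left_mono) auto
      finally show ?thesis using that[of N] by (simp add: divide_less_eq)
    qed
    have "dist (X m) (X n) < e" if "N \<le> m" "N \<le> n" for m n
    proof -
      have "(norm (X m - X n))\<^sup>2 < e\<^sup>2" using est[OF that] N by linarith
      then show ?thesis using e by (simp add: dist_norm power2_less_imp_less)
    qed
    then show "\<exists>M. \<forall>m\<ge>M. \<forall>n\<ge>M. dist (X m) (X n) < e" by blast
  qed
  then obtain v where v: "X \<longlonglongrightarrow> v" using Cauchy_convergent_iff convergent_def by blast
  have "v \<in> K" using closed_sequentially[OF assms(1) X(1) v] .
  moreover have "norm (u - v) \<le> d"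
  proof (rule LIMSEQ_le)
    show "(\<lambda>n. norm (u - X n)) \<longlonglongrightarrow> norm (u - v)" by (intro tendsto_intros v)
    show "(\<lambda>n. d + 1 / Suc n) \<longlonglongrightarrow> d"
      using tendsto_add[OF tendsto_const[of d] LIMSEQ_inverse_real_of_nat] by (simp add: inverse_eq_divide)
    show "\<exists>N. \<forall>n\<ge>N. norm (u - X n) \<le> d + 1 / Suc n" using X(2) less_imp_le by blast
  qed
  ultimately show "\<exists>v. v \<in> K \<and> (\<forall>w\<in>K. dist u v \<le> dist u w)"
    using d_le by (force simp: dist_norm)
next
  fix v w
  assume v: "v \<in> K \<and> (\<forall>z\<in>K. dist u v \<le> dist u z)" and w: "w \<in> K \<and> (\<forall>z\<in>K. dist u w \<le> dist u z)"
  let ?z = "(1/2) *\<^sub>R (v + w)"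
  have "norm (u - v) \<le> norm (u - ?z)" "norm (u - w) \<le> norm (u - ?z)"
    using v w convex_midpoint[OF assms(2), of v w] by (auto simp: dist_norm)
  then have "(norm (u - v))\<^sup>2 \<le> (norm (u - ?z))\<^sup>2" "(norm (u - w))\<^sup>2 \<le> (norm (u - ?z))\<^sup>2"
    by (auto intro: power_mono)
  then have "(norm (v - w))\<^sup>2 \<le> 0" using parallelogram_midpoint[of v w u] by linarith
  then show "v = w" by simp
qed

context
  fixes K :: "ell2 set"
  assumes K: "closed K" "convex K" "K \<noteq> {}"
begin

lemma proj_on_mem: "proj_on K u \<in> K"
  and proj_on_nearest: "w \<in> K \<Longrightarrow> norm (u - proj_on K u) \<le> norm (u - w)"
  using theI'[OF ex1_nearest_point[OF K, of u]] by (auto simp: proj_on_def dist_norm)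

text \<open>The first-order condition of the minimisation: if the angle were acute, a small step
  from the projection towards \<open>w\<close> would stay in \<open>K\<close> and come closer to
  \<open>u\<close>.\<close>

lemma proj_on_variational:
  assumes "w \<in> K"
  shows "inner (u - proj_on K u) (w - proj_on K u) \<le> 0"
proof (rule ccontr)
  let ?p = "proj_on K u"
  let ?a = "inner (u - ?p) (w - ?p)" and ?b = "(norm (w - ?p))\<^sup>2"
  assume "\<not> ?a \<le> 0"
  then have a: "?a > 0" by simp
  \<comment> \<open>Minimality will give \<open>2 * ?a \<le> s * ?b\<close>, so \<open>s\<close> is
    taken small enough for \<open>s * ?b \<le> ?a\<close>. The cap at 1 keeps the step inside the
    segment.\<close>
  define s where "s = min 1 (?a / (?b + 1))"
  have b: "?b + 1 > 0" by (simp add: add_nonneg_pos)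
  have s: "0 < s" "s \<le> 1" using a b by (auto simp: s_def)
  have "?p + s *\<^sub>R (w - ?p) = (1 - s) *\<^sub>R ?p + s *\<^sub>R w" by (simp add: algebra_simps)
  also have "\<dots> \<in> K" using s assms proj_on_mem by (intro convexD[OF K(2)]) auto
  finally have "norm (u - ?p) \<le> norm (u - (?p + s *\<^sub>R (w - ?p)))" by (rule proj_on_nearest)
  then have "(norm (u - ?p))\<^sup>2 \<le> (norm ((u - ?p) - s *\<^sub>R (w - ?p)))\<^sup>2"
    by (intro power_mono) (auto simp: algebra_simps)
  also have "\<dots> = (norm (u - ?p))\<^sup>2 - 2 * s * ?a + s * (s * ?b)"
    unfolding power2_norm_eq_inner
    by (simp only: inner_diff_left inner_diff_right inner_scaleR_left inner_scaleR_right inner_commute)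
  finally have "2 * ?a \<le> s * ?b" using s by (simp add: power2_eq_square)
  also have "\<dots> \<le> ?a / (?b + 1) * (?b + 1)"
    by (intro mult_mono) (use a b in \<open>auto simp: s_def\<close>)
  also have "\<dots> = ?a" using b by simp
  finally show False using a by simp
qed

text \<open>Adding the variational inequalities at the two projections bounds
  \<open>(norm (?p - ?r))\<^sup>2\<close> by \<open>inner (u - v) (?p - ?r)\<close>.\<close>

lemma proj_on_nonexpansive: "norm (proj_on K u - proj_on K v) \<le> norm (u - v)"
proof -
  let ?p = "proj_on K u" and ?r = "proj_on K v"
  have "inner (u - ?p) (?r - ?p) \<le> 0" "inner (v - ?r) (?p - ?r) \<le> 0"
    by (auto intro: proj_on_variational proj_on_mem)
  then have "(norm (?p - ?r))\<^sup>2 \<le> inner (u - v) (?p - ?r)"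
    by (simp add: power2_norm_eq_inner inner_diff_left inner_diff_right inner_commute)
  also have "\<dots> \<le> norm (u - v) * norm (?p - ?r)" by (rule norm_cauchy_schwarz)
  finally show ?thesis
    by (cases "?p = ?r") (auto simp: power2_eq_square)
qed

end

section \<open>Estimates for single modes\<close>

lemma vector_derivative_mono:
  fixes f :: "real \<Rightarrow> real"
  assumes "a \<le> b" "\<And>t. t \<in> {a..b} \<Longrightarrow> (f has_vector_derivative f' t) (at t within {a..b})"
    and "\<And>t. t \<in> {a..b} \<Longrightarrow> f' t \<le> 0"
  shows "f b \<le> f a"
proof -
  have "(f' has_integral f b - f a) {a..b}"
    using assms by (intro fundamental_theorem_of_calculus) auto
  from has_integral_le[OF this has_integral_0] show ?thesis using assms(3) by simp
qed

text \<open>The majorant \<open>C + M * integral {0..s} \<phi>\<close> times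
  \<open>exp (- M * s)\<close> is nonincreasing. Only the majorant is differentiated, so continuity
  of \<phi> suffices.\<close>

lemma gronwall:
  fixes \<phi> :: "real \<Rightarrow> real"
  assumes cont: "continuous_on {0..\<tau>} \<phi>" and M: "0 \<le> M" and t: "t \<in> {0..\<tau>}"
    and le: "\<And>s. s \<in> {0..\<tau>} \<Longrightarrow> \<phi> s \<le> C + M * integral {0..s} \<phi>"
  shows "\<phi> t \<le> C * exp (M * t)"
proof -
  define \<Psi> where "\<Psi> s = C + M * integral {0..s} \<phi>" for s
  have c: "continuous_on {0..t} \<phi>" using cont by (rule continuous_on_subset) (use t in auto)
  have D: "((\<lambda>s. exp (- M * s) * \<Psi> s) has_vector_derivative
      exp (- M * s) * (M * \<phi> s) + (- M * exp (- M * s)) * \<Psi> s) (at s within {0..t})"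
    if "s \<in> {0..t}" for s
    unfolding \<Psi>_def has_real_derivative_iff_has_vector_derivative[symmetric]
    by (rule derivative_eq_intros refl integral_has_real_derivative[OF c that])+
       (auto simp: algebra_simps)
  have "exp (- M * t) * \<Psi> t \<le> exp (- M * 0) * \<Psi> 0"
  proof (rule vector_derivative_mono[OF _ D])
    fix s assume s: "s \<in> {0..t}"
    have "exp (- M * s) * (M * \<phi> s) + (- M * exp (- M * s)) * \<Psi> s
        = exp (- M * s) * M * (\<phi> s - \<Psi> s)" by (simp add: algebra_simps)
    also have "\<dots> \<le> 0"
      using le[of s] s t M by (intro mult_nonneg_nonpos) (auto simp: \<Psi>_def)
    finally show "exp (- M * s) * (M * \<phi> s) + (- M * exp (- M * s)) * \<Psi> s \<le> 0" .
  qed (use t in auto)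
  then have "exp (- M * t) * \<Psi> t \<le> C" by (simp add: \<Psi>_def)
  then have "exp (M * t) * (exp (- M * t) * \<Psi> t) \<le> exp (M * t) * C" by simp
  then have "\<Psi> t \<le> exp (M * t) * C" by (simp add: mult.assoc[symmetric] exp_add[symmetric])
  then show ?thesis using le[OF t] by (simp add: \<Psi>_def mult.commute)
qed

text \<open>This is \<open>0 \<le> (norm (b - (2 * \<nu> * \<kappa>) *\<^sub>R y))\<^sup>2\<close>
  expanded. The bound is free of \<kappa>, so the dissipation absorbs the factor in front of
  \<open>b\<close> equally well in all modes.\<close>

lemma young_modes:
  fixes y b :: "'a :: real_inner"
  assumes "0 < \<nu>"
  shows "2 * inner y (- (\<nu> * \<kappa>\<^sup>2) *\<^sub>R y + \<kappa> *\<^sub>R b) \<le> (norm b)\<^sup>2 / (2 * \<nu>)"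
proof -
  have "0 \<le> (norm (b - (2 * \<nu> * \<kappa>) *\<^sub>R y))\<^sup>2" by simp
  also have "\<dots> = (norm b)\<^sup>2 + (2 * \<nu> * \<kappa>)\<^sup>2 * (norm y)\<^sup>2 - 2 * (2 * \<nu> * \<kappa>) * inner b y"
    unfolding norm_diff_sq by (simp add: power_mult_distrib)
  also have "\<dots> = (norm b)\<^sup>2 - (2 * \<nu>) * (2 * (- (\<nu> * \<kappa>\<^sup>2) * (norm y)\<^sup>2 + \<kappa> * inner b y))"
    by (simp add: power2_eq_square algebra_simps)
  finally have "(2 * \<nu>) * (2 * (- (\<nu> * \<kappa>\<^sup>2) * (norm y)\<^sup>2 + \<kappa> * inner b y)) \<le> (norm b)\<^sup>2" by simp
  moreover have "inner y (- (\<nu> * \<kappa>\<^sup>2) *\<^sub>R y + \<kappa> *\<^sub>R b) = - (\<nu> * \<kappa>\<^sup>2) * (norm y)\<^sup>2 + \<kappa> * inner b y"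
    by (simp only: inner_add_right inner_scaleR_right power2_norm_eq_inner inner_commute)
  ultimately show ?thesis using assms by (simp add: le_divide_eq mult.commute)
qed

text \<open>The two sources are treated differently: \<open>\<kappa> *\<^sub>R b\<close> is absorbed
  at the cost of its square, while \<open>c\<close> stays paired with \<open>y\<close>, so that a
  sign or a cancellation in \<open>inner (c t) (y t)\<close> can still be exploited.\<close>

lemma mode_energy:
  fixes y b c :: "real \<Rightarrow> complex"
  assumes "0 \<le> \<tau>" "0 < \<nu>"
    and D: "\<And>t. t \<in> {0..\<tau>} \<Longrightarrow>
      (y has_vector_derivative (- (\<nu> * \<kappa>\<^sup>2) *\<^sub>R y t + \<kappa> *\<^sub>R b t + c t)) (at t within {0..\<tau>})"
    and b: "continuous_on {0..\<tau>} b" and c: "continuous_on {0..\<tau>} c"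
  shows "(cmod (y \<tau>))\<^sup>2 \<le> (cmod (y 0))\<^sup>2 +
    integral {0..\<tau>} (\<lambda>t. (cmod (b t))\<^sup>2 / (2 * \<nu>) + 2 * inner (c t) (y t))"
proof -
  have y: "continuous_on {0..\<tau>} y"
    using D by (meson continuous_on_eq_continuous_within has_vector_derivative_continuous)
  let ?r = "\<lambda>t. - (\<nu> * \<kappa>\<^sup>2) *\<^sub>R y t + \<kappa> *\<^sub>R b t + c t"
  have "((\<lambda>t. inner (y t) (y t)) has_vector_derivative inner (y t) (?r t) + inner (?r t) (y t))
      (at t within {0..\<tau>})" if "t \<in> {0..\<tau>}" for t
    by (rule bounded_bilinear.has_vector_derivative[OF bounded_bilinear_inner D D]) (use that in auto)
  then have "((\<lambda>t. inner (y t) (?r t) + inner (?r t) (y t)) has_integral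
      inner (y \<tau>) (y \<tau>) - inner (y 0) (y 0)) {0..\<tau>}"
    using assms(1) by (intro fundamental_theorem_of_calculus) auto
  moreover have "((\<lambda>t. (cmod (b t))\<^sup>2 / (2 * \<nu>) + 2 * inner (c t) (y t)) has_integral
      integral {0..\<tau>} (\<lambda>t. (cmod (b t))\<^sup>2 / (2 * \<nu>) + 2 * inner (c t) (y t))) {0..\<tau>}"
    using assms(2) by (intro integrable_integral integrable_continuous_real continuous_intros y b c) auto
  ultimately have "inner (y \<tau>) (y \<tau>) - inner (y 0) (y 0)
      \<le> integral {0..\<tau>} (\<lambda>t. (cmod (b t))\<^sup>2 / (2 * \<nu>) + 2 * inner (c t) (y t))"
  proof (rule has_integral_le)
    fix t
    have "inner (y t) (?r t) + inner (?r t) (y t)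
        = 2 * inner (y t) (- (\<nu> * \<kappa>\<^sup>2) *\<^sub>R y t + \<kappa> *\<^sub>R b t) + 2 * inner (c t) (y t)"
      unfolding inner_add_right[of "y t" _ "c t"] inner_commute[of "?r t"] inner_commute[of "c t"] by simp
    then show "inner (y t) (?r t) + inner (?r t) (y t)
        \<le> (cmod (b t))\<^sup>2 / (2 * \<nu>) + 2 * inner (c t) (y t)"
      using young_modes[OF assms(2), of "y t" \<kappa> "b t"] by linarith
  qed
  then show ?thesis by (simp add: power2_norm_eq_inner del: dot_square_norm)
qed

section \<open>The linear evolution\<close>

locale sabra =
  fixes k0 q \<nu> :: real
  assumes k0_pos: "0 < k0" and q_gt_1: "1 < q" and nu_pos: "0 < \<nu>"
begin

abbreviation k :: "nat \<Rightarrow> real" where "k \<equiv> wavenumber k0 q"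

lemma k_pos: "0 < k n"
  using k0_pos q_gt_1 by (simp add: wavenumber_def)

lemma k_ge: "k0 \<le> k n"
  using k0_pos q_gt_1 by (simp add: wavenumber_def)

lemma k_Suc: "k (Suc n) = q * k n"
  by (simp add: wavenumber_def)

text \<open>Mode by mode, \<open>evolves \<tau> y \<beta> \<gamma>\<close> states \<open>y' + \<nu> A y = A\<^sup>1\<^sup>/\<^sup>2 \<beta> + \<gamma>\<close> on \<open>[0, \<tau>]\<close>; neither
  \<open>A y\<close> nor \<open>A\<^sup>1\<^sup>/\<^sup>2 \<beta>\<close> needs to lie in \<open>H\<close>.\<close>

definition evolves :: "real \<Rightarrow> (real \<Rightarrow> ell2) \<Rightarrow> (real \<Rightarrow> ell2) \<Rightarrow> (real \<Rightarrow> ell2) \<Rightarrow> bool" where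
  "evolves \<tau> y \<beta> \<gamma> \<longleftrightarrow> (\<forall>n. \<forall>t\<in>{0..\<tau>}. ((\<lambda>s. coord (y s) n) has_vector_derivative
     (- (\<nu> * (k n)\<^sup>2) *\<^sub>R coord (y t) n + k n *\<^sub>R coord (\<beta> t) n + coord (\<gamma> t) n)) (at t within {0..\<tau>}))"

lemma evolvesD:
  "evolves \<tau> y \<beta> \<gamma> \<Longrightarrow> t \<in> {0..\<tau>} \<Longrightarrow> ((\<lambda>s. coord (y s) n) has_vector_derivative
     (- (\<nu> * (k n)\<^sup>2) *\<^sub>R coord (y t) n + k n *\<^sub>R coord (\<beta> t) n + coord (\<gamma> t) n)) (at t within {0..\<tau>})"
  by (simp add: evolves_def)

lemma evolves_subset: "evolves \<tau> y \<beta> \<gamma> \<Longrightarrow> \<sigma> \<le> \<tau> \<Longrightarrow> evolves \<sigma> y \<beta> \<gamma>"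
  unfolding evolves_def by (force intro: has_vector_derivative_within_subset)

text \<open>Only the combination \<open>A\<^sup>1\<^sup>/\<^sup>2 \<beta> + \<gamma>\<close>
  matters, so a source may be moved from \<beta> to \<gamma> once it is known to lie in
  \<open>H\<close>. The a priori estimate rests on such a move.\<close>

lemma evolves_cong:
  assumes "evolves \<tau> y \<beta> \<gamma>"
    and "\<And>t. t \<in> {0..\<tau>} \<Longrightarrow> y t = y' t"
    and "\<And>t n. t \<in> {0..\<tau>} \<Longrightarrow>
      k n *\<^sub>R coord (\<beta> t) n + coord (\<gamma> t) n = k n *\<^sub>R coord (\<beta>' t) n + coord (\<gamma>' t) n"
  shows "evolves \<tau> y' \<beta>' \<gamma>'"
  unfolding evolves_def
proof (intro allI ballI)
  fix n t assume t: "t \<in> {0..\<tau>}"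
  have "((\<lambda>s. coord (y' s) n) has_vector_derivative
     (- (\<nu> * (k n)\<^sup>2) *\<^sub>R coord (y t) n + k n *\<^sub>R coord (\<beta> t) n + coord (\<gamma> t) n)) (at t within {0..\<tau>})"
    by (rule has_vector_derivative_transform[OF t _ evolvesD[OF assms(1) t]]) (simp add: assms(2))
  then show "((\<lambda>s. coord (y' s) n) has_vector_derivative
     (- (\<nu> * (k n)\<^sup>2) *\<^sub>R coord (y' t) n + k n *\<^sub>R coord (\<beta>' t) n + coord (\<gamma>' t) n)) (at t within {0..\<tau>})"
    using assms(2)[OF t] assms(3)[OF t, of n] by (simp only: add.assoc)
qed

lemma evolves_diff:
  assumes "evolves \<tau> y \<beta> \<gamma>" "evolves \<tau> y' \<beta>' \<gamma>'"
  shows "evolves \<tau> (\<lambda>t. y t - y' t) (\<lambda>t. \<beta> t - \<beta>' t) (\<lambda>t. \<gamma> t - \<gamma>' t)"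
  unfolding evolves_def
proof (intro allI ballI)
  fix n t assume t: "t \<in> {0..\<tau>}"
  show "((\<lambda>s. coord (y s - y' s) n) has_vector_derivative
     (- (\<nu> * (k n)\<^sup>2) *\<^sub>R coord (y t - y' t) n + k n *\<^sub>R coord (\<beta> t - \<beta>' t) n
       + coord (\<gamma> t - \<gamma>' t) n)) (at t within {0..\<tau>})"
    using has_vector_derivative_diff[OF evolvesD[OF assms(1) t, of n] evolvesD[OF assms(2) t, of n]]
    by (simp add: algebra_simps)
qed

lemma evolves_shift:
  assumes "evolves \<tau> y \<beta> \<gamma>" "0 \<le> h"
  shows "evolves (\<tau> - h) (\<lambda>t. y (t + h)) (\<lambda>t. \<beta> (t + h)) (\<lambda>t. \<gamma> (t + h))"
  unfolding evolves_def
proof (intro allI ballI)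
  fix n t assume t: "t \<in> {0..\<tau> - h}"
  have 1: "((\<lambda>s. coord (y s) n) has_vector_derivative
     (- (\<nu> * (k n)\<^sup>2) *\<^sub>R coord (y (t + h)) n + k n *\<^sub>R coord (\<beta> (t + h)) n + coord (\<gamma> (t + h)) n))
     (at (t + h) within (\<lambda>s. s + h) ` {0..\<tau> - h})"
    by (rule has_vector_derivative_within_subset[OF evolvesD[OF assms(1)]]) (use t assms(2) in auto)
  have 2: "((\<lambda>s. s + h) has_vector_derivative 1) (at t within {0..\<tau> - h})"
    by (auto intro!: derivative_eq_intros)
  show "((\<lambda>s. coord (y (s + h)) n) has_vector_derivative
     (- (\<nu> * (k n)\<^sup>2) *\<^sub>R coord (y (t + h)) n + k n *\<^sub>R coord (\<beta> (t + h)) n + coord (\<gamma> (t + h)) n))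
     (at t within {0..\<tau> - h})"
    using vector_diff_chain_within[OF 2 1] by (simp add: o_def)
qed

text \<open>Since \<open>y\<close> is differentiable only mode by mode, the estimate is summed over
  the modes \<open>n < N\<close> first; the integrands have the majorant \<open>(norm (\<beta>
  t))\<^sup>2 / (2 * \<nu>) + 2 * (norm (\<gamma> t) * norm (y t))\<close>, and dominated
  convergence lets \<open>N\<close> tend to infinity.\<close>

lemma energy_estimate:
  assumes ev: "evolves \<tau> y \<beta> \<gamma>" and "0 \<le> \<tau>"
    and y: "continuous_on {0..\<tau>} y" and \<beta>: "continuous_on {0..\<tau>} \<beta>" and \<gamma>: "continuous_on {0..\<tau>} \<gamma>"
  shows "(norm (y \<tau>))\<^sup>2 \<le> (norm (y 0))\<^sup>2 +
    integral {0..\<tau>} (\<lambda>t. (norm (\<beta> t))\<^sup>2 / (2 * \<nu>) + 2 * inner (\<gamma> t) (y t))"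
proof -
  define F where "F N t = (\<Sum>n<N. (cmod (coord (\<beta> t) n))\<^sup>2 / (2 * \<nu>)
    + 2 * inner (coord (\<gamma> t) n) (coord (y t) n))" for N t
  have F: "F N t = (norm (mult_ind {..<N} (\<beta> t)))\<^sup>2 / (2 * \<nu>)
      + 2 * inner (mult_ind {..<N} (\<gamma> t)) (y t)" for N t
    by (simp add: F_def sum.distrib sum_divide_distrib sum_distrib_left norm_mult_ind_finite
        inner_mult_ind_finite)
  have cm: "continuous_on {0..\<tau>} (\<lambda>t. mult_ind S (\<beta> t))" "continuous_on {0..\<tau>} (\<lambda>t. mult_ind S (\<gamma> t))" for S
    by (rule bounded_linear.continuous_on[OF bounded_linear_mult_ind \<beta>]
        bounded_linear.continuous_on[OF bounded_linear_mult_ind \<gamma>])+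
  have part: "(\<Sum>n<N. (cmod (coord (y \<tau>) n))\<^sup>2)
      \<le> (\<Sum>n<N. (cmod (coord (y 0) n))\<^sup>2) + integral {0..\<tau>} (F N)" for N
  proof -
    have "(cmod (coord (y \<tau>) n))\<^sup>2 \<le> (cmod (coord (y 0) n))\<^sup>2 +
      integral {0..\<tau>} (\<lambda>t. (cmod (coord (\<beta> t) n))\<^sup>2 / (2 * \<nu>)
        + 2 * inner (coord (\<gamma> t) n) (coord (y t) n))" for n
      by (intro mode_energy[where \<kappa> = "k n"] evolvesD[OF ev] assms(2) nu_pos
          continuous_on_coord \<beta> \<gamma>)
    then have "(\<Sum>n<N. (cmod (coord (y \<tau>) n))\<^sup>2) \<le> (\<Sum>n<N. (cmod (coord (y 0) n))\<^sup>2 +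
      integral {0..\<tau>} (\<lambda>t. (cmod (coord (\<beta> t) n))\<^sup>2 / (2 * \<nu>)
        + 2 * inner (coord (\<gamma> t) n) (coord (y t) n)))"
      by (rule sum_mono)
    moreover have "integral {0..\<tau>} (F N) = (\<Sum>n<N. integral {0..\<tau>} (\<lambda>t.
        (cmod (coord (\<beta> t) n))\<^sup>2 / (2 * \<nu>) + 2 * inner (coord (\<gamma> t) n) (coord (y t) n)))"
      unfolding F_def using nu_pos
      by (intro integral_sum integrable_continuous_real continuous_intros \<beta> \<gamma> y) auto
    ultimately show ?thesis by (simp only: sum.distrib)
  qed
  have "(\<lambda>N. integral {0..\<tau>} (F N)) \<longlonglongrightarrow>
      integral {0..\<tau>} (\<lambda>t. (norm (\<beta> t))\<^sup>2 / (2 * \<nu>) + 2 * inner (\<gamma> t) (y t))"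
  proof (rule dominated_convergence(2))
    show "F N integrable_on {0..\<tau>}" for N
      unfolding F using nu_pos by (intro integrable_continuous_real continuous_intros cm y) auto
    show "(\<lambda>t. (norm (\<beta> t))\<^sup>2 / (2 * \<nu>) + 2 * (norm (\<gamma> t) * norm (y t))) integrable_on {0..\<tau>}"
      using nu_pos by (intro integrable_continuous_real continuous_intros \<beta> \<gamma> y) auto
    show "norm (F N t) \<le> (norm (\<beta> t))\<^sup>2 / (2 * \<nu>) + 2 * (norm (\<gamma> t) * norm (y t))" for N t
    proof -
      have "(norm (mult_ind {..<N} (\<beta> t)))\<^sup>2 / (2 * \<nu>) \<le> (norm (\<beta> t))\<^sup>2 / (2 * \<nu>)"
        using nu_pos by (intro divide_right_mono power_mono norm_mult_ind_le) auto
      moreover have "0 \<le> (norm (mult_ind {..<N} (\<beta> t)))\<^sup>2 / (2 * \<nu>)" using nu_pos by simp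
      moreover have "\<bar>inner (mult_ind {..<N} (\<gamma> t)) (y t)\<bar> \<le> norm (\<gamma> t) * norm (y t)"
        using Cauchy_Schwarz_ineq2[of "mult_ind {..<N} (\<gamma> t)" "y t"]
          mult_right_mono[OF norm_mult_ind_le[of "{..<N}" "\<gamma> t"] norm_ge_zero[of "y t"]] by linarith
      ultimately show ?thesis unfolding F real_norm_def by linarith
    qed
    show "(\<lambda>N. F N t) \<longlonglongrightarrow> (norm (\<beta> t))\<^sup>2 / (2 * \<nu>) + 2 * inner (\<gamma> t) (y t)" for t
      unfolding F using nu_pos by (intro tendsto_intros mult_ind_lessThan_tendsto) auto
  qed
  moreover have lim: "(\<lambda>N. \<Sum>n<N. (cmod (coord u n))\<^sup>2) \<longlonglongrightarrow> (norm u)\<^sup>2" for u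
    using norm_ell2_sums[of u] by (simp add: sums_def)
  ultimately show ?thesis
    using LIMSEQ_le[OF lim[of "y \<tau>"] tendsto_add[OF lim[of "y 0"]]] part by blast
qed

text \<open>Each mode is given by variation of constants; the point is that the modes together form
  a continuous curve in \<open>H\<close>. Summability and continuity both come from one estimate
  over finite sets of modes.\<close>

lemma linear_solution:
  assumes \<beta>: "continuous_on {0..T} \<beta>" and T: "0 \<le> T"
  shows "\<exists>y. continuous_on {0..T} y \<and> y 0 = y0 \<and> evolves T y \<beta> (\<lambda>_. 0)"
proof -
  define Y where "Y n t = exp (- (\<nu> * (k n)\<^sup>2) * t) *\<^sub>R (coord y0 n
    + integral {0..t} (\<lambda>s. exp (\<nu> * (k n)\<^sup>2 * s) *\<^sub>R (k n *\<^sub>R coord (\<beta> s) n)))" for n t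
  have D: "(Y n has_vector_derivative (- (\<nu> * (k n)\<^sup>2) *\<^sub>R Y n t + k n *\<^sub>R coord (\<beta> t) n))
      (at t within {0..T})" if t: "t \<in> {0..T}" for n t
  proof -
    have "((\<lambda>t. exp (- (\<nu> * (k n)\<^sup>2) * t)) has_field_derivative
        - (\<nu> * (k n)\<^sup>2) * exp (- (\<nu> * (k n)\<^sup>2) * t)) (at t within {0..T})"
      by (auto intro!: derivative_eq_intros)
    moreover have "((\<lambda>t. coord y0 n + integral {0..t} (\<lambda>s. exp (\<nu> * (k n)\<^sup>2 * s) *\<^sub>R (k n *\<^sub>R coord (\<beta> s) n)))
        has_vector_derivative 0 + exp (\<nu> * (k n)\<^sup>2 * t) *\<^sub>R (k n *\<^sub>R coord (\<beta> t) n)) (at t within {0..T})"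
      by (intro has_vector_derivative_add has_vector_derivative_const integral_has_vector_derivative
          continuous_intros \<beta> t)
    ultimately have *: "(Y n has_vector_derivative exp (- (\<nu> * (k n)\<^sup>2) * t) *\<^sub>R
        (0 + exp (\<nu> * (k n)\<^sup>2 * t) *\<^sub>R (k n *\<^sub>R coord (\<beta> t) n)) + (- (\<nu> * (k n)\<^sup>2) * exp (- (\<nu> * (k n)\<^sup>2) * t)) *\<^sub>R
        (coord y0 n + integral {0..t} (\<lambda>s. exp (\<nu> * (k n)\<^sup>2 * s) *\<^sub>R (k n *\<^sub>R coord (\<beta> s) n)))) (at t within {0..T})"
      unfolding Y_def by (rule has_vector_derivative_scaleR)
    have [simp]: "exp (- (\<nu> * (k n)\<^sup>2 * t)) * (exp (\<nu> * (k n)\<^sup>2 * t) * r) = r" for r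
      by (simp add: mult.assoc[symmetric] exp_add[symmetric])
    with * show ?thesis by (simp add: Y_def)
  qed
  have Y0: "Y n 0 = coord y0 n" for n by (simp add: Y_def)
  have Yz: "Y 0 t = 0" for t by (simp add: Y_def)
  \<comment> \<open>Used with \<open>S = {..<N}\<close> for membership in \<open>H\<close> and with
    \<open>S = {..<M} - {..<N}\<close> for the tails. Integrating up to \<open>T\<close> makes the
    bound uniform in \<open>t\<close>.\<close>
  have est: "(\<Sum>n\<in>S. (cmod (Y n t))\<^sup>2) \<le> (norm (mult_ind S y0))\<^sup>2
      + integral {0..T} (\<lambda>t. (norm (mult_ind S (\<beta> t)))\<^sup>2 / (2 * \<nu>))" if S: "finite S" and t: "t \<in> {0..T}" for S t
  proof -
    have cs: "continuous_on {0..\<tau>} (\<lambda>s. (cmod (coord (\<beta> s) n))\<^sup>2 / (2 * \<nu>))" if "\<tau> \<le> T" for n \<tau>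
      using nu_pos that by (intro continuous_intros continuous_on_subset[OF \<beta>]) auto
    have "(cmod (Y n t))\<^sup>2 \<le> (cmod (Y n 0))\<^sup>2
        + integral {0..t} (\<lambda>s. (cmod (coord (\<beta> s) n))\<^sup>2 / (2 * \<nu>))" for n
    proof -
      have "(cmod (Y n t))\<^sup>2 \<le> (cmod (Y n 0))\<^sup>2
        + integral {0..t} (\<lambda>s. (cmod (coord (\<beta> s) n))\<^sup>2 / (2 * \<nu>) + 2 * inner 0 (Y n s))"
      proof (rule mode_energy[where \<kappa> = "k n"])
        show "(Y n has_vector_derivative - (\<nu> * (k n)\<^sup>2) *\<^sub>R Y n s + k n *\<^sub>R coord (\<beta> s) n + 0)
            (at s within {0..t})" if "s \<in> {0..t}" for s
          using D[of s n] t that by (auto intro: has_vector_derivative_within_subset)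
      qed (use t nu_pos in \<open>auto intro!: continuous_intros continuous_on_subset[OF \<beta>]\<close>)
      then show ?thesis by simp
    qed
    moreover have "integral {0..t} (\<lambda>s. (cmod (coord (\<beta> s) n))\<^sup>2 / (2 * \<nu>))
        \<le> integral {0..T} (\<lambda>s. (cmod (coord (\<beta> s) n))\<^sup>2 / (2 * \<nu>))" for n
      using t nu_pos by (intro integral_subset_le integrable_continuous_real cs) auto
    ultimately have "(cmod (Y n t))\<^sup>2 \<le> (cmod (coord y0 n))\<^sup>2
        + integral {0..T} (\<lambda>s. (cmod (coord (\<beta> s) n))\<^sup>2 / (2 * \<nu>))" for n
      unfolding Y0 by (meson add_left_mono order_trans)
    then have "(\<Sum>n\<in>S. (cmod (Y n t))\<^sup>2) \<le> (\<Sum>n\<in>S. (cmod (coord y0 n))\<^sup>2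
        + integral {0..T} (\<lambda>s. (cmod (coord (\<beta> s) n))\<^sup>2 / (2 * \<nu>)))"
      by (rule sum_mono)
    also have "\<dots> = (norm (mult_ind S y0))\<^sup>2
        + integral {0..T} (\<lambda>s. (\<Sum>n\<in>S. (cmod (coord (\<beta> s) n))\<^sup>2 / (2 * \<nu>)))"
      unfolding sum.distrib norm_mult_ind_finite[OF S]
      by (subst integral_sum[OF S]) (auto intro!: integrable_continuous_real cs)
    finally show ?thesis
      by (simp add: norm_mult_ind_finite[OF S] sum_divide_distrib)
  qed
  have cm: "continuous_on {0..T} (\<lambda>t. mult_ind S (\<beta> t))" for S
    by (rule bounded_linear.continuous_on[OF bounded_linear_mult_ind \<beta>])
  define y where "y t = Abs_ell2 (\<lambda>n. Y n t)" for t
  have mem: "(\<lambda>n. Y n t) \<in> ell2_seqs" if t: "t \<in> {0..T}" for t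
  proof (rule ell2_of_partial_bounds(1))
    show "Y 0 t = 0" by (rule Yz)
    let ?B = "(norm y0)\<^sup>2 + integral {0..T} (\<lambda>t. (norm (\<beta> t))\<^sup>2 / (2 * \<nu>))"
    have int: "(\<lambda>t. (norm (\<beta> t))\<^sup>2 / (2 * \<nu>)) integrable_on {0..T}"
      using nu_pos by (intro integrable_continuous_real continuous_intros \<beta>) auto
    have B: "0 \<le> ?B" using nu_pos by (intro add_nonneg_nonneg integral_nonneg int) auto
    show "0 \<le> sqrt ?B" using B by simp
    fix N
    have "(\<Sum>n<N. (cmod (Y n t))\<^sup>2) \<le> (norm (mult_ind {..<N} y0))\<^sup>2
      + integral {0..T} (\<lambda>t. (norm (mult_ind {..<N} (\<beta> t)))\<^sup>2 / (2 * \<nu>))" by (rule est[OF _ t]) simp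
    also have "\<dots> \<le> ?B"
      using nu_pos by (intro add_mono integral_le power_mono norm_mult_ind_le norm_ge_zero int divide_right_mono
          integrable_continuous_real continuous_intros cm) auto
    finally show "(\<Sum>n<N. (cmod (Y n t))\<^sup>2) \<le> (sqrt ?B)\<^sup>2" using B by simp
  qed
  have yc: "coord (y t) n = Y n t" if "t \<in> {0..T}" for t n
    using coord_Abs[OF mem[OF that]] by (simp add: y_def)
  \<comment> \<open>The bound of \<open>est\<close> for the modes from \<open>N\<close> on. It tends
    to 0 and does not depend on \<open>t\<close>, so the truncations of \<open>y\<close>, which are
    continuous, converge uniformly.\<close>
  define e where "e N = (norm (y0 - mult_ind {..<N} y0))\<^sup>2
    + integral {0..T} (\<lambda>t. (norm (\<beta> t - mult_ind {..<N} (\<beta> t)))\<^sup>2 / (2 * \<nu>))" for N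
  have intd: "(\<lambda>t. (norm (\<beta> t - mult_ind {..<N} (\<beta> t)))\<^sup>2 / (2 * \<nu>)) integrable_on {0..T}" for N
    using nu_pos by (intro integrable_continuous_real continuous_intros cm \<beta>) auto
  have "e \<longlonglongrightarrow> (norm (y0 - y0))\<^sup>2 + integral {0..T} (\<lambda>t. 0)"
    unfolding e_def
  proof (intro tendsto_intros mult_ind_lessThan_tendsto dominated_convergence(2) intd)
    show "(\<lambda>t. (2 * norm (\<beta> t))\<^sup>2 / (2 * \<nu>)) integrable_on {0..T}"
      using nu_pos by (intro integrable_continuous_real continuous_intros \<beta>) auto
    show "norm ((norm (\<beta> t - mult_ind {..<N} (\<beta> t)))\<^sup>2 / (2 * \<nu>)) \<le> (2 * norm (\<beta> t))\<^sup>2 / (2 * \<nu>)" for t N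
    proof -
      have "norm (\<beta> t - mult_ind {..<N} (\<beta> t)) \<le> 2 * norm (\<beta> t)"
        using norm_triangle_ineq4[of "\<beta> t" "mult_ind {..<N} (\<beta> t)"] norm_mult_ind_le[of "{..<N}" "\<beta> t"]
        by linarith
      then have "(norm (\<beta> t - mult_ind {..<N} (\<beta> t)))\<^sup>2 \<le> (2 * norm (\<beta> t))\<^sup>2" by (rule power_mono) simp
      then have "(norm (\<beta> t - mult_ind {..<N} (\<beta> t)))\<^sup>2 / (2 * \<nu>) \<le> (2 * norm (\<beta> t))\<^sup>2 / (2 * \<nu>)"
        by (rule divide_right_mono) (use nu_pos in simp)
      moreover have "0 \<le> (norm (\<beta> t - mult_ind {..<N} (\<beta> t)))\<^sup>2 / (2 * \<nu>)" using nu_pos by simp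
      ultimately show ?thesis unfolding real_norm_def by linarith
    qed
    show "(\<lambda>N. (norm (\<beta> t - mult_ind {..<N} (\<beta> t)))\<^sup>2 / (2 * \<nu>)) \<longlonglongrightarrow> 0" for t
    proof -
      have "(\<lambda>N. (norm (\<beta> t - mult_ind {..<N} (\<beta> t)))\<^sup>2 / (2 * \<nu>)) \<longlonglongrightarrow> (norm (\<beta> t - \<beta> t))\<^sup>2 / (2 * \<nu>)"
        using nu_pos by (intro tendsto_intros mult_ind_lessThan_tendsto) auto
      then show ?thesis by simp
    qed
  qed
  then have "e \<longlonglongrightarrow> 0" by simp
  from tendsto_real_sqrt[OF this] have e0: "(\<lambda>N. sqrt (e N)) \<longlonglongrightarrow> 0" by simp
  have tail: "norm (y t - mult_ind {..<N} (y t)) \<le> sqrt (e N)" if t: "t \<in> {0..T}" for t N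
  proof (rule norm_leI)
    have e: "0 \<le> e N" unfolding e_def using nu_pos
      by (intro add_nonneg_nonneg integral_nonneg intd) auto
    then show "0 \<le> sqrt (e N)" by simp
    fix M
    have le: "(norm (mult_ind ({..<M} - {..<N}) u))\<^sup>2 \<le> (norm (u - mult_ind {..<N} u))\<^sup>2" for u
      using norm_le_coordwise[of "mult_ind ({..<M} - {..<N}) u" 1 "u - mult_ind {..<N} u"]
      by (intro power_mono) (auto simp: coord_mult_ind)
    have "(\<Sum>n<M. (cmod (coord (y t - mult_ind {..<N} (y t)) n))\<^sup>2) = (\<Sum>n\<in>{..<M} - {..<N}. (cmod (Y n t))\<^sup>2)"
      by (rule sum.mono_neutral_cong_right) (auto simp: coord_mult_ind yc[OF t])
    also have "\<dots> \<le> (norm (mult_ind ({..<M} - {..<N}) y0))\<^sup>2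
      + integral {0..T} (\<lambda>t. (norm (mult_ind ({..<M} - {..<N}) (\<beta> t)))\<^sup>2 / (2 * \<nu>))" by (rule est[OF _ t]) simp
    also have "\<dots> \<le> e N"
      unfolding e_def using nu_pos
      by (intro add_mono integral_le intd le divide_right_mono
          integrable_continuous_real continuous_intros cm) auto
    finally show "(\<Sum>n<M. (cmod (coord (y t - mult_ind {..<N} (y t)) n))\<^sup>2) \<le> (sqrt (e N))\<^sup>2" using e by simp
  qed
  have lim: "uniform_limit {0..T} (\<lambda>N t. mult_ind {..<N} (y t)) y sequentially"
  proof (rule uniform_limitI)
    fix \<epsilon> :: real assume "0 < \<epsilon>"
    then have "eventually (\<lambda>N. sqrt (e N) < \<epsilon>) sequentially" using e0 by (simp add: order_tendstoD)
    then show "\<forall>\<^sub>F N in sequentially. \<forall>t\<in>{0..T}. dist (mult_ind {..<N} (y t)) (y t) < \<epsilon>"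
    proof eventually_elim
      case (elim N)
      then show ?case
        using le_less_trans[OF tail elim] by (simp add: dist_norm norm_minus_commute)
    qed
  qed
  have yn: "continuous_on {0..T} (\<lambda>t. coord (y t) n)" for n
  proof -
    have "continuous_on {0..T} (Y n)"
      using D by (meson continuous_on_eq_continuous_within has_vector_derivative_continuous)
    then show ?thesis
      using continuous_on_cong[OF refl, of "{0..T}" "\<lambda>t. coord (y t) n" "Y n"] yc by blast
  qed
  have "continuous_on {0..T} y"
    by (rule uniform_limit_theorem[OF _ lim])
       (auto intro!: always_eventually continuous_on_mult_ind_finite yn)
  moreover have "y 0 = y0" using T by (intro ell2_eqI) (simp add: yc Y0)
  moreover have "evolves T y \<beta> (\<lambda>_. 0)"
    unfolding evolves_def
  proof (intro allI ballI)
    fix n t assume t: "t \<in> {0..T}"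
    show "((\<lambda>s. coord (y s) n) has_vector_derivative - (\<nu> * (k n)\<^sup>2) *\<^sub>R coord (y t) n
      + k n *\<^sub>R coord (\<beta> t) n + coord 0 n) (at t within {0..T})"
      using has_vector_derivative_transform[OF t _ D[OF t], of "\<lambda>s. coord (y s) n"]
      by (simp add: yc[OF t] yc)
  qed
  ultimately show ?thesis by blast
qed

end

section \<open>Lipschitz perturbations of the linear evolution\<close>

context sabra
begin

text \<open>Inputs \<open>v\<close>, \<open>v'\<close> and outputs \<open>y\<close>,
  \<open>y'\<close> are kept apart so that the estimate serves twice: outputs equal to inputs give
  uniqueness, consecutive iterates give convergence of the Picard scheme.\<close>

lemma lipschitz_diff_estimate:
  fixes N :: "real \<Rightarrow> ell2 \<Rightarrow> ell2"
  assumes y: "evolves T y (\<lambda>t. N t (v t)) (\<lambda>_. 0)" "continuous_on {0..T} y"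
    and y': "evolves T y' (\<lambda>t. N t (v' t)) (\<lambda>_. 0)" "continuous_on {0..T} y'"
    and init: "y 0 = y' 0"
    and v: "continuous_on {0..T} v" "continuous_on {0..T} v'"
    and cont: "\<And>u. continuous_on {0..T} u \<Longrightarrow> continuous_on {0..T} (\<lambda>t. N t (u t))"
    and L: "\<And>t u w. t \<in> {0..T} \<Longrightarrow> norm (N t u - N t w) \<le> L * norm (u - w)"
    and t: "t \<in> {0..T}"
  shows "(norm (y t - y' t))\<^sup>2 \<le> L\<^sup>2 / (2 * \<nu>) * integral {0..t} (\<lambda>s. (norm (v s - v' s))\<^sup>2)"
proof -
  have sub: "continuous_on {0..t} h" if "continuous_on {0..T} h" for h :: "real \<Rightarrow> ell2"
    using that by (rule continuous_on_subset) (use t in auto)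
  have "evolves t (\<lambda>s. y s - y' s) (\<lambda>s. N s (v s) - N s (v' s)) (\<lambda>s. 0 - 0)"
    by (rule evolves_subset[OF evolves_diff[OF y(1) y'(1)]]) (use t in auto)
  then have "(norm (y t - y' t))\<^sup>2 \<le> (norm (y 0 - y' 0))\<^sup>2 +
      integral {0..t} (\<lambda>s. (norm (N s (v s) - N s (v' s)))\<^sup>2 / (2 * \<nu>) + 2 * inner (0 - 0) (y s - y' s))"
    by (rule energy_estimate) (use t in \<open>auto intro!: continuous_intros sub cont v y(2) y'(2)\<close>)
  also have "\<dots> = integral {0..t} (\<lambda>s. (norm (N s (v s) - N s (v' s)))\<^sup>2 / (2 * \<nu>))"
    by (simp add: init)
  also have "\<dots> \<le> integral {0..t} (\<lambda>s. L\<^sup>2 / (2 * \<nu>) * (norm (v s - v' s))\<^sup>2)"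
  proof (rule integral_le)
    fix s assume s: "s \<in> {0..t}"
    have "(norm (N s (v s) - N s (v' s)))\<^sup>2 \<le> (L * norm (v s - v' s))\<^sup>2"
      using s t by (intro power_mono L) auto
    then have "(norm (N s (v s) - N s (v' s)))\<^sup>2 / (2 * \<nu>) \<le> (L * norm (v s - v' s))\<^sup>2 / (2 * \<nu>)"
      by (rule divide_right_mono) (use nu_pos in simp)
    then show "(norm (N s (v s) - N s (v' s)))\<^sup>2 / (2 * \<nu>) \<le> L\<^sup>2 / (2 * \<nu>) * (norm (v s - v' s))\<^sup>2"
      by (simp add: power_mult_distrib)
  qed (use nu_pos in \<open>auto intro!: integrable_continuous_real continuous_intros sub[OF cont] sub[OF v(1)]
    sub[OF v(2)] v\<close>)
  finally show ?thesis by simp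
qed

lemma lipschitz_solution_unique:
  fixes N :: "real \<Rightarrow> ell2 \<Rightarrow> ell2"
  assumes u: "evolves T u (\<lambda>t. N t (u t)) (\<lambda>_. 0)" "continuous_on {0..T} u"
    and v: "evolves T v (\<lambda>t. N t (v t)) (\<lambda>_. 0)" "continuous_on {0..T} v"
    and init: "u 0 = v 0"
    and cont: "\<And>u. continuous_on {0..T} u \<Longrightarrow> continuous_on {0..T} (\<lambda>t. N t (u t))"
    and L: "\<And>t u w. t \<in> {0..T} \<Longrightarrow> norm (N t u - N t w) \<le> L * norm (u - w)"
    and t: "t \<in> {0..T}"
  shows "u t = v t"
proof -
  have "(norm (u t - v t))\<^sup>2 \<le> 0 * exp (L\<^sup>2 / (2 * \<nu>) * t)"
  proof (rule gronwall[OF _ _ t])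
    show "continuous_on {0..T} (\<lambda>t. (norm (u t - v t))\<^sup>2)" by (intro continuous_intros u v)
    show "0 \<le> L\<^sup>2 / (2 * \<nu>)" using nu_pos by simp
  qed (use lipschitz_diff_estimate[OF u v init u(2) v(2) cont L] in auto)
  then show ?thesis by simp
qed

text \<open>The iteration runs on all of \<open>[0, T]\<close> at once: an exponential weight in
  time takes the place of a short interval.\<close>

lemma lipschitz_solution_exists:
  fixes N :: "real \<Rightarrow> ell2 \<Rightarrow> ell2"
  assumes T: "0 \<le> T"
    and cont: "\<And>u. continuous_on {0..T} u \<Longrightarrow> continuous_on {0..T} (\<lambda>t. N t (u t))"
    and L: "\<And>t u w. t \<in> {0..T} \<Longrightarrow> norm (N t u - N t w) \<le> L * norm (u - w)"
  shows "\<exists>u. continuous_on {0..T} u \<and> u 0 = u0 \<and> evolves T u (\<lambda>t. N t (u t)) (\<lambda>_. 0)"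
proof -
  have "\<forall>u. \<exists>y. continuous_on {0..T} u \<longrightarrow>
      continuous_on {0..T} y \<and> y 0 = u0 \<and> evolves T y (\<lambda>t. N t (u t)) (\<lambda>_. 0)"
    using linear_solution[OF cont T] by blast
  from choice[OF this] obtain \<Phi> where \<Phi>: "\<And>u. continuous_on {0..T} u \<Longrightarrow> continuous_on {0..T} (\<Phi> u)"
    "\<And>u. continuous_on {0..T} u \<Longrightarrow> \<Phi> u 0 = u0"
    "\<And>u. continuous_on {0..T} u \<Longrightarrow> evolves T (\<Phi> u) (\<lambda>t. N t (u t)) (\<lambda>_. 0)" by blast
  \<comment> \<open>The \<open>+ 1\<close> keeps \<open>M\<close> positive when
    \<open>L = 0\<close>, since \<open>4 * M\<close> will be a denominator.\<close>
  define M where "M = L\<^sup>2 / (2 * \<nu>) + 1"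
  have M: "0 < M" using nu_pos by (simp add: M_def add_nonneg_pos)
  have contr: "(norm (\<Phi> v t - \<Phi> w t))\<^sup>2 \<le> M * integral {0..t} (\<lambda>s. (norm (v s - w s))\<^sup>2)"
    if v: "continuous_on {0..T} v" and w: "continuous_on {0..T} w" and t: "t \<in> {0..T}" for v w t
  proof -
    have "(norm (\<Phi> v t - \<Phi> w t))\<^sup>2 \<le> L\<^sup>2 / (2 * \<nu>) * integral {0..t} (\<lambda>s. (norm (v s - w s))\<^sup>2)"
      by (rule lipschitz_diff_estimate[OF \<Phi>(3)[OF v] \<Phi>(1)[OF v] \<Phi>(3)[OF w] \<Phi>(1)[OF w] _ v w cont L t])
         (simp_all add: \<Phi>(2) v w)
    also have "\<dots> \<le> M * integral {0..t} (\<lambda>s. (norm (v s - w s))\<^sup>2)"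
    proof (rule mult_right_mono)
      have "continuous_on {0..t} v" "continuous_on {0..t} w"
        using v w t by (auto intro: continuous_on_subset)
      then show "0 \<le> integral {0..t} (\<lambda>s. (norm (v s - w s))\<^sup>2)"
        by (intro integral_nonneg integrable_continuous_real continuous_intros) auto
    qed (simp add: M_def)
    finally show ?thesis .
  qed
  define X where "X j = (\<Phi> ^^ j) (\<lambda>_. u0)" for j
  have X0: "X 0 = (\<lambda>_. u0)" and XS: "X (Suc j) = \<Phi> (X j)" for j by (simp_all add: X_def)
  have Xc: "continuous_on {0..T} (X j)" for j by (induction j) (simp_all add: X0 XS \<Phi>(1))
  have "compact ((\<lambda>t. (norm (X 1 t - X 0 t))\<^sup>2) ` {0..T})"
    by (intro compact_continuous_image continuous_intros Xc) auto
  then have "bounded ((\<lambda>t. (norm (X 1 t - X 0 t))\<^sup>2) ` {0..T})" by (rule compact_imp_bounded)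
  then obtain D where "0 < D" and D: "\<And>t. t \<in> {0..T} \<Longrightarrow> norm ((norm (X 1 t - X 0 t))\<^sup>2) \<le> D"
    by (auto simp: bounded_pos)
  \<comment> \<open>Integrating \<open>exp (4 * M * s)\<close> gains \<open>1 / (4 * M)\<close>,
    which cancels the \<open>M\<close> of \<open>contr\<close> and leaves a factor
    \<open>1 / 4\<close> per iteration, hence \<open>1 / 2\<close> for the norms.\<close>
  have step: "(norm (X (Suc j) t - X j t))\<^sup>2 \<le> D * exp (4 * M * t) / 4 ^ j" if "t \<in> {0..T}" for j t
    using that
  proof (induction j arbitrary: t)
    case 0
    have "(norm (X 1 t - X 0 t))\<^sup>2 \<le> D * 1" using D[OF 0] by simp
    also have "\<dots> \<le> D * exp (4 * M * t)" using \<open>0 < D\<close> M 0 by (intro mult_left_mono) auto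
    finally show ?case by simp
  next
    case (Suc j)
    have sub: "continuous_on {0..t} (X i)" for i
      using Xc by (rule continuous_on_subset) (use Suc.prems in auto)
    have I: "((\<lambda>s. D * exp (4 * M * s) / 4 ^ j) has_integral
        D / 4 ^ j / (4 * M) * exp (4 * M * t) - D / 4 ^ j / (4 * M) * exp (4 * M * 0)) {0..t}"
      using Suc.prems M
      by (intro fundamental_theorem_of_calculus)
         (auto intro!: derivative_eq_intros simp: has_real_derivative_iff_has_vector_derivative[symmetric])
    have "(norm (X (Suc (Suc j)) t - X (Suc j) t))\<^sup>2
        \<le> M * integral {0..t} (\<lambda>s. (norm (X (Suc j) s - X j s))\<^sup>2)"
      unfolding XS[of "Suc j"] XS[of j] by (rule contr) (use Suc.prems Xc \<Phi>(1) in auto)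
    also have "integral {0..t} (\<lambda>s. (norm (X (Suc j) s - X j s))\<^sup>2)
        \<le> D / 4 ^ j / (4 * M) * exp (4 * M * t) - D / 4 ^ j / (4 * M) * exp (4 * M * 0)"
    proof (rule has_integral_le[OF integrable_integral I])
      show "(\<lambda>s. (norm (X (Suc j) s - X j s))\<^sup>2) integrable_on {0..t}"
        by (intro integrable_continuous_real continuous_intros sub)
    qed (use Suc in auto)
    also have "\<dots> \<le> D / 4 ^ j / (4 * M) * exp (4 * M * t)" using \<open>0 < D\<close> M by simp
    also have "M * (D / 4 ^ j / (4 * M) * exp (4 * M * t)) = D * exp (4 * M * t) / 4 ^ Suc j"
      using M by (simp add: field_simps)
    finally show ?case using M by simp
  qed
  define E where "E = sqrt (D * exp (4 * M * T))"
  have incr: "norm (X (Suc j) t - X j t) \<le> E * (1 / 2) ^ j" if t: "t \<in> {0..T}" for j t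
  proof (rule power2_le_imp_le)
    have "(norm (X (Suc j) t - X j t))\<^sup>2 \<le> D * exp (4 * M * t) / 4 ^ j" by (rule step[OF t])
    also have "\<dots> \<le> D * exp (4 * M * T) / 4 ^ j"
      using \<open>0 < D\<close> M t by (intro divide_right_mono mult_left_mono) auto
    also have "\<dots> = (E * (1 / 2) ^ j)\<^sup>2"
      using \<open>0 < D\<close> by (simp add: E_def power_mult_distrib power_divide power2_eq_square power_mult_distrib[symmetric])
    finally show "(norm (X (Suc j) t - X j t))\<^sup>2 \<le> (E * (1 / 2) ^ j)\<^sup>2" .
  qed (use \<open>0 < D\<close> in \<open>simp add: E_def\<close>)
  have "summable (\<lambda>j. E * (1 / 2) ^ j)" by (intro summable_mult summable_geometric) simp
  note S = Weierstrass_m_test[OF incr this]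
  define S where "S t = (\<Sum>i. X (Suc i) t - X i t)" for t
  define u where "u t = S t + u0" for t
  have "uniform_limit {0..T} (\<lambda>n t. (\<Sum>i<n. X (Suc i) t - X i t) + u0) u sequentially"
    unfolding u_def S_def by (intro uniform_limit_add uniform_limit_const S)
  moreover have "(\<Sum>i<n. X (Suc i) t - X i t) + u0 = X n t" for n t
    using sum_lessThan_telescope[of "\<lambda>i. X i t" n] by (simp add: X0)
  ultimately have lim: "uniform_limit {0..T} X u sequentially" by simp
  have uc: "continuous_on {0..T} u"
    by (rule uniform_limit_theorem[OF _ lim]) (use Xc in auto)
  have "\<Phi> u t = u t" if t: "t \<in> {0..T}" for t
  proof (rule LIMSEQ_unique)
    show "(\<lambda>n. X (Suc n) t) \<longlonglongrightarrow> u t"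
      using LIMSEQ_Suc[OF tendsto_uniform_limitI[OF lim t]] .
    show "(\<lambda>n. X (Suc n) t) \<longlonglongrightarrow> \<Phi> u t"
    proof (rule metric_LIMSEQ_I)
      fix \<epsilon> :: real assume \<epsilon>: "0 < \<epsilon>"
      \<comment> \<open>Chosen so that \<open>M * (T + 1) * e\<^sup>2 = \<epsilon>\<^sup>2\<close>;
        with \<open>T + 1\<close> in place of \<open>T\<close> the final inequality becomes
        strict.\<close>
      define e where "e = \<epsilon> / sqrt (M * (T + 1))"
      have e: "0 < e" using \<epsilon> M T by (simp add: e_def)
      have e2: "M * (T + 1) * e\<^sup>2 = \<epsilon>\<^sup>2" using M T by (simp add: e_def power_divide)
      obtain n0 where "\<forall>n\<ge>n0. \<forall>s\<in>{0..T}. dist (X n s) (u s) < e"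
        using uniform_limitD[OF lim e] unfolding eventually_sequentially by blast
      then have n0: "\<And>n s. n \<ge> n0 \<Longrightarrow> s \<in> {0..T} \<Longrightarrow> dist (X n s) (u s) < e" by blast
      have "dist (X (Suc n) t) (\<Phi> u t) < \<epsilon>" if n: "n \<ge> n0" for n
      proof -
        have sub: "continuous_on {0..t} u" "continuous_on {0..t} (X n)"
          by (rule continuous_on_subset[OF uc] continuous_on_subset[OF Xc]; use t in simp)+
        have "(norm (\<Phi> (X n) t - \<Phi> u t))\<^sup>2 \<le> M * integral {0..t} (\<lambda>s. (norm (X n s - u s))\<^sup>2)"
          by (rule contr[OF Xc uc t])
        also have "integral {0..t} (\<lambda>s. (norm (X n s - u s))\<^sup>2) \<le> integral {0..t} (\<lambda>s. e\<^sup>2)"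
        proof (rule integral_le)
          show "(norm (X n s - u s))\<^sup>2 \<le> e\<^sup>2" if "s \<in> {0..t}" for s
            using n0[OF n, of s] that t by (intro power_mono) (auto simp: dist_norm)
        qed (auto intro!: integrable_continuous_real continuous_intros sub)
        also have "\<dots> = t * e\<^sup>2" using t by simp
        also have "\<dots> < (T + 1) * e\<^sup>2" using t e by (intro mult_strict_right_mono) auto
        finally have "(norm (\<Phi> (X n) t - \<Phi> u t))\<^sup>2 < \<epsilon>\<^sup>2"
          using M e2 by (simp add: mult.assoc)
        then show ?thesis using \<epsilon> by (simp add: dist_norm XS power2_less_imp_less)
      qed
      then show "\<exists>no. \<forall>n\<ge>no. dist (X (Suc n) t) (\<Phi> u t) < \<epsilon>" by blast
    qed
  qed
  then have "evolves T u (\<lambda>t. N t (u t)) (\<lambda>_. 0)" "u 0 = u0"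
    using evolves_cong[OF \<Phi>(3)[OF uc], of u "\<lambda>t. N t (u t)" "\<lambda>_. 0"] \<Phi>(2)[OF uc] T by auto
  then show ?thesis using uc by blast
qed

end

section \<open>The nonlinearity\<close>

lemma coord_ell2_of_bound:
  assumes "x 0 = 0" "\<And>N. (\<Sum>n<N. (cmod (x n))\<^sup>2) \<le> B\<^sup>2" "0 \<le> B"
  shows "coord (ell2_of x) = x" "norm (ell2_of x) \<le> B"
proof -
  have mem: "x \<in> ell2_seqs" and "norm (Abs_ell2 x) \<le> B"
    by (rule ell2_of_partial_bounds; use assms in simp)+
  then show "coord (ell2_of x) = x" "norm (ell2_of x) \<le> B"
    using coord_ell2_of[OF mem] by (simp_all add: ell2_of_def)
qed

text \<open>Slot 0 is padding and must stay 0, so the shift discards \<open>coord v 1\<close>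
  instead of moving it there.\<close>

definition shift_up :: "ell2 \<Rightarrow> ell2" where
  "shift_up v = ell2_of (\<lambda>n. if n = 0 then 0 else coord v (n + 1))"

definition shift_down :: "ell2 \<Rightarrow> ell2" where
  "shift_down v = ell2_of (\<lambda>n. coord v (n - 1))"

text \<open>A diagonal operator, meaningful for bounded multipliers \<open>z\<close>, which every
  later use supplies.\<close>

definition scale_seq :: "(nat \<Rightarrow> complex) \<Rightarrow> ell2 \<Rightarrow> ell2" where
  "scale_seq z v = ell2_of (\<lambda>n. z n * coord v n)"

text \<open>Conjugation is linear over the reals only, and this is the linearity meant in all that
  follows.\<close>

definition conj_seq :: "ell2 \<Rightarrow> ell2" where
  "conj_seq v = ell2_of (\<lambda>n. cnj (coord v n))"

lemma shift_up: "coord (shift_up v) = (\<lambda>n. if n = 0 then 0 else coord v (n + 1))"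
  and norm_shift_up: "norm (shift_up v) \<le> norm v"
proof -
  have "(\<Sum>n<N. (cmod (if n = 0 then 0 else coord v (n + 1)))\<^sup>2) \<le> (norm v)\<^sup>2" for N
  proof -
    have "(\<Sum>n<N. (cmod (if n = 0 then 0 else coord v (n + 1)))\<^sup>2) \<le> (\<Sum>n<N. (cmod (coord v (Suc n)))\<^sup>2)"
      by (intro sum_mono) auto
    also have "\<dots> \<le> (\<Sum>n<Suc N. (cmod (coord v n))\<^sup>2)" by (simp add: sum.lessThan_Suc_shift del: sum.lessThan_Suc)
    also have "\<dots> \<le> (norm v)\<^sup>2" by (rule ell2_partial_le)
    finally show ?thesis .
  qed
  from coord_ell2_of_bound[OF _ this]
  show "coord (shift_up v) = (\<lambda>n. if n = 0 then 0 else coord v (n + 1))" "norm (shift_up v) \<le> norm v"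
    by (simp_all add: shift_up_def)
qed

lemma shift_down: "coord (shift_down v) = (\<lambda>n. coord v (n - 1))"
  and norm_shift_down: "norm (shift_down v) \<le> norm v"
proof -
  have "(\<Sum>n<N. (cmod (coord v (n - 1)))\<^sup>2) \<le> (norm v)\<^sup>2" for N
  proof (cases N)
    case (Suc M)
    have "(\<Sum>n<Suc M. (cmod (coord v (n - 1)))\<^sup>2) = (\<Sum>n<M. (cmod (coord v n))\<^sup>2)"
      by (simp add: sum.lessThan_Suc_shift del: sum.lessThan_Suc)
    then show ?thesis using ell2_partial_le[of v M] Suc by simp
  qed simp
  from coord_ell2_of_bound[OF _ this]
  show "coord (shift_down v) = (\<lambda>n. coord v (n - 1))" "norm (shift_down v) \<le> norm v"
    by (simp_all add: shift_down_def)
qed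

lemma scale_seq:
  assumes "\<And>n. cmod (z n) \<le> B"
  shows "coord (scale_seq z v) = (\<lambda>n. z n * coord v n)"
  unfolding scale_seq_def
  by (intro coord_ell2_of ell2_seqs_comparison[OF coord_mem[of v], where M = B])
     (auto simp: norm_mult intro!: mult_right_mono assms)

lemma norm_scale_seq:
  assumes "\<And>n. cmod (z n) \<le> B"
  shows "norm (scale_seq z v) \<le> B * norm v"
  using order_trans[OF norm_ge_zero assms[of 0]]
  by (intro norm_le_coordwise) (auto simp: scale_seq[of z B, OF assms] norm_mult intro!: mult_right_mono assms)

lemma conj_seq: "coord (conj_seq v) = (\<lambda>n. cnj (coord v n))"
  unfolding conj_seq_def
  by (intro coord_ell2_of ell2_seqs_comparison[OF coord_mem[of v], where M = 1]) auto

lemma bounded_linear_shift_up: "bounded_linear shift_up"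
  by (rule bounded_linear_intro[where K = 1])
     (auto intro!: ell2_eqI simp: shift_up norm_shift_up)

lemma bounded_linear_shift_down: "bounded_linear shift_down"
  by (rule bounded_linear_intro[where K = 1])
     (auto intro!: ell2_eqI simp: shift_down norm_shift_down)

lemma bounded_linear_scale_seq:
  assumes "\<And>n. cmod (z n) \<le> B"
  shows "bounded_linear (scale_seq z)"
  by (rule bounded_linear_intro[where K = B])
     (use norm_scale_seq[of z B, OF assms] in \<open>auto intro!: ell2_eqI
       simp: scale_seq[of z B, OF assms] algebra_simps\<close>)

lemma bounded_linear_conj_seq: "bounded_linear conj_seq"
proof (rule bounded_linear_intro[where K = 1])
  show "norm (conj_seq u) \<le> norm u * 1" for u
    using norm_le_coordwise[of "conj_seq u" 1 u] by (simp add: conj_seq)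
qed (auto intro!: ell2_eqI simp: conj_seq)

text \<open>A square-summable sequence is a bounded multiplier, so the pointwise product is a
  diagonal operator applied to \<open>v\<close>.\<close>

definition mult_seq :: "ell2 \<Rightarrow> ell2 \<Rightarrow> ell2" where
  "mult_seq u v = scale_seq (coord u) v"

lemma mult_seq:
  "coord (mult_seq u v) = (\<lambda>n. coord u n * coord v n)"
  unfolding mult_seq_def by (rule scale_seq[of _ "norm u"]) (rule cmod_coord_le)

lemma bounded_bilinear_mult_seq: "bounded_bilinear mult_seq"
proof
  show "\<exists>K. \<forall>u v. norm (mult_seq u v) \<le> norm u * norm v * K"
    by (intro exI[of _ 1] allI) (simp add: mult_seq_def norm_scale_seq cmod_coord_le)
qed (auto intro!: ell2_eqI simp: mult_seq algebra_simps)

text \<open>The shape of \<open>B\<close> with constants in place of the wavenumbers. Each term is a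
  product of a shift of \<open>u\<close> and a shift of \<open>v\<close>, so boundedness on
  \<open>H\<close> is inherited from these building blocks.\<close>

definition shell_form :: "real \<Rightarrow> real \<Rightarrow> real \<Rightarrow> real \<Rightarrow> ell2 \<Rightarrow> ell2 \<Rightarrow> ell2" where
  "shell_form c1 c2 c3 c4 u v =
     mult_seq (scale_seq (\<lambda>_. - \<i> * of_real c1) (conj_seq (shift_up u))) (shift_up (shift_up v))
   + mult_seq (scale_seq (\<lambda>_. - \<i> * of_real c2) (conj_seq (shift_down u))) (shift_up v)
   + mult_seq (scale_seq (\<lambda>_. - \<i> * of_real c3) (shift_down u)) (shift_down (shift_down v))
   + mult_seq (scale_seq (\<lambda>_. - \<i> * of_real c4) (shift_down (shift_down u))) (shift_down v)"

lemma coord_shell_form: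
  "coord (shell_form c1 c2 c3 c4 u v) n = (if n = 0 then 0 else - \<i> *
     (of_real c1 * coord v (n + 2) * cnj (coord u (n + 1))
    + of_real c2 * coord v (n + 1) * cnj (coord u (n - 1))
    + of_real c3 * coord u (n - 1) * coord v (n - 2)
    + of_real c4 * coord v (n - 1) * coord u (n - 2)))"
proof -
  have sc: "coord (scale_seq (\<lambda>_. z) w) = (\<lambda>n. z * coord w n)" for z w
    by (rule scale_seq[of _ "cmod z"]) simp
  show ?thesis
    by (simp add: shell_form_def mult_seq sc conj_seq shift_up shift_down algebra_simps
        numeral_2_eq_2)
qed

lemma bounded_bilinear_add:
  fixes f g :: "'a :: real_normed_vector \<Rightarrow> 'b :: real_normed_vector \<Rightarrow> 'c :: real_normed_vector"
  assumes "bounded_bilinear f" "bounded_bilinear g"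
  shows "bounded_bilinear (\<lambda>x y. f x y + g x y)"
proof
  obtain K L where K: "\<And>x y. norm (f x y) \<le> norm x * norm y * K" and L: "\<And>x y. norm (g x y) \<le> norm x * norm y * L"
    using bounded_bilinear.bounded[OF assms(1)] bounded_bilinear.bounded[OF assms(2)] by blast
  show "\<exists>K. \<forall>x y. norm (f x y + g x y) \<le> norm x * norm y * K"
    by (intro exI[of _ "K + L"] allI norm_triangle_le) (simp add: add_mono[OF K L] distrib_left)
qed (use assms in \<open>auto simp: bounded_bilinear.add_left bounded_bilinear.add_right
  bounded_bilinear.scaleR_left bounded_bilinear.scaleR_right scaleR_add_right\<close>)

lemma bounded_bilinear_shell_form: "bounded_bilinear (shell_form c1 c2 c3 c4)"
proof -
  have sc: "bounded_linear (\<lambda>u. scale_seq (\<lambda>_. z) (L u))" if "bounded_linear L" for z L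
    by (rule bounded_linear_compose[OF bounded_linear_scale_seq[of _ "cmod z"] that]) simp
  note lin = sc bounded_linear_compose[OF bounded_linear_shift_up] bounded_linear_compose[OF bounded_linear_shift_down]
    bounded_linear_compose[OF bounded_linear_conj_seq] bounded_linear_shift_up bounded_linear_shift_down
  show ?thesis
    unfolding shell_form_def[abs_def]
    by (intro bounded_bilinear_add bounded_bilinear.comp[OF bounded_bilinear_mult_seq] lin)
qed

lemma shell_form_scaleR:
  "shell_form c1 c2 c3 c4 (r *\<^sub>R u) (s *\<^sub>R v) = (r * s) *\<^sub>R shell_form c1 c2 c3 c4 u v"
  using bounded_bilinear_shell_form[of c1 c2 c3 c4]
  by (simp add: bounded_bilinear.scaleR_left bounded_bilinear.scaleR_right)

section \<open>Truncation of a quadratic map\<close>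

lemma bounded_bilinear_diag_diff:
  assumes "bounded_bilinear B"
  shows "B x x - B y y = B (x - y) x + B y (x - y)"
  using assms by (simp add: bounded_bilinear.diff_left bounded_bilinear.diff_right)

text \<open>The radial retraction onto the closed ball of radius \<open>R\<close>. Being a scalar
  multiple of \<open>x\<close>, it changes a bilinear map only by a scalar factor.\<close>

definition retract :: "real \<Rightarrow> 'a :: real_normed_vector \<Rightarrow> 'a" where
  "retract R x = (R / max R (norm x)) *\<^sub>R x"

lemma retract_id: "0 < R \<Longrightarrow> norm x \<le> R \<Longrightarrow> retract R x = x"
  by (simp add: retract_def max_def)

lemma norm_retract_le: "0 < R \<Longrightarrow> norm (retract R x) \<le> R"
  by (auto simp: retract_def max_def divide_simps)

text \<open>The difference splits into \<open>(R / m) *\<^sub>R (x - y)\<close> and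
  \<open>(R / m - R / n) *\<^sub>R y\<close>; each is at most \<open>norm (x - y)\<close>, whence
  the 2.\<close>

lemma retract_lipschitz:
  assumes R: "0 < R"
  shows "norm (retract R x - retract R y) \<le> 2 * norm (x - y)"
proof -
  define m n where "m = max R (norm x)" and "n = max R (norm y)"
  have mn: "R \<le> m" "R \<le> n" "norm y \<le> n" "\<bar>n - m\<bar> \<le> norm (x - y)"
    using norm_triangle_ineq3[of x y] by (auto simp: m_def n_def max_def abs_le_iff)
  have "retract R x - retract R y = (R / m) *\<^sub>R (x - y) + (R / m - R / n) *\<^sub>R y"
    by (simp add: retract_def m_def n_def algebra_simps)
  also have "norm \<dots> \<le> norm ((R / m) *\<^sub>R (x - y)) + norm ((R / m - R / n) *\<^sub>R y)"
    by (rule norm_triangle_ineq)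
  also have "norm ((R / m) *\<^sub>R (x - y)) \<le> 1 * norm (x - y)"
    unfolding norm_scaleR using mn R by (intro mult_right_mono) auto
  also have "norm ((R / m - R / n) *\<^sub>R y) \<le> norm (x - y)"
  proof -
    have "R / m - R / n = (R / m) * ((n - m) / n)" using mn R by (simp add: field_simps)
    then have "norm ((R / m - R / n) *\<^sub>R y) = (R / m) * (norm y / n) * \<bar>n - m\<bar>"
      using mn R by (simp add: abs_mult)
    also have "\<dots> \<le> (1 * 1) * \<bar>n - m\<bar>"
      using mn R by (intro mult_right_mono mult_mono) auto
    finally show ?thesis using mn by simp
  qed
  finally show ?thesis by simp
qed

text \<open>The constant \<open>4 * R * K\<close> combines the factor 2 of the retraction with the
  sum of two norms, each at most \<open>R\<close>.\<close>

lemma bilinear_retract_lipschitz: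
  assumes B: "bounded_bilinear B" and R: "0 < R"
  shows "\<exists>L\<ge>0. \<forall>x y. norm (B (retract R x) (retract R x) - B (retract R y) (retract R y)) \<le> L * norm (x - y)"
proof -
  obtain K where K: "K > 0" "\<And>x y. norm (B x y) \<le> norm x * norm y * K"
    using bounded_bilinear.pos_bounded[OF B] by blast
  have "norm (B (retract R x) (retract R x) - B (retract R y) (retract R y)) \<le> (4 * R * K) * norm (x - y)" for x y
  proof -
    let ?x = "retract R x" and ?y = "retract R y"
    have "norm (B ?x ?x - B ?y ?y) \<le> norm (?x - ?y) * norm ?x * K + norm ?y * norm (?x - ?y) * K"
      unfolding bounded_bilinear_diag_diff[OF B] by (rule norm_triangle_le) (intro add_mono K)
    also have "\<dots> = norm (?x - ?y) * (K * (norm ?x + norm ?y))" by (simp add: algebra_simps)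
    also have "\<dots> \<le> (2 * norm (x - y)) * (K * (R + R))"
      using K(1) R by (intro mult_mono retract_lipschitz add_mono norm_retract_le) auto
    finally show ?thesis by (simp add: algebra_simps)
  qed
  then show ?thesis using K R by (intro exI[of _ "4 * R * K"]) auto
qed

section \<open>Half powers of A and the cancellation in the energy\<close>

context sabra
begin

definition inv_sqrt_A :: "ell2 \<Rightarrow> ell2" where
  "inv_sqrt_A = scale_seq (\<lambda>n. of_real (1 / k n))"

lemma inv_sqrt_A_bound: "cmod (of_real (1 / k n)) \<le> 1 / k0"
  using k_ge[of n] k0_pos k_pos[of n] by (simp add: norm_divide frac_le)

lemma coord_inv_sqrt_A: "k n *\<^sub>R coord (inv_sqrt_A x) n = coord x n"
  using scale_seq[OF inv_sqrt_A_bound] k_pos[of n] by (simp add: inv_sqrt_A_def scaleR_conv_of_real)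

lemma bounded_linear_inv_sqrt_A: "bounded_linear inv_sqrt_A"
  unfolding inv_sqrt_A_def by (rule bounded_linear_scale_seq[OF inv_sqrt_A_bound])

lemma norm_inv_sqrt_A: "norm (inv_sqrt_A x) \<le> 1 / k0 * norm x"
  unfolding inv_sqrt_A_def by (rule norm_scale_seq[OF inv_sqrt_A_bound])

text \<open>The nonlinearity loses half a power of \<open>A\<close>: \<open>B(u, v) = A\<^sup>1\<^sup>/\<^sup>2 (B_low u v) = B_high (A\<^sup>1\<^sup>/\<^sup>2 u) v\<close>.\<close>

definition B_low :: "real \<Rightarrow> real \<Rightarrow> ell2 \<Rightarrow> ell2 \<Rightarrow> ell2" where
  "B_low a b = shell_form (a * q) b (a / q) (b / q)"

definition B_high :: "real \<Rightarrow> real \<Rightarrow> ell2 \<Rightarrow> ell2 \<Rightarrow> ell2" where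
  "B_high a b = shell_form a (b * q) a (b * q)"

text \<open>Every wavenumber is expressed through \<open>k n\<close>: from
  \<open>k (n + 1) = q * k n\<close> and \<open>k (n - 1) = k n / q\<close> come the coefficients
  \<open>a * q\<close>, \<open>b\<close>, \<open>a / q\<close>, \<open>b / q\<close>.\<close>

lemma coord_B_low: "k n *\<^sub>R coord (B_low a b u v) n = shell_B_seq k0 q a b u v n"
proof (cases n)
  case (Suc m)
  have "k n = q * k m" using Suc by (simp add: k_Suc)
  then show ?thesis
    using q_gt_1 Suc by (simp add: B_low_def coord_shell_form shell_B_seq_def k_Suc scaleR_conv_of_real field_simps)
qed (simp add: B_low_def coord_shell_form shell_B_seq_def)

text \<open>Each wavenumber is attached to the component of \<open>u\<close> beside it. In both
  \<open>b\<close> terms it belongs to the next higher shell, whence \<open>b * q\<close>.\<close>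

lemma coord_B_high:
  assumes "\<And>n. coord U n = k n *\<^sub>R coord u n"
  shows "coord (B_high a b U v) n = shell_B_seq k0 q a b u v n"
proof (cases n)
  case (Suc m)
  \<comment> \<open>For \<open>m = 0\<close> the truncated subtraction turns
    \<open>k (m - 1)\<close> into \<open>k 0\<close>; the identity then holds because
    \<open>coord u 0 = 0\<close>.\<close>
  have "k m *\<^sub>R coord u (m - 1) = (q * k (m - 1)) *\<^sub>R coord u (m - 1)"
    by (cases m) (auto simp: k_Suc)
  then have *: "of_real (k m) * coord u (m - Suc 0) = of_real q * (of_real (k (m - Suc 0)) * coord u (m - Suc 0))"
    by (simp add: scaleR_conv_of_real)
  have "of_real (b * k m) * coord v m * coord u (m - Suc 0)
      = of_real (b * q) * coord v m * (of_real (k (m - Suc 0)) * coord u (m - Suc 0))"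
    using arg_cong[OF *, of "\<lambda>z. of_real b * coord v m * z"] by (simp add: algebra_simps)
  then show ?thesis
    using Suc by (simp add: B_high_def coord_shell_form shell_B_seq_def k_Suc scaleR_conv_of_real assms
        numeral_2_eq_2 algebra_simps)
qed (simp add: B_high_def coord_shell_form shell_B_seq_def)

lemma shell_B_eq_B_high:
  assumes "\<And>n. coord U n = k n *\<^sub>R coord u n"
  shows "shell_B k0 q a b u v = B_high a b U v"
proof -
  have "shell_B_seq k0 q a b u v = coord (B_high a b U v)"
    using coord_B_high[OF assms] by auto
  then show ?thesis by (simp add: shell_B_def ell2_of_def coord_mem)
qed

text \<open>With the triad interaction \<open>\<xi> n\<close>, the pairing in shell \<open>n\<close>
  is \<open>a * \<xi> (n + 1) + b * \<xi> n - (a + b) * \<xi> (n - 1)\<close>; here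
  \<open>a + b\<close> is the \<open>- c\<close> of the model. The coefficients sum to 0, so this is
  an increment of the energy flux \<open>D\<close> and the series telescopes. The existence of
  \<open>U\<close> sends the flux to 0 at infinity.\<close>

lemma B_high_orthogonal:
  assumes U: "\<And>n. coord U n = k n *\<^sub>R coord u n"
  shows "inner (B_high a b U u) u = 0"
proof -
  define \<xi> where "\<xi> n = k n * Im (coord u (n + 1) * cnj (coord u n) * cnj (coord u (n - 1)))" for n
  define D where "D n = a * \<xi> n + (a + b) * \<xi> (n - 1)" for n
  have "inner (coord (B_high a b U u) n) (coord u n) = D (Suc n) - D n" for n
  proof (cases n)
    case 0
    then show ?thesis by (simp add: D_def \<xi>_def)
  next
    case (Suc m)
    then show ?thesis
      unfolding coord_B_high[OF U] by (simp add: shell_B_seq_def D_def \<xi>_def inner_complex_def algebra_simps numeral_2_eq_2)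
  qed
  moreover have "(\<lambda>n. D (Suc n) - D n) sums (0 - D 0)"
  proof (rule telescope_sums)
    have "(\<lambda>n. (cmod (coord U n))\<^sup>2) \<longlonglongrightarrow> 0"
      by (rule summable_LIMSEQ_zero[OF summable_coord])
    from tendsto_real_sqrt[OF this] have "(\<lambda>n. cmod (coord U n)) \<longlonglongrightarrow> 0" by simp
    from tendsto_mult_right_zero[OF this, of "(norm u)\<^sup>2"]
    have lim: "(\<lambda>n. (norm u)\<^sup>2 * cmod (coord U n)) \<longlonglongrightarrow> 0" .
    \<comment> \<open>The factor \<open>k n\<close> is given to the middle component, turning it
      into \<open>coord U n\<close>; the other two are bounded by \<open>norm u\<close>.\<close>
    have le: "norm (\<xi> n) \<le> (norm u)\<^sup>2 * cmod (coord U n)" for n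
    proof -
      have "norm (\<xi> n) = k n * \<bar>Im (coord u (n + 1) * cnj (coord u n) * cnj (coord u (n - 1)))\<bar>"
        by (simp only: \<xi>_def real_norm_def abs_mult abs_of_pos[OF k_pos])
      also have "\<dots> \<le> k n * cmod (coord u (n + 1) * cnj (coord u n) * cnj (coord u (n - 1)))"
        using k_pos[of n] by (intro mult_left_mono abs_Im_le_cmod) simp
      also have "\<dots> = (cmod (coord u (n + 1)) * cmod (coord u (n - 1))) * cmod (coord U n)"
        using k_pos[of n] by (simp add: norm_mult U)
      also have "\<dots> \<le> (norm u * norm u) * cmod (coord U n)"
        by (intro mult_right_mono mult_mono cmod_coord_le) auto
      finally show ?thesis by (simp add: power2_eq_square)
    qed
    have \<xi>: "\<xi> \<longlonglongrightarrow> 0"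
      by (rule Lim_null_comparison[OF _ lim]) (simp add: le[unfolded real_norm_def])
    have "(\<lambda>n. \<xi> (n - 1)) \<longlonglongrightarrow> 0"
      by (rule LIMSEQ_imp_Suc) (simp add: \<xi>)
    then have "D \<longlonglongrightarrow> a * 0 + (a + b) * 0"
      unfolding D_def by (intro tendsto_intros \<xi>)
    then show "D \<longlonglongrightarrow> 0" by simp
  qed
  moreover have "D 0 = 0" by (simp add: D_def \<xi>_def)
  ultimately show ?thesis
    using inner_ell2_sums[of "B_high a b U u" u] sums_unique2 by force
qed

end

section \<open>Regularity\<close>

lemma power2_sum_le: "(norm (x + y))\<^sup>2 \<le> 2 * (norm x)\<^sup>2 + 2 * (norm y)\<^sup>2"
  for x y :: "'a :: real_normed_vector"
proof -
  have "(norm (x + y))\<^sup>2 \<le> (norm x + norm y)\<^sup>2" by (intro power_mono norm_triangle_ineq) simp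
  also have "\<dots> \<le> 2 * (norm x)\<^sup>2 + 2 * (norm y)\<^sup>2"
    using sum_squares_bound[of "norm x" "norm y"] by (simp add: power2_sum)
  finally show ?thesis .
qed

lemma continuous_on_Icc_bounded:
  fixes f :: "real \<Rightarrow> 'a :: real_normed_vector"
  assumes "continuous_on {a..b} f"
  obtains C where "\<And>t. t \<in> {a..b} \<Longrightarrow> norm (f t) \<le> C"
proof -
  have "bounded (f ` {a..b})"
    by (intro compact_imp_bounded compact_continuous_image assms) simp
  then obtain C where "\<forall>x\<in>f ` {a..b}. norm x \<le> C" unfolding bounded_iff by blast
  then show ?thesis using that[of C] by blast
qed

text \<open>The difference quotients are bounded by \<Lambda> in \<open>H\<close> and converge mode
  by mode, so every partial sum of squares of the limit inherits the bound. Convergence in norm is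
  not claimed.\<close>

lemma ell2_derivative:
  assumes T: "0 < T" and t: "t \<in> {0..T}"
    and D: "\<And>n. ((\<lambda>s. coord (y s) n) has_vector_derivative d n) (at t within {0..T})"
    and lip: "\<And>s. s \<in> {0..T} \<Longrightarrow> norm (y s - y t) \<le> \<Lambda> * \<bar>s - t\<bar>" and \<Lambda>: "0 \<le> \<Lambda>"
  shows "\<exists>v. coord v = d \<and> norm v \<le> \<Lambda>"
proof -
  have nt: "at t within {0..T} \<noteq> bot"
    using T t by (simp add: trivial_limit_within)
  have lim: "((\<lambda>s. (coord (y s) n - coord (y t) n) /\<^sub>R (s - t)) \<longlongrightarrow> d n) (at t within {0..T})" for n
  proof (rule Lim_transform_within[OF _ zero_less_one])
    have "((\<lambda>s. norm (coord (y s) n - coord (y t) n - (s - t) *\<^sub>R d n) / norm (s - t)) \<longlongrightarrow> 0) (at t within {0..T})"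
      using D[of n] by (simp add: has_vector_derivative_def has_derivative_iff_norm)
    then have "((\<lambda>s. norm ((coord (y s) n - coord (y t) n - (s - t) *\<^sub>R d n) /\<^sub>R (s - t))) \<longlongrightarrow> 0) (at t within {0..T})"
      by (simp add: divide_inverse mult.commute)
    then have "((\<lambda>s. (coord (y s) n - coord (y t) n - (s - t) *\<^sub>R d n) /\<^sub>R (s - t)) \<longlongrightarrow> 0) (at t within {0..T})"
      by (rule tendsto_norm_zero_cancel)
    from tendsto_add[OF this tendsto_const[of "d n"]]
    show "((\<lambda>s. (coord (y s) n - coord (y t) n - (s - t) *\<^sub>R d n) /\<^sub>R (s - t) + d n) \<longlongrightarrow> d n) (at t within {0..T})"
      by simp
  qed (simp add: scaleR_diff_right)
  have "d 0 = 0"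
    using tendsto_unique[OF nt lim[of 0]] by simp
  have "(\<Sum>n<N. (cmod (d n))\<^sup>2) \<le> \<Lambda>\<^sup>2" for N
  proof (rule tendsto_upperbound[OF _ _ nt])
    show "((\<lambda>s. \<Sum>n<N. (cmod ((coord (y s) n - coord (y t) n) /\<^sub>R (s - t)))\<^sup>2) \<longlongrightarrow> (\<Sum>n<N. (cmod (d n))\<^sup>2)) (at t within {0..T})"
      by (intro tendsto_intros lim)
    have "(\<Sum>n<N. (cmod ((coord (y s) n - coord (y t) n) /\<^sub>R (s - t)))\<^sup>2) \<le> \<Lambda>\<^sup>2" if s: "s \<in> {0..T}" "s \<noteq> t" for s
    proof -
      have "(\<Sum>n<N. (cmod ((coord (y s) n - coord (y t) n) /\<^sub>R (s - t)))\<^sup>2) \<le> (norm ((y s - y t) /\<^sub>R (s - t)))\<^sup>2"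
        using ell2_partial_le[of "(y s - y t) /\<^sub>R (s - t)" N] by simp
      also have "norm ((y s - y t) /\<^sub>R (s - t)) = norm (y s - y t) / \<bar>s - t\<bar>"
        by (simp only: norm_scaleR abs_inverse divide_inverse mult.commute)
      also have "(norm (y s - y t) / \<bar>s - t\<bar>)\<^sup>2 \<le> \<Lambda>\<^sup>2"
        using lip[OF s(1)] s(2) by (intro power_mono) (auto simp: divide_le_eq)
      finally show ?thesis .
    qed
    then show "\<forall>\<^sub>F s in at t within {0..T}. (\<Sum>n<N. (cmod ((coord (y s) n - coord (y t) n) /\<^sub>R (s - t)))\<^sup>2) \<le> \<Lambda>\<^sup>2"
      by (auto simp: eventually_at intro!: exI[of _ 1])
  qed
  from coord_ell2_of_bound[OF \<open>d 0 = 0\<close> this \<Lambda>] show ?thesis by blast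
qed

text \<open>The shifted and the unshifted integral differ only by two end pieces of length
  \<open>h\<close>, on which monotonicity bounds \<open>G\<close>. This yields a full factor
  \<open>h\<close> without any rate for \<open>G\<close> itself.\<close>

lemma integral_shift_diff_le:
  fixes G :: "real \<Rightarrow> real"
  assumes G: "continuous_on {0..T} G" "\<And>s t. 0 \<le> s \<Longrightarrow> s \<le> t \<Longrightarrow> t \<le> T \<Longrightarrow> G s \<le> G t"
    and h: "0 \<le> h" and t: "0 \<le> t" "t + h \<le> T"
  shows "integral {0..t} (\<lambda>s. G (s + h) - G s) \<le> h * (G T - G 0)"
proof -
  have I: "G integrable_on {a..b}" if "0 \<le> a" "b \<le> T" for a b
    by (rule integrable_continuous_real) (rule continuous_on_subset[OF G(1)], use that in auto)
  have ch: "continuous_on {0..t} (\<lambda>s. G (s + h))"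
    by (rule continuous_on_compose2[OF G(1)]) (use h t in \<open>auto intro!: continuous_intros\<close>)
  have "integral {0..t} (\<lambda>s. G (s + h) - G s) = integral {0..t} (\<lambda>s. G (s + h)) - integral {0..t} G"
    by (rule integral_diff[OF integrable_continuous_real[OF ch] I]) (use h t in auto)
  also have "integral {0..t} (\<lambda>s. G (s + h)) = integral {h..t + h} G"
    using integral_shift_real_ivl[of h h "t + h" G] by simp
  also have "integral {h..t + h} G - integral {0..t} G = integral {t..t + h} G - integral {0..h} G"
    using Henstock_Kurzweil_Integration.integral_combine[of 0 h "t + h" G, OF _ _ I]
      Henstock_Kurzweil_Integration.integral_combine[of 0 t "t + h" G, OF _ _ I] h t by simp
  finally have eq: "integral {0..t} (\<lambda>s. G (s + h) - G s) = integral {t..t + h} G - integral {0..h} G" .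
  have "integral {t..t + h} G \<le> integral {t..t + h} (\<lambda>_. G T)"
    by (rule integral_le) (use h t in \<open>auto intro!: I G\<close>)
  moreover have "integral {0..h} (\<lambda>_. G 0) \<le> integral {0..h} G"
    by (rule integral_le) (use h t in \<open>auto intro!: I G\<close>)
  ultimately show ?thesis unfolding eq using h by (simp add: algebra_simps)
qed

section \<open>Lipschitz continuity in time and boundedness of A u\<close>

context sabra
begin

text \<open>A constant solves the equation once its residual is put into \<gamma>; subtracting it
  from \<open>u\<close> leaves an evolution that starts at 0.\<close>

lemma evolves_const:
  assumes "\<And>t n. t \<in> {0..T} \<Longrightarrow> coord (\<gamma> t) n = (\<nu> * (k n)\<^sup>2) *\<^sub>R coord w n - k n *\<^sub>R coord (\<beta> t) n"
  shows "evolves T (\<lambda>_. w) \<beta> \<gamma>"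
  unfolding evolves_def by (simp add: assms has_vector_derivative_const)

text \<open>Splitting \<open>2 C \<bar>w\<bar> \<le> h C\<^sup>2 + \<bar>w\<bar>\<^sup>2 / h\<close> costs only a bounded factor in Gronwall's lemma on
  \<open>[0, h]\<close>, which is how \<open>O(h)\<close> is obtained rather than \<open>O(\<surd>h)\<close>.\<close>

lemma lipschitz_at_start:
  fixes N :: "real \<Rightarrow> ell2 \<Rightarrow> ell2"
  assumes u: "evolves T u (\<lambda>t. N t (u t)) (\<lambda>_. 0)" "continuous_on {0..T} u"
    and cont: "\<And>u. continuous_on {0..T} u \<Longrightarrow> continuous_on {0..T} (\<lambda>t. N t (u t))"
    and L: "\<And>t u w. t \<in> {0..T} \<Longrightarrow> norm (N t u - N t w) \<le> L * norm (u - w)"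
    and \<Gamma>: "continuous_on {0..T} \<Gamma>" "\<And>t. t \<in> {0..T} \<Longrightarrow> norm (\<Gamma> t) \<le> C"
    and compat: "\<And>t n. t \<in> {0..T} \<Longrightarrow>
      coord (\<Gamma> t) n = k n *\<^sub>R coord (N t (u 0)) n - (\<nu> * (k n)\<^sup>2) *\<^sub>R coord (u 0) n"
    and h: "0 < h" "h \<le> T"
  shows "(norm (u h - u 0))\<^sup>2 \<le> h\<^sup>2 * (C\<^sup>2 * exp (L\<^sup>2 / (2 * \<nu>) * T + 1))"
proof -
  define M where "M = L\<^sup>2 / (2 * \<nu>)"
  have M: "0 \<le> M" using nu_pos by (simp add: M_def)
  have C: "0 \<le> C" using order_trans[OF norm_ge_zero \<Gamma>(2)[of 0]] h by simp
  define w where "w t = u t - u 0" for t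
  have "evolves T (\<lambda>_. u 0) (\<lambda>t. N t (u 0)) (\<lambda>t. - \<Gamma> t)"
    by (rule evolves_const) (simp add: compat)
  from evolves_diff[OF u(1) this]
  have ev: "evolves T w (\<lambda>t. N t (u t) - N t (u 0)) \<Gamma>" by (simp add: w_def[abs_def])
  have wc: "continuous_on {0..T} w" unfolding w_def by (intro continuous_intros u)
  have est: "(norm (w t))\<^sup>2 \<le> h\<^sup>2 * C\<^sup>2 + (M + 1 / h) * integral {0..t} (\<lambda>s. (norm (w s))\<^sup>2)" if t: "t \<in> {0..h}" for t
  proof -
    have sub: "continuous_on {0..t} g" if "continuous_on {0..T} g" for g :: "real \<Rightarrow> ell2"
      using that by (rule continuous_on_subset) (use t h in auto)
    have c: "continuous_on {0..t} (\<lambda>t. N t (u t) - N t (u 0))"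
      by (intro sub continuous_on_diff cont u continuous_on_const)
    have "(norm (w t))\<^sup>2 \<le> (norm (w 0))\<^sup>2 + integral {0..t}
        (\<lambda>s. (norm (N s (u s) - N s (u 0)))\<^sup>2 / (2 * \<nu>) + 2 * inner (\<Gamma> s) (w s))"
      by (rule energy_estimate[OF evolves_subset[OF ev]]) (use t h in \<open>auto intro!: sub c wc \<Gamma>\<close>)
    also have "\<dots> = integral {0..t}
        (\<lambda>s. (norm (N s (u s) - N s (u 0)))\<^sup>2 / (2 * \<nu>) + 2 * inner (\<Gamma> s) (w s))"
      by (simp add: w_def)
    also have "\<dots> \<le> integral {0..t} (\<lambda>s. h * C\<^sup>2 + (M + 1 / h) * (norm (w s))\<^sup>2)"
    proof (rule integral_le)
      show "(\<lambda>s. (norm (N s (u s) - N s (u 0)))\<^sup>2 / (2 * \<nu>) + 2 * inner (\<Gamma> s) (w s)) integrable_on {0..t}"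
        using nu_pos by (intro integrable_continuous_real continuous_intros c sub wc \<Gamma>) auto
      show "(\<lambda>s. h * C\<^sup>2 + (M + 1 / h) * (norm (w s))\<^sup>2) integrable_on {0..t}"
        by (intro integrable_continuous_real continuous_intros sub wc)
      fix s assume "s \<in> {0..t}"
      then have s: "s \<in> {0..T}" using t h by auto
      have "(norm (N s (u s) - N s (u 0)))\<^sup>2 \<le> (L * norm (w s))\<^sup>2"
        unfolding w_def using s by (intro power_mono L) auto
      then have "(norm (N s (u s) - N s (u 0)))\<^sup>2 / (2 * \<nu>) \<le> (L * norm (w s))\<^sup>2 / (2 * \<nu>)"
        by (rule divide_right_mono) (use nu_pos in simp)
      then have 1: "(norm (N s (u s) - N s (u 0)))\<^sup>2 / (2 * \<nu>) \<le> M * (norm (w s))\<^sup>2"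
        by (simp add: M_def power_mult_distrib)
      have "2 * inner (\<Gamma> s) (w s) \<le> 2 * (norm (\<Gamma> s) * norm (w s))"
        using norm_cauchy_schwarz[of "\<Gamma> s" "w s"] by simp
      also have "\<dots> \<le> 2 * (C * norm (w s))" using \<Gamma>(2)[OF s] by (simp add: mult_right_mono)
      also have "\<dots> \<le> h * C\<^sup>2 + (norm (w s))\<^sup>2 / h"
      proof -
        have "0 \<le> (h * C - norm (w s))\<^sup>2 / h" using h by simp
        also have "\<dots> = h * C\<^sup>2 + (norm (w s))\<^sup>2 / h - 2 * (C * norm (w s))"
          using h by (simp add: power2_eq_square field_simps)
        finally show ?thesis by simp
      qed
      finally show "(norm (N s (u s) - N s (u 0)))\<^sup>2 / (2 * \<nu>) + 2 * inner (\<Gamma> s) (w s)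
          \<le> h * C\<^sup>2 + (M + 1 / h) * (norm (w s))\<^sup>2"
        using 1 by (simp add: distrib_right)
    qed
    also have "\<dots> = t * (h * C\<^sup>2) + (M + 1 / h) * integral {0..t} (\<lambda>s. (norm (w s))\<^sup>2)"
      using t by (subst integral_add)
        (auto intro!: integrable_continuous_real continuous_intros sub wc)
    also have "t * (h * C\<^sup>2) \<le> h * (h * C\<^sup>2)" using t h by (intro mult_right_mono) auto
    finally show ?thesis by (simp add: power2_eq_square mult.assoc)
  qed
  have "(norm (w h))\<^sup>2 \<le> h\<^sup>2 * C\<^sup>2 * exp ((M + 1 / h) * h)"
    using h M by (intro gronwall[OF _ _ _ est] continuous_intros continuous_on_subset[OF wc]) auto
  also have "(M + 1 / h) * h = M * h + 1" using h by (simp add: field_simps)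
  also have "h\<^sup>2 * C\<^sup>2 * exp (M * h + 1) \<le> h\<^sup>2 * C\<^sup>2 * exp (M * T + 1)"
    using h M by (intro mult_left_mono) (auto intro: mult_left_mono)
  finally show ?thesis by (simp add: w_def M_def mult.assoc)
qed

text \<open>The increment \<open>u (t + h) - u t\<close> solves an evolution of the same form. It is
  of order \<open>h\<close> at \<open>t = 0\<close> by \<open>lipschitz_at_start\<close>. Its source
  changes through the state, which Gronwall handles, and through time, where \<open>NG\<close> and
  \<open>integral_shift_diff_le\<close> contribute
  \<open>h\<^sup>2 * ((G T - G 0) / \<nu>)\<close>.\<close>

lemma lipschitz_in_time:
  fixes N :: "real \<Rightarrow> ell2 \<Rightarrow> ell2"
  assumes u: "evolves T u (\<lambda>t. N t (u t)) (\<lambda>_. 0)" "continuous_on {0..T} u"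
    and cont: "\<And>u. continuous_on {0..T} u \<Longrightarrow> continuous_on {0..T} (\<lambda>t. N t (u t))"
    and L: "\<And>t u w. t \<in> {0..T} \<Longrightarrow> norm (N t u - N t w) \<le> L * norm (u - w)"
    and \<Gamma>: "continuous_on {0..T} \<Gamma>"
    and compat: "\<And>t n. t \<in> {0..T} \<Longrightarrow>
      coord (\<Gamma> t) n = k n *\<^sub>R coord (N t (u 0)) n - (\<nu> * (k n)\<^sup>2) *\<^sub>R coord (u 0) n"
    and G: "continuous_on {0..T} G" "\<And>s t. 0 \<le> s \<Longrightarrow> s \<le> t \<Longrightarrow> t \<le> T \<Longrightarrow> G s \<le> G t"
    and NG: "\<And>s t x. 0 \<le> s \<Longrightarrow> s \<le> t \<Longrightarrow> t \<le> T \<Longrightarrow> (norm (N t x - N s x))\<^sup>2 \<le> (t - s) * (G t - G s)"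
  shows "\<exists>\<Lambda>\<ge>0. \<forall>s\<in>{0..T}. \<forall>t\<in>{0..T}. norm (u t - u s) \<le> \<Lambda> * \<bar>t - s\<bar>"
proof -
  obtain C where C: "\<And>t. t \<in> {0..T} \<Longrightarrow> norm (\<Gamma> t) \<le> C"
    by (rule continuous_on_Icc_bounded[OF \<Gamma>]) blast
  \<comment> \<open>Twice the \<open>L\<^sup>2 / (2 * \<nu>)\<close> of a single difference:
    \<open>power2_sum_le\<close> separates the change of \<open>N\<close> in the state from its
    change in time.\<close>
  define M where "M = L\<^sup>2 / \<nu>"
  have M: "0 \<le> M" using nu_pos by (simp add: M_def)
  define C1 where "C1 = C\<^sup>2 * exp (L\<^sup>2 / (2 * \<nu>) * T + 1)"
  define \<Lambda> where "\<Lambda> = sqrt ((C1 + (G T - G 0) / \<nu>) * exp (M * T))"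
  have incr: "(norm (u (s + h) - u s))\<^sup>2 \<le> h\<^sup>2 * ((C1 + (G T - G 0) / \<nu>) * exp (M * T))"
    if s: "0 \<le> s" and h: "0 < h" and sh: "s + h \<le> T" for s h
  proof -
    define w where "w t = u (t + h) - u t" for t
    have ev: "evolves (T - h) w (\<lambda>t. N (t + h) (u (t + h)) - N t (u t)) (\<lambda>t. 0 - 0)"
      unfolding w_def using h by (intro evolves_diff evolves_shift evolves_subset[OF u(1)] u) auto
    have shift: "continuous_on {0..T - h} (\<lambda>t. g (t + h))" if "continuous_on {0..T} g" for g :: "real \<Rightarrow> ell2"
      by (rule continuous_on_compose2[OF that]) (use h in \<open>auto intro!: continuous_intros\<close>)
    have restr: "continuous_on {0..T - h} g" if "continuous_on {0..T} g" for g :: "real \<Rightarrow> 'b :: topological_space"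
      by (rule continuous_on_subset[OF that]) (use h in auto)
    have Gs: "continuous_on {0..T - h} (\<lambda>t. G (t + h))"
      by (rule continuous_on_compose2[OF G(1)]) (use h in \<open>auto intro!: continuous_intros\<close>)
    have wc: "continuous_on {0..T - h} w"
      unfolding w_def by (intro continuous_intros shift restr u)
    have c: "continuous_on {0..T - h} (\<lambda>t. N (t + h) (u (t + h)) - N t (u t))"
      by (intro continuous_on_diff restr[OF cont[OF u(2)]] shift[OF cont[OF u(2)]])
    have est: "(norm (w t))\<^sup>2 \<le> h\<^sup>2 * (C1 + (G T - G 0) / \<nu>) + M * integral {0..t} (\<lambda>s. (norm (w s))\<^sup>2)"
      if t: "t \<in> {0..T - h}" for t
    proof -
      have sub: "continuous_on {0..t} g" if "continuous_on {0..T - h} g" for g :: "real \<Rightarrow> 'b :: topological_space"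
        using that by (rule continuous_on_subset) (use t in auto)
      have "(norm (w t))\<^sup>2 \<le> (norm (w 0))\<^sup>2 + integral {0..t}
          (\<lambda>s. (norm (N (s + h) (u (s + h)) - N s (u s)))\<^sup>2 / (2 * \<nu>) + 2 * inner (0 - 0) (w s))"
        by (rule energy_estimate[OF evolves_subset[OF ev]]) (use t in \<open>auto intro!: sub c wc\<close>)
      also have "\<dots> = (norm (w 0))\<^sup>2 + integral {0..t}
          (\<lambda>s. (norm (N (s + h) (u (s + h)) - N s (u s)))\<^sup>2 / (2 * \<nu>))" by simp
      also have "(norm (w 0))\<^sup>2 \<le> h\<^sup>2 * C1"
        unfolding w_def C1_def using lipschitz_at_start[OF u cont L \<Gamma> C compat h] s sh by simp
      also have "integral {0..t} (\<lambda>s. (norm (N (s + h) (u (s + h)) - N s (u s)))\<^sup>2 / (2 * \<nu>))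
          \<le> integral {0..t} (\<lambda>s. M * (norm (w s))\<^sup>2 + h / \<nu> * (G (s + h) - G s))"
      proof (rule integral_le)
        show "(\<lambda>s. (norm (N (s + h) (u (s + h)) - N s (u s)))\<^sup>2 / (2 * \<nu>)) integrable_on {0..t}"
          using nu_pos by (intro integrable_continuous_real continuous_intros sub c) auto
        show "(\<lambda>s. M * (norm (w s))\<^sup>2 + h / \<nu> * (G (s + h) - G s)) integrable_on {0..t}"
          by (intro integrable_continuous_real continuous_intros sub wc Gs restr[OF G(1)])
        fix s assume "s \<in> {0..t}"
        then have s: "0 \<le> s" "s + h \<le> T" using t by auto
        have "(norm (N (s + h) (u (s + h)) - N s (u s)))\<^sup>2
            \<le> 2 * (norm (N (s + h) (u (s + h)) - N (s + h) (u s)))\<^sup>2 + 2 * (norm (N (s + h) (u s) - N s (u s)))\<^sup>2"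
          using power2_sum_le[of "N (s + h) (u (s + h)) - N (s + h) (u s)" "N (s + h) (u s) - N s (u s)"] by simp
        also have "\<dots> \<le> 2 * (L * norm (w s))\<^sup>2 + 2 * (h * (G (s + h) - G s))"
          using NG[of s "s + h" "u s"] s h unfolding w_def
          by (intro add_mono mult_left_mono power_mono L) auto
        finally have "(norm (N (s + h) (u (s + h)) - N s (u s)))\<^sup>2 / (2 * \<nu>)
            \<le> (2 * (L * norm (w s))\<^sup>2 + 2 * (h * (G (s + h) - G s))) / (2 * \<nu>)"
          by (rule divide_right_mono) (use nu_pos in simp)
        also have "\<dots> = M * (norm (w s))\<^sup>2 + h / \<nu> * (G (s + h) - G s)"
          using nu_pos by (simp add: M_def power_mult_distrib field_simps)
        finally show "(norm (N (s + h) (u (s + h)) - N s (u s)))\<^sup>2 / (2 * \<nu>)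
            \<le> M * (norm (w s))\<^sup>2 + h / \<nu> * (G (s + h) - G s)" .
      qed
      also have "\<dots> = M * integral {0..t} (\<lambda>s. (norm (w s))\<^sup>2) + h / \<nu> * integral {0..t} (\<lambda>s. G (s + h) - G s)"
      proof -
        have "(\<lambda>s. M * (norm (w s))\<^sup>2) integrable_on {0..t}"
          by (intro integrable_continuous_real continuous_intros sub wc)
        moreover have "(\<lambda>s. h / \<nu> * (G (s + h) - G s)) integrable_on {0..t}"
          by (intro integrable_continuous_real continuous_intros sub Gs restr[OF G(1)])
        ultimately show ?thesis
          by (simp only: Henstock_Kurzweil_Integration.integral_add integral_mult_right)
      qed
      also have "h / \<nu> * integral {0..t} (\<lambda>s. G (s + h) - G s) \<le> h / \<nu> * (h * (G T - G 0))"
        using h nu_pos t by (intro mult_left_mono integral_shift_diff_le G) auto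
      finally have "(norm (w t))\<^sup>2 \<le> h\<^sup>2 * C1
          + (M * integral {0..t} (\<lambda>s. (norm (w s))\<^sup>2) + h / \<nu> * (h * (G T - G 0)))" by simp
      moreover have "h / \<nu> * (h * (G T - G 0)) = h\<^sup>2 * ((G T - G 0) / \<nu>)"
        by (simp add: power2_eq_square)
      ultimately show ?thesis unfolding distrib_left[of "h\<^sup>2" C1] by linarith
    qed
    have "(norm (w s))\<^sup>2 \<le> h\<^sup>2 * (C1 + (G T - G 0) / \<nu>) * exp (M * s)"
    proof (rule gronwall[OF _ M _ est])
      show "continuous_on {0..T - h} (\<lambda>t. (norm (w t))\<^sup>2)" by (intro continuous_intros wc)
    qed (use s sh in auto)
    also have "\<dots> \<le> h\<^sup>2 * (C1 + (G T - G 0) / \<nu>) * exp (M * T)"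
    proof (intro mult_left_mono)
      show "exp (M * s) \<le> exp (M * T)" using M sh h by (simp add: mult_left_mono)
      show "0 \<le> h\<^sup>2 * (C1 + (G T - G 0) / \<nu>)"
        using G(2)[of 0 T] s h sh nu_pos by (auto intro!: mult_nonneg_nonneg add_nonneg_nonneg simp: C1_def)
    qed
    finally show ?thesis by (simp add: w_def mult.assoc)
  qed
  have lip: "norm (u t - u s) \<le> \<Lambda> * (t - s)" if "0 \<le> s" "s < t" "t \<le> T" for s t
  proof -
    have "(norm (u t - u s))\<^sup>2 \<le> (t - s)\<^sup>2 * ((C1 + (G T - G 0) / \<nu>) * exp (M * T))"
      using incr[of s "t - s"] that by simp
    from real_sqrt_le_mono[OF this] show ?thesis
      using that by (simp add: \<Lambda>_def real_sqrt_mult mult.commute)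
  qed
  have "norm (u t - u s) \<le> \<Lambda> * \<bar>t - s\<bar>" if "s \<in> {0..T}" "t \<in> {0..T}" for s t
    using lip[of s t] lip[of t s] that by (cases s t rule: linorder_cases) (auto simp: norm_minus_commute)
  then show ?thesis
    by (intro exI[of _ "\<bar>\<Lambda>\<bar>"]) (auto intro: order_trans[OF _ mult_right_mono[OF abs_ge_self]])
qed

text \<open>With \<open>U\<close> as \<open>A\<^sup>1\<^sup>/\<^sup>2 u\<close> and \<open>W\<close>
  as \<open>A u\<close>, the square is the pairing of \<open>W\<close> with \<open>u\<close>. This
  will turn a bound of \<open>A u\<close> and continuity of \<open>u\<close> into continuity of
  \<open>A\<^sup>1\<^sup>/\<^sup>2 u\<close>.\<close>

lemma norm_interpolation:
  assumes "\<And>n. coord U n = k n *\<^sub>R coord u n" "\<And>n. coord W n = (k n)\<^sup>2 *\<^sub>R coord u n"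
  shows "(norm U)\<^sup>2 \<le> norm W * norm u"
proof -
  have "(cmod (coord U n))\<^sup>2 = inner (coord W n) (coord u n)" for n
    by (simp add: assms power_mult_distrib dot_square_norm)
  then have "(norm U)\<^sup>2 = inner W u"
    using norm_ell2_sums[of U] inner_ell2_sums[of W u] sums_unique2 by simp
  then show ?thesis using norm_cauchy_schwarz[of W u] by simp
qed

lemma dom_A_I:
  assumes "\<And>n. coord W n = (k n)\<^sup>2 *\<^sub>R coord u n"
  shows "u \<in> dom_A k0 q" "shell_A k0 q u = W"
proof -
  have "shell_A_seq k0 q u = coord W" by (auto simp: shell_A_seq_def assms scaleR_conv_of_real)
  then show "u \<in> dom_A k0 q" "shell_A k0 q u = W"
    by (simp_all add: dom_A_def summable_coord shell_A_def ell2_of_def coord_mem)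
qed

lemma coord_shell_A_scaleR: "u \<in> dom_A k0 q \<Longrightarrow> coord (shell_A k0 q u) n = (k n)\<^sup>2 *\<^sub>R coord u n"
  by (simp add: coord_shell_A shell_A_seq_def scaleR_conv_of_real)

lemma sqrt_A_exists:
  assumes "u \<in> dom_A k0 q"
  obtains U where "\<And>n. coord U n = k n *\<^sub>R coord u n"
proof
  fix n
  have "k n *\<^sub>R coord (inv_sqrt_A (shell_A k0 q u)) n = k n *\<^sub>R (k n *\<^sub>R coord u n)"
    by (simp add: coord_inv_sqrt_A coord_shell_A_scaleR[OF assms] power2_eq_square)
  then show "coord (inv_sqrt_A (shell_A k0 q u)) n = k n *\<^sub>R coord u n"
    using k_pos[of n] unfolding scaleR_cancel_left by simp
qed

text \<open>A bootstrap through half powers of \<open>A\<close>. A Lipschitz solution has a velocity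
  \<open>v\<close> in \<open>H\<close>. Dividing the modal equation by \<open>k n\<close> yields
  \<open>A\<^sup>1\<^sup>/\<^sup>2 u\<close> in \<open>H\<close>; this puts the nonlinearity itself
  in \<open>H\<close>, by way of \<open>B_high\<close>, and the undivided equation then yields
  \<open>A u\<close>.\<close>

lemma spatial_regularity:
  assumes T: "0 < T"
    and u: "evolves T u (\<lambda>t. inv_sqrt_A (F t) - r t *\<^sub>R B_low a b (u t) (u t)) (\<lambda>_. 0)" "continuous_on {0..T} u"
    and F: "continuous_on {0..T} F" and r: "continuous_on {0..T} r"
    and \<Lambda>: "0 \<le> \<Lambda>" "\<And>s t. s \<in> {0..T} \<Longrightarrow> t \<in> {0..T} \<Longrightarrow> norm (u t - u s) \<le> \<Lambda> * \<bar>t - s\<bar>"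
  shows "\<exists>C U. continuous_on {0..T} U \<and> (\<forall>t\<in>{0..T}. u t \<in> dom_A k0 q \<and> norm (shell_A k0 q (u t)) \<le> C \<and>
    (\<forall>n. coord (U t) n = k n *\<^sub>R coord (u t) n))"
proof -
  define N where "N t = inv_sqrt_A (F t) - r t *\<^sub>R B_low a b (u t) (u t)" for t
  have "continuous_on {0..T} N"
    unfolding N_def B_low_def
    by (intro continuous_intros bounded_linear.continuous_on[OF bounded_linear_inv_sqrt_A F] r
        bounded_bilinear.continuous_on[OF bounded_bilinear_shell_form] u)
  then obtain CN where bd1: "\<And>t. t \<in> {0..T} \<Longrightarrow> norm (N t) \<le> CN"
    by (rule continuous_on_Icc_bounded) blast
  obtain CF where bd2: "\<And>t. t \<in> {0..T} \<Longrightarrow> norm (F t) \<le> CF"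
    by (rule continuous_on_Icc_bounded[OF F]) blast
  obtain Cr where bd3: "\<And>t. t \<in> {0..T} \<Longrightarrow> \<bar>r t\<bar> \<le> Cr"
    by (rule continuous_on_Icc_bounded[OF r]) auto
  obtain Cu where bd4: "\<And>t. t \<in> {0..T} \<Longrightarrow> norm (u t) \<le> Cu"
    by (rule continuous_on_Icc_bounded[OF u(2)]) blast
  note bd = bd1 bd2 bd3 bd4
  obtain K where K: "K > 0" "\<And>x y. norm (B_high a b x y) \<le> norm x * norm y * K"
    using bounded_bilinear.pos_bounded[OF bounded_bilinear_shell_form] unfolding B_high_def by blast
  have "\<exists>v. coord v = (\<lambda>n. - (\<nu> * (k n)\<^sup>2) *\<^sub>R coord (u t) n + k n *\<^sub>R coord (N t) n) \<and> norm v \<le> \<Lambda>"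
    if t: "t \<in> {0..T}" for t
    using evolvesD[OF u(1) t] \<Lambda>(2)[OF t] \<Lambda>(1)
    by (intro ell2_derivative[OF T t]) (simp_all add: N_def)
  then have "\<forall>t\<in>{0..T}. \<exists>v. coord v = (\<lambda>n. - (\<nu> * (k n)\<^sup>2) *\<^sub>R coord (u t) n + k n *\<^sub>R coord (N t) n)
      \<and> norm v \<le> \<Lambda>" by blast
  from bchoice[OF this] obtain v where "\<forall>t\<in>{0..T}. coord (v t) =
      (\<lambda>n. - (\<nu> * (k n)\<^sup>2) *\<^sub>R coord (u t) n + k n *\<^sub>R coord (N t) n) \<and> norm (v t) \<le> \<Lambda>" ..
  then have v: "\<And>t n. t \<in> {0..T} \<Longrightarrow> coord (v t) n = - (\<nu> * (k n)\<^sup>2) *\<^sub>R coord (u t) n + k n *\<^sub>R coord (N t) n"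
    "\<And>t. t \<in> {0..T} \<Longrightarrow> norm (v t) \<le> \<Lambda>" by simp_all
  define U where "U t = (1 / \<nu>) *\<^sub>R (N t - inv_sqrt_A (v t))" for t
  have U: "coord (U t) n = k n *\<^sub>R coord (u t) n" if t: "t \<in> {0..T}" for t n
  proof -
    have "k n *\<^sub>R coord (U t) n = (1 / \<nu>) *\<^sub>R (k n *\<^sub>R coord (N t) n - k n *\<^sub>R coord (inv_sqrt_A (v t)) n)"
      by (simp only: U_def coord_scaleR coord_diff scaleR_diff_right scaleR_left_commute)
    also have "\<dots> = (1 / \<nu>) *\<^sub>R (k n *\<^sub>R coord (N t) n - coord (v t) n)"
      by (simp only: coord_inv_sqrt_A)
    also have "\<dots> = k n *\<^sub>R (k n *\<^sub>R coord (u t) n)"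
      using nu_pos by (simp add: v(1)[OF t] power2_eq_square)
    finally show ?thesis using k_pos[of n] unfolding scaleR_cancel_left by simp
  qed
  have Ub: "norm (U t) \<le> (1 / \<nu>) * (CN + 1 / k0 * \<Lambda>)" if t: "t \<in> {0..T}" for t
  proof -
    have "norm (N t - inv_sqrt_A (v t)) \<le> CN + 1 / k0 * \<Lambda>"
      using norm_triangle_ineq4[of "N t" "inv_sqrt_A (v t)"] bd(1)[OF t] norm_inv_sqrt_A[of "v t"]
        mult_left_mono[OF v(2)[OF t], of "1 / k0"] k0_pos by simp
    then show ?thesis unfolding U_def norm_scaleR using nu_pos by (intro mult_mono) auto
  qed
  define W where "W t = (1 / \<nu>) *\<^sub>R (F t - r t *\<^sub>R B_high a b (U t) (u t) - v t)" for t
  have W: "coord (W t) n = (k n)\<^sup>2 *\<^sub>R coord (u t) n" if t: "t \<in> {0..T}" for t n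
  proof -
    have "k n *\<^sub>R coord (N t) n = coord (F t) n - r t *\<^sub>R coord (B_high a b (U t) (u t)) n"
      unfolding coord_B_high[OF U[OF t]] coord_B_low[symmetric]
      by (simp add: N_def scaleR_diff_right coord_inv_sqrt_A scaleR_left_commute)
    then show ?thesis using nu_pos by (simp add: W_def v(1)[OF t])
  qed
  define C where "C = (1 / \<nu>) * (CF + Cr * ((1 / \<nu>) * (CN + 1 / k0 * \<Lambda>) * Cu * K) + \<Lambda>)"
  have Wb: "norm (W t) \<le> C" if t: "t \<in> {0..T}" for t
  proof -
    have pos: "0 \<le> Cu" "0 \<le> (1 / \<nu>) * (CN + 1 / k0 * \<Lambda>)" "0 \<le> Cr"
      using order_trans[OF norm_ge_zero bd(4)[OF t]] order_trans[OF norm_ge_zero Ub[OF t]]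
        order_trans[OF abs_ge_zero bd(3)[OF t]] by auto
    have "norm (B_high a b (U t) (u t)) \<le> norm (U t) * norm (u t) * K" by (rule K)
    also have "\<dots> \<le> (1 / \<nu>) * (CN + 1 / k0 * \<Lambda>) * Cu * K"
      using K(1) pos by (intro mult_right_mono mult_mono Ub[OF t] bd(4)[OF t]) auto
    finally have B: "norm (B_high a b (U t) (u t)) \<le> (1 / \<nu>) * (CN + 1 / k0 * \<Lambda>) * Cu * K" .
    have "norm (r t *\<^sub>R B_high a b (U t) (u t)) \<le> Cr * ((1 / \<nu>) * (CN + 1 / k0 * \<Lambda>) * Cu * K)"
      unfolding norm_scaleR by (rule mult_mono[OF bd(3)[OF t] B pos(3) norm_ge_zero])
    then have "norm (F t - r t *\<^sub>R B_high a b (U t) (u t) - v t)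
        \<le> CF + Cr * ((1 / \<nu>) * (CN + 1 / k0 * \<Lambda>) * Cu * K) + \<Lambda>"
      using bd(2)[OF t] v(2)[OF t] norm_triangle_ineq4[of "F t - r t *\<^sub>R B_high a b (U t) (u t)" "v t"]
        norm_triangle_ineq4[of "F t" "r t *\<^sub>R B_high a b (U t) (u t)"] by linarith
    then show ?thesis
      unfolding W_def C_def norm_scaleR using nu_pos by (intro mult_mono) auto
  qed
  \<comment> \<open>\<open>W\<close> is bounded but not known to be continuous; interpolation with
    the Lipschitz bound of \<open>u\<close> still makes \<open>U\<close> Hoelder continuous of
    exponent \<open>1 / 2\<close>.\<close>
  have Ulip: "norm (U t - U s) \<le> sqrt (2 * C * \<Lambda> * \<bar>t - s\<bar>)" if s: "s \<in> {0..T}" and t: "t \<in> {0..T}" for s t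
  proof (rule real_le_rsqrt)
    have "(norm (U t - U s))\<^sup>2 \<le> norm (W t - W s) * norm (u t - u s)"
      by (rule norm_interpolation) (simp_all only: coord_diff U[OF s] U[OF t] W[OF s] W[OF t] scaleR_diff_right)
    also have "\<dots> \<le> (2 * C) * (\<Lambda> * \<bar>t - s\<bar>)"
    proof (rule mult_mono)
      show "norm (W t - W s) \<le> 2 * C"
        using norm_triangle_ineq4[of "W t" "W s"] Wb[OF s] Wb[OF t] by linarith
      then show "0 \<le> 2 * C" using norm_ge_zero[of "W t - W s"] by linarith
    qed (use \<Lambda>(2)[OF s t] in auto)
    finally show "(norm (U t - U s))\<^sup>2 \<le> 2 * C * \<Lambda> * \<bar>t - s\<bar>" by (simp add: mult.assoc)
  qed
  have "continuous_on {0..T} U"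
    unfolding continuous_on_def
  proof
    fix s assume s: "s \<in> {0..T}"
    have "((\<lambda>t. sqrt (2 * C * \<Lambda> * \<bar>t - s\<bar>)) \<longlongrightarrow> sqrt (2 * C * \<Lambda> * \<bar>s - s\<bar>)) (at s within {0..T})"
      by (intro tendsto_intros)
    then have lim: "((\<lambda>t. sqrt (2 * C * \<Lambda> * \<bar>t - s\<bar>)) \<longlongrightarrow> 0) (at s within {0..T})" by simp
    have "((\<lambda>t. U t - U s) \<longlongrightarrow> 0) (at s within {0..T})"
      by (rule Lim_null_comparison[OF _ lim]) (use Ulip[OF s] in \<open>auto simp: eventually_at intro!: exI[of _ 1]\<close>)
    then show "(U \<longlongrightarrow> U s) (at s within {0..T})" by (rule LIM_zero_cancel)
  qed
  then show ?thesis
    using U Wb dom_A_I[OF W] by (intro exI[of _ C] exI[of _ U]) auto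
qed

end

section \<open>Absolutely continuous functions\<close>

lemma set_integrable_Icc_subset:
  fixes V :: "real \<Rightarrow> ell2"
  assumes "set_integrable lebesgue {0..T} V" "0 \<le> s" "t \<le> T"
  shows "set_integrable lebesgue {s..t} V"
  using assms(1) by (rule set_integrable_subset) (use assms in auto)

lemma integral_Icc_diff:
  fixes h :: "real \<Rightarrow> real"
  assumes "h integrable_on {0..T}" "0 \<le> s" "s \<le> t" "t \<le> T"
  shows "integral {s..t} h = integral {0..t} h - integral {0..s} h"
proof -
  have "h integrable_on {0..t}" by (rule integrable_on_subinterval[OF assms(1)]) (use assms in auto)
  from Henstock_Kurzweil_Integration.integral_combine[OF assms(2,3) this] show ?thesis by simp
qed

lemma primitive_increment:
  fixes V :: "real \<Rightarrow> ell2"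
  assumes V: "set_integrable lebesgue {0..T} V"
    and u: "\<And>t. t \<in> {0..T} \<Longrightarrow> u t = u0 + (LINT s:{0..t}|lebesgue. V s)"
    and st: "0 \<le> s" "s \<le> t" "t \<le> T"
  shows "norm (u t - u s) \<le> integral {s..t} (\<lambda>r. norm (V r))"
proof -
  let ?I = "\<lambda>A f. (LINT r:A|lebesgue. f r)"
  have split: "?I {s<..t} W = ?I {0..t} W - ?I {0..s} W" if W: "set_integrable lebesgue {0..T} W"
    for W :: "real \<Rightarrow> 'a :: {banach, second_countable_topology}"
  proof -
    have "?I ({0..s} \<union> {s<..t}) W = ?I {0..s} W + ?I {s<..t} W"
      by (intro set_integral_Un set_integrable_subset[OF W]) (use st in auto)
    moreover have "{0..s} \<union> {s<..t} = {0..t}" using st by auto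
    ultimately show ?thesis by simp
  qed
  have nV: "set_integrable lebesgue {0..T} (\<lambda>r. norm (V r))" by (rule set_integrable_norm[OF V])
  have I: "?I {0..r} (\<lambda>r. norm (V r)) = integral {0..r} (\<lambda>r. norm (V r))" if "r \<le> T" for r
    by (intro set_lebesgue_integral_eq_integral set_integrable_subset[OF nV]) (use that in auto)
  have "u t - u s = ?I {s<..t} V" using u[of t] u[of s] st split[OF V] by simp
  also have "norm \<dots> \<le> ?I {s<..t} (\<lambda>r. norm (V r))"
    using st by (intro set_integral_norm_bound set_integrable_subset[OF V]) auto
  also have "\<dots> = integral {0..t} (\<lambda>r. norm (V r)) - integral {0..s} (\<lambda>r. norm (V r))"
    using split[OF nV] I st by simp
  also have "\<dots> = integral {s..t} (\<lambda>r. norm (V r))"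
    using integral_Icc_diff[OF set_lebesgue_integral_eq_integral(1)[OF nV] st] by simp
  finally show ?thesis .
qed

lemma integrable_on_norm:
  fixes V :: "real \<Rightarrow> ell2"
  assumes "set_integrable lebesgue {0..T} V" "0 \<le> s" "t \<le> T"
  shows "(\<lambda>r. norm (V r)) integrable_on {s..t}"
  using set_integrable_norm[OF set_integrable_Icc_subset[OF assms]]
  by (rule set_lebesgue_integral_eq_integral(1))

lemma continuous_on_of_increment_bound:
  fixes u :: "real \<Rightarrow> 'a :: real_normed_vector"
  assumes G: "continuous_on {0..T} G"
    and le: "\<And>s t. 0 \<le> s \<Longrightarrow> s \<le> t \<Longrightarrow> t \<le> T \<Longrightarrow> norm (u t - u s) \<le> G t - G s"
  shows "continuous_on {0..T} u"
  unfolding continuous_on_def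
proof
  fix s assume s: "s \<in> {0..T}"
  have "((\<lambda>t. \<bar>G t - G s\<bar>) \<longlongrightarrow> \<bar>G s - G s\<bar>) (at s within {0..T})"
    using G s by (intro tendsto_intros) (auto simp: continuous_on_def)
  then have lim: "((\<lambda>t. \<bar>G t - G s\<bar>) \<longlongrightarrow> 0) (at s within {0..T})" by simp
  have "norm (u t - u s) \<le> \<bar>G t - G s\<bar>" if "t \<in> {0..T}" for t
    using le[of s t] le[of t s] s that by (cases "s \<le> t") (auto simp: norm_minus_commute)
  then have "((\<lambda>t. u t - u s) \<longlongrightarrow> 0) (at s within {0..T})"
    by (intro Lim_null_comparison[OF _ lim]) (auto simp: eventually_at intro!: exI[of _ 1])
  then show "(u \<longlongrightarrow> u s) (at s within {0..T})" by (rule LIM_zero_cancel)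
qed

lemma primitive_continuous:
  fixes V :: "real \<Rightarrow> ell2"
  assumes V: "set_integrable lebesgue {0..T} V"
    and u: "\<And>t. t \<in> {0..T} \<Longrightarrow> u t = u0 + (LINT s:{0..t}|lebesgue. V s)"
  shows "continuous_on {0..T} u"
proof (rule continuous_on_of_increment_bound)
  have I: "(\<lambda>r. norm (V r)) integrable_on {0..T}" by (rule integrable_on_norm[OF V]) auto
  then show "continuous_on {0..T} (\<lambda>t. integral {0..t} (\<lambda>r. norm (V r)))"
    by (rule indefinite_integral_continuous_1)
  show "norm (u t - u s) \<le> integral {0..t} (\<lambda>r. norm (V r)) - integral {0..s} (\<lambda>r. norm (V r))"
    if "0 \<le> s" "s \<le> t" "t \<le> T" for s t
    using primitive_increment[OF V u that] integral_Icc_diff[OF I that] by simp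
qed

lemma primitive_coord:
  fixes V :: "real \<Rightarrow> ell2"
  assumes V: "set_integrable lebesgue A V"
  shows "set_integrable lebesgue A (\<lambda>s. coord (V s) n)"
    and "coord (LINT s:A|lebesgue. V s) n = (LINT s:A|lebesgue. coord (V s) n)"
  using integrable_bounded_linear[OF bounded_linear_coord[of n] V[unfolded set_integrable_def]]
    integral_bounded_linear[OF bounded_linear_coord[of n] V[unfolded set_integrable_def]]
  by (simp_all add: set_integrable_def set_lebesgue_integral_def)

text \<open>Nonnegativity of the integral of \<open>(h r - I / d)\<^sup>2\<close>, where
  \<open>I / d\<close> is the mean of \<open>h\<close>.\<close>

lemma integral_cauchy_schwarz_const:
  fixes h :: "real \<Rightarrow> real"
  assumes "s \<le> t" and h: "h integrable_on {s..t}" and h2: "(\<lambda>r. (h r)\<^sup>2) integrable_on {s..t}"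
  shows "(integral {s..t} h)\<^sup>2 \<le> (t - s) * integral {s..t} (\<lambda>r. (h r)\<^sup>2)"
proof (cases "s = t")
  case False
  define I where "I = integral {s..t} h"
  define d where "d = t - s"
  have d: "0 < d" using False assms(1) by (simp add: d_def)
  have "((\<lambda>r. (h r)\<^sup>2 - (2 * I / d) * h r + (I / d)\<^sup>2) has_integral
      integral {s..t} (\<lambda>r. (h r)\<^sup>2) - (2 * I / d) * I + d * (I / d)\<^sup>2) {s..t}"
  proof (intro has_integral_add has_integral_diff has_integral_mult_right)
    show "((\<lambda>r. (h r)\<^sup>2) has_integral integral {s..t} (\<lambda>r. (h r)\<^sup>2)) {s..t}" "(h has_integral I) {s..t}"
      using h h2 by (simp_all add: I_def integrable_integral)
    show "((\<lambda>r. (I / d)\<^sup>2) has_integral d * (I / d)\<^sup>2) {s..t}"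
      using has_integral_const_real[of "(I / d)\<^sup>2" s t] assms(1) by (simp add: d_def)
  qed
  then have "0 \<le> integral {s..t} (\<lambda>r. (h r)\<^sup>2) - (2 * I / d) * I + d * (I / d)\<^sup>2"
  proof (rule has_integral_nonneg)
    show "0 \<le> (h r)\<^sup>2 - (2 * I / d) * h r + (I / d)\<^sup>2" for r
    proof -
      have "(h r)\<^sup>2 - (2 * I / d) * h r + (I / d)\<^sup>2 = (h r - I / d)\<^sup>2"
        by (simp add: power2_eq_square algebra_simps)
      then show ?thesis by simp
    qed
  qed
  then have "0 \<le> d * (integral {s..t} (\<lambda>r. (h r)\<^sup>2) - (2 * I / d) * I + d * (I / d)\<^sup>2)"
    using d by simp
  also have "\<dots> = d * integral {s..t} (\<lambda>r. (h r)\<^sup>2) - I\<^sup>2"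
    using d by (simp add: power2_eq_square field_simps)
  finally show ?thesis by (simp add: I_def d_def)
qed (use assms in simp)

text \<open>\<open>G\<close> is the primitive of \<open>(norm (V r))\<^sup>2\<close>. A bare Hoelder
  bound would give increments of order \<open>sqrt h\<close>; the increment of \<open>G\<close>
  retains that its own integral over time is of order \<open>h\<close>.\<close>

lemma W12_modulus:
  assumes f: "in_W1p 2 T f" and T: "0 \<le> T"
  shows "continuous_on {0..T} f" and "\<exists>G. continuous_on {0..T} G \<and>
    (\<forall>s t. 0 \<le> s \<longrightarrow> s \<le> t \<longrightarrow> t \<le> T \<longrightarrow> G s \<le> G t \<and> (norm (f t - f s))\<^sup>2 \<le> (t - s) * (G t - G s))"
proof -
  obtain V where V: "set_integrable lebesgue {0..T} V"
    and fV: "\<And>t. t \<in> {0..T} \<Longrightarrow> f t = f 0 + (LINT s:{0..t}|lebesgue. V s)" and L2: "in_Lp 2 T V"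
    using f unfolding in_W1p_def ac_deriv_def by blast
  show "continuous_on {0..T} f" by (rule primitive_continuous[OF V fV])
  have meas: "V \<in> borel_measurable (lebesgue_on {0..T})"
    and fin: "(\<integral>\<^sup>+ t. ennreal (norm (V t) powr 2) \<partial>lebesgue_on {0..T}) < \<infinity>"
    using L2 by (auto simp: in_Lp_def)
  have "norm (V t) powr 2 = (norm (V t))\<^sup>2" for t
    by (cases "V t = 0") (auto simp: powr_numeral)
  then have "integrable (lebesgue_on {0..T}) (\<lambda>t. (norm (V t))\<^sup>2)"
    using fin meas by (intro integrableI_bounded) auto
  then have "set_integrable lebesgue {0..T} (\<lambda>t. (norm (V t))\<^sup>2)"
    by (simp add: integrable_restrict_space set_integrable_def)
  then have I2: "(\<lambda>t. (norm (V t))\<^sup>2) integrable_on {0..T}"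
    by (rule set_lebesgue_integral_eq_integral(1))
  define G where "G t = integral {0..t} (\<lambda>r. (norm (V r))\<^sup>2)" for t
  have "continuous_on {0..T} G"
    unfolding G_def by (rule indefinite_integral_continuous_1[OF I2])
  moreover have "G s \<le> G t \<and> (norm (f t - f s))\<^sup>2 \<le> (t - s) * (G t - G s)" if st: "0 \<le> s" "s \<le> t" "t \<le> T" for s t
  proof
    have I2': "(\<lambda>t. (norm (V t))\<^sup>2) integrable_on {s..t}"
      by (rule integrable_on_subinterval[OF I2]) (use st in auto)
    have eq: "integral {s..t} (\<lambda>r. (norm (V r))\<^sup>2) = G t - G s"
      unfolding G_def by (rule integral_Icc_diff[OF I2 st])
    have "0 \<le> integral {s..t} (\<lambda>r. (norm (V r))\<^sup>2)" by (rule integral_nonneg[OF I2']) simp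
    then show "G s \<le> G t" using eq by simp
    have "(norm (f t - f s))\<^sup>2 \<le> (integral {s..t} (\<lambda>r. norm (V r)))\<^sup>2"
      by (intro power_mono primitive_increment[OF V fV st]) auto
    also have "\<dots> \<le> (t - s) * (G t - G s)"
      unfolding eq[symmetric]
      by (rule integral_cauchy_schwarz_const[OF st(2) integrable_on_norm[OF V st(1,3)] I2'])
    finally show "(norm (f t - f s))\<^sup>2 \<le> (t - s) * (G t - G s)" .
  qed
  ultimately show "\<exists>G. continuous_on {0..T} G \<and>
    (\<forall>s t. 0 \<le> s \<longrightarrow> s \<le> t \<longrightarrow> t \<le> T \<longrightarrow> G s \<le> G t \<and> (norm (f t - f s))\<^sup>2 \<le> (t - s) * (G t - G s))"
    by blast
qed

section \<open>Differentiation of primitives\<close>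

lemma lebesgue_differentiation_right:
  fixes h :: "real \<Rightarrow> real"
  assumes "\<And>a b. h integrable_on {a..b}"
  obtains N where "negligible N" "\<And>x e. x \<notin> N \<Longrightarrow> 0 < e \<Longrightarrow>
    \<exists>d>0. \<forall>\<delta>. 0 < \<delta> \<and> \<delta> < d \<longrightarrow> \<bar>integral {x..x + \<delta>} h / \<delta> - h x\<bar> < e"
proof -
  have "h integrable_on cbox a b" for a b using assms by simp
  from integrable_ccontinuous_explicit[of h, OF this] obtain N where
    "negligible N" "\<And>x e. x \<notin> N \<Longrightarrow> 0 < e \<Longrightarrow>
      \<exists>d>0. \<forall>\<delta>. 0 < \<delta> \<and> \<delta> < d \<longrightarrow>
        norm (integral (cbox x (x + \<delta> *\<^sub>R One)) h /\<^sub>R \<delta> ^ DIM(real) - h x) < e" by metis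
  then show ?thesis
    by (intro that[of N]) (simp_all add: divide_inverse mult.commute)
qed

text \<open>The averages in \<open>lebesgue_differentiation_right\<close> extend to one side of the
  point only; reflecting the line supplies the other side.\<close>

lemma lebesgue_differentiation_left:
  fixes h :: "real \<Rightarrow> real"
  assumes "\<And>a b. h integrable_on {a..b}"
  obtains N where "negligible N" "\<And>x e. x \<notin> N \<Longrightarrow> 0 < e \<Longrightarrow>
    \<exists>d>0. \<forall>\<delta>. 0 < \<delta> \<and> \<delta> < d \<longrightarrow> \<bar>integral {x - \<delta>..x} h / \<delta> - h x\<bar> < e"
proof -
  have "(\<lambda>x. h (- x)) integrable_on {a..b}" for a b
    using assms[of "- b" "- a"] has_integral_reflect_real[of h _ "-a" "-b"] by (auto simp: integrable_on_def)
  then obtain N where N: "negligible N" "\<And>x e. x \<notin> N \<Longrightarrow> 0 < e \<Longrightarrow>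
    \<exists>d>0. \<forall>\<delta>. 0 < \<delta> \<and> \<delta> < d \<longrightarrow> \<bar>integral {x..x + \<delta>} (\<lambda>x. h (- x)) / \<delta> - h (- x)\<bar> < e"
    by (rule lebesgue_differentiation_right) blast
  show ?thesis
  proof (rule that[of "uminus ` N"])
    show "negligible (uminus ` N)"
      by (rule negligible_differentiable_image_negligible) (use N in \<open>auto intro!: derivative_intros\<close>)
    fix x e :: real assume x: "x \<notin> uminus ` N" and e: "0 < e"
    have "- x \<notin> N" using x by (metis image_eqI minus_minus)
    then obtain d where d: "d > 0" "\<And>\<delta>. 0 < \<delta> \<Longrightarrow> \<delta> < d \<Longrightarrow>
        \<bar>integral {- x..- x + \<delta>} (\<lambda>x. h (- x)) / \<delta> - h x\<bar> < e"
      using N(2)[OF _ e, of "- x"] by auto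
    have "\<bar>integral {x - \<delta>..x} h / \<delta> - h x\<bar> < e" if "0 < \<delta>" "\<delta> < d" for \<delta>
      using d(2)[OF that] Henstock_Kurzweil_Integration.integral_reflect_real[of x "x - \<delta>" h] by simp
    then show "\<exists>d>0. \<forall>\<delta>. 0 < \<delta> \<and> \<delta> < d \<longrightarrow> \<bar>integral {x - \<delta>..x} h / \<delta> - h x\<bar> < e"
      using d(1) by blast
  qed
qed

text \<open>Lebesgue points of \<open>V\<close> are the common Lebesgue points of the scalar functions \<open>\<bar>V - d\<bar>\<close>, with
  \<open>d\<close> in a countable dense set.\<close>

lemma primitive_differentiable_ae:
  fixes V :: "real \<Rightarrow> ell2"
  assumes V: "set_integrable lebesgue {0..T} V"
    and u: "\<And>t. t \<in> {0..T} \<Longrightarrow> u t = u0 + (LINT s:{0..t}|lebesgue. V s)"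
  shows "AE t in lebesgue_on {0..T}. (u has_vector_derivative V t) (at t within {0..T})"
proof -
  obtain D :: "ell2 set" where D: "countable D" "\<And>x e. e > 0 \<Longrightarrow> \<exists>d\<in>D. dist d x < e"
    using ell2_countable_dense by blast
  have const: "set_integrable lebesgue {0..t} (\<lambda>_. w)" for t :: real and w :: ell2
  proof -
    have "{0..t} \<in> lmeasurable" by simp
    then show ?thesis
      unfolding set_integrable_def
      by (intro integrable_scaleR_left integrable_real_indicator) (auto simp: fmeasurable_def)
  qed
  \<comment> \<open>Extended by 0, so that it is integrable over every interval, also one reaching
    beyond \<open>[0, T]\<close>.\<close>
  define h where "h d t = (if t \<in> {0..T} then norm (V t - d) else 0)" for d t
  have hI: "h d integrable_on {a..b}" for d a b
  proof -
    have "(\<lambda>t. norm (V t - d)) integrable_on {0..T}"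
      by (rule integrable_on_norm[OF set_integral_diff(1)[OF V const]]) auto
    then have "h d integrable_on UNIV" unfolding h_def integrable_restrict_UNIV .
    then show ?thesis by (rule integrable_on_subinterval) simp
  qed
  have "\<exists>N. negligible N \<and> (\<forall>x e. x \<notin> N \<longrightarrow> 0 < e \<longrightarrow>
      (\<exists>d>0. \<forall>\<delta>. 0 < \<delta> \<and> \<delta> < d \<longrightarrow> \<bar>integral {x..x + \<delta>} (h c) / \<delta> - h c x\<bar> < e
        \<and> \<bar>integral {x - \<delta>..x} (h c) / \<delta> - h c x\<bar> < e))" for c
  proof -
    obtain N1 where N1: "negligible N1" "\<And>x e. x \<notin> N1 \<Longrightarrow> 0 < e \<Longrightarrow>
      \<exists>d>0. \<forall>\<delta>. 0 < \<delta> \<and> \<delta> < d \<longrightarrow> \<bar>integral {x..x + \<delta>} (h c) / \<delta> - h c x\<bar> < e"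
      by (rule lebesgue_differentiation_right[OF hI]) blast
    obtain N2 where N2: "negligible N2" "\<And>x e. x \<notin> N2 \<Longrightarrow> 0 < e \<Longrightarrow>
      \<exists>d>0. \<forall>\<delta>. 0 < \<delta> \<and> \<delta> < d \<longrightarrow> \<bar>integral {x - \<delta>..x} (h c) / \<delta> - h c x\<bar> < e"
      by (rule lebesgue_differentiation_left[OF hI]) blast
    have "\<exists>d>0. \<forall>\<delta>. 0 < \<delta> \<and> \<delta> < d \<longrightarrow> \<bar>integral {x..x + \<delta>} (h c) / \<delta> - h c x\<bar> < e
        \<and> \<bar>integral {x - \<delta>..x} (h c) / \<delta> - h c x\<bar> < e" if x: "x \<notin> N1 \<union> N2" and e: "0 < e" for x e
    proof -
      obtain d1 where d1: "d1 > 0" "\<forall>\<delta>. 0 < \<delta> \<and> \<delta> < d1 \<longrightarrow> \<bar>integral {x..x + \<delta>} (h c) / \<delta> - h c x\<bar> < e"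
        using N1(2)[OF _ e, of x] x by blast
      obtain d2 where d2: "d2 > 0" "\<forall>\<delta>. 0 < \<delta> \<and> \<delta> < d2 \<longrightarrow> \<bar>integral {x - \<delta>..x} (h c) / \<delta> - h c x\<bar> < e"
        using N2(2)[OF _ e, of x] x by blast
      show ?thesis using d1 d2 by (intro exI[of _ "min d1 d2"]) auto
    qed
    then show ?thesis using negligible_Un[OF N1(1) N2(1)] by blast
  qed
  then obtain N where N: "\<And>c. negligible (N c)" "\<And>c x e. x \<notin> N c \<Longrightarrow> 0 < e \<Longrightarrow>
      \<exists>d>0. \<forall>\<delta>. 0 < \<delta> \<and> \<delta> < d \<longrightarrow> \<bar>integral {x..x + \<delta>} (h c) / \<delta> - h c x\<bar> < e
        \<and> \<bar>integral {x - \<delta>..x} (h c) / \<delta> - h c x\<bar> < e" by metis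
  have inc: "norm (u t - u s - (t - s) *\<^sub>R w) \<le> integral {s..t} (\<lambda>r. norm (V r - w))"
    if st: "0 \<le> s" "s \<le> t" "t \<le> T" for s t w
  proof -
    have "norm ((u t - t *\<^sub>R w) - (u s - s *\<^sub>R w)) \<le> integral {s..t} (\<lambda>r. norm (V r - w))"
    proof (rule primitive_increment[OF set_integral_diff(1)[OF V const] _ st])
      show "u t - t *\<^sub>R w = u0 + (LINT s:{0..t}|lebesgue. V s - w)" if t: "t \<in> {0..T}" for t
      proof -
        have "(LINT s:{0..t}|lebesgue. w) = t *\<^sub>R w"
          using t by (simp add: set_lebesgue_integral_def)
        then show ?thesis
          using set_integral_diff(2)[OF set_integrable_Icc_subset[OF V, of 0 t] const[of t w]] u[OF t] t by simp
      qed
    qed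
    then show ?thesis by (simp add: algebra_simps)
  qed
  have deriv: "(u has_vector_derivative V x) (at x within {0..T})"
    if xN: "x \<notin> (\<Union>c\<in>D. N c)" and x: "x \<in> {0..T}" for x
    unfolding has_vector_derivative_def has_derivative_within_alt
  proof (intro conjI allI impI bounded_linear_scaleR_left)
    fix e :: real assume e: "0 < e"
    \<comment> \<open>The average of \<open>norm (V r - V x)\<close> is at most that of
      \<open>norm (V r - c)\<close> plus \<open>e / 4\<close>, and the latter average stays below
      \<open>h c x + e / 4 < e / 2\<close>: in total \<open>3 / 4 * e\<close>.\<close>
    obtain c where c: "c \<in> D" "norm (V x - c) < e / 4"
      using D(2)[of "e / 4" "V x"] e by (auto simp: dist_norm norm_minus_commute)
    have "x \<notin> N c" using xN c by blast
    from N(2)[OF this, of "e / 4"] e obtain d where d: "0 < d"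
      and d1: "\<And>\<delta>. 0 < \<delta> \<Longrightarrow> \<delta> < d \<Longrightarrow> \<bar>integral {x..x + \<delta>} (h c) / \<delta> - h c x\<bar> < e / 4"
      and d2: "\<And>\<delta>. 0 < \<delta> \<Longrightarrow> \<delta> < d \<Longrightarrow> \<bar>integral {x - \<delta>..x} (h c) / \<delta> - h c x\<bar> < e / 4" by auto
    have hx: "h c x < e / 4" using c x by (simp add: h_def)
    have est: "norm (u t - u s - (t - s) *\<^sub>R V x) \<le> e * (t - s)"
      if st: "0 \<le> s" "s < t" "t \<le> T" and lt: "\<bar>integral {s..t} (h c) / (t - s) - h c x\<bar> < e / 4" for s t
    proof -
      have int: "(\<lambda>r. norm (V r - w)) integrable_on {s..t}" for w
        by (rule integrable_on_norm[OF set_integral_diff(1)[OF V const]]) (use st in auto)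
      have "norm (u t - u s - (t - s) *\<^sub>R V x) \<le> integral {s..t} (\<lambda>r. norm (V r - V x))"
        by (rule inc) (use st in auto)
      also have "\<dots> \<le> integral {s..t} (\<lambda>r. h c r + e / 4)"
      proof (rule integral_le)
        show "(\<lambda>r. h c r + e / 4) integrable_on {s..t}" by (intro integrable_add hI) auto
        fix r assume "r \<in> {s..t}"
        then have "h c r = norm (V r - c)" using st by (simp add: h_def)
        then show "norm (V r - V x) \<le> h c r + e / 4"
          using norm_triangle_ineq[of "V r - c" "c - V x"] c(2) by (simp add: norm_minus_commute)
      qed (rule int)
      also have "\<dots> = integral {s..t} (h c) + (t - s) * (e / 4)"
        using st by (subst integral_add) (auto intro: hI)
      also have "integral {s..t} (h c) \<le> (t - s) * (e / 2)"
      proof -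
        have "integral {s..t} (h c) / (t - s) < e / 2" using lt hx by linarith
        then show ?thesis using st by (simp add: divide_less_eq mult.commute)
      qed
      finally have "norm (u t - u s - (t - s) *\<^sub>R V x) \<le> (t - s) * (3 / 4 * e)" by (simp add: algebra_simps)
      also have "\<dots> \<le> (t - s) * e" using st e by (intro mult_left_mono) auto
      finally show ?thesis by (simp add: mult.commute)
    qed
    have "norm (u y - u x - (y - x) *\<^sub>R V x) \<le> e * norm (y - x)" if y: "y \<in> {0..T}" "norm (y - x) < d" for y
    proof (cases y x rule: linorder_cases)
      case less
      have "norm (u x - u y - (x - y) *\<^sub>R V x) \<le> e * (x - y)"
        by (rule est) (use d2[of "x - y"] less x y in auto)
      moreover have "u y - u x - (y - x) *\<^sub>R V x = - (u x - u y - (x - y) *\<^sub>R V x)" by (simp add: algebra_simps)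
      ultimately show ?thesis using less by (simp only: norm_minus_cancel) simp
    next
      case greater
      then show ?thesis using est[of x y] d1[of "y - x"] x y by simp
    qed simp
    then show "\<exists>d>0. \<forall>y\<in>{0..T}. norm (y - x) < d \<longrightarrow> norm (u y - u x - (y - x) *\<^sub>R V x) \<le> e * norm (y - x)"
      using d by blast
  qed
  have "negligible (\<Union>c\<in>D. N c)"
    by (rule negligible_countable_Union) (use D N in auto)
  then have null: "(\<Union>c\<in>D. N c) \<in> null_sets lebesgue" by (simp add: negligible_iff_null_sets)
  have "AE t in lebesgue. t \<in> {0..T} \<longrightarrow> (u has_vector_derivative V t) (at t within {0..T})"
    by (rule AE_I'[OF null]) (use deriv in blast)
  then show ?thesis by (simp add: AE_restrict_space_iff)
qed

section \<open>The feedback law\<close>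

lemma continuous_on_lipschitz_comp:
  fixes g :: "'a :: real_normed_vector \<Rightarrow> 'b :: real_normed_vector"
  assumes "\<And>x y. norm (g x - g y) \<le> L * norm (x - y)" "continuous_on S u"
  shows "continuous_on S (\<lambda>t. g (u t))"
proof -
  have "norm (g x - g y) \<le> \<bar>L\<bar> * norm (x - y)" for x y
    using order_trans[OF assms(1) mult_right_mono[OF abs_ge_self]] by simp
  then have "\<bar>L\<bar>-lipschitz_on UNIV g" by (intro lipschitz_onI) (auto simp: dist_norm)
  then show ?thesis using assms(2) by (auto intro: continuous_on_compose2 lipschitz_on_continuous_on)
qed

context
  fixes K :: "ell2 set" and \<omega> :: "nat set" and lam :: real
  assumes K: "closed K" "convex K" "0 \<in> K"
    and comm: "\<And>u. proj_on K (mult_ind \<omega> u) = mult_ind \<omega> (proj_on K u)"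
    and lam: "0 < lam"
begin

lemma K_ne: "K \<noteq> {}" using K by auto

text \<open>By the commutation hypothesis the feedback is a Yosida-type penalty, a multiple of
  \<open>x - proj_on K x\<close> at \<open>x = mult_ind \<omega> u\<close>. Nonexpansiveness of the
  projection then makes it Lipschitz.\<close>

lemma feedback_eq: "feedback K \<omega> lam u = - (1 / lam) *\<^sub>R (mult_ind \<omega> u - proj_on K (mult_ind \<omega> u))"
  by (simp add: feedback_def comm)

lemma residual_lipschitz:
  "norm ((mult_ind \<omega> u - proj_on K (mult_ind \<omega> u)) - (mult_ind \<omega> v - proj_on K (mult_ind \<omega> v)))
    \<le> 2 * norm (u - v)"
proof -
  have 1: "norm (mult_ind \<omega> u - mult_ind \<omega> v) \<le> norm (u - v)"
    using norm_mult_ind_le[of \<omega> "u - v"] by (simp add: mult_ind_diff)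
  have "(mult_ind \<omega> u - proj_on K (mult_ind \<omega> u)) - (mult_ind \<omega> v - proj_on K (mult_ind \<omega> v))
      = (mult_ind \<omega> u - mult_ind \<omega> v) - (proj_on K (mult_ind \<omega> u) - proj_on K (mult_ind \<omega> v))" by simp
  also have "norm \<dots> \<le> norm (mult_ind \<omega> u - mult_ind \<omega> v) + norm (proj_on K (mult_ind \<omega> u) - proj_on K (mult_ind \<omega> v))"
    by (rule norm_triangle_ineq4)
  also have "\<dots> \<le> 2 * norm (u - v)"
    using 1 proj_on_nonexpansive[OF K(1,2) K_ne, of "mult_ind \<omega> u" "mult_ind \<omega> v"] by linarith
  finally show ?thesis .
qed

lemma feedback_lipschitz: "norm (feedback K \<omega> lam u - feedback K \<omega> lam v) \<le> 2 / lam * norm (u - v)"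
proof -
  have "feedback K \<omega> lam u - feedback K \<omega> lam v = - (1 / lam) *\<^sub>R
    ((mult_ind \<omega> u - proj_on K (mult_ind \<omega> u)) - (mult_ind \<omega> v - proj_on K (mult_ind \<omega> v)))"
    unfolding feedback_eq by (simp only: scaleR_diff_right)
  then have "norm (feedback K \<omega> lam u - feedback K \<omega> lam v) = (1 / lam) *
    norm ((mult_ind \<omega> u - proj_on K (mult_ind \<omega> u)) - (mult_ind \<omega> v - proj_on K (mult_ind \<omega> v)))"
    using lam by (simp only: norm_scaleR) simp
  also have "\<dots> \<le> (1 / lam) * (2 * norm (u - v))"
    using lam by (intro mult_left_mono residual_lipschitz) simp
  finally show ?thesis by simp
qed

lemma continuous_on_dist_to:
  "continuous_on S u \<Longrightarrow> continuous_on S (\<lambda>t. dist_to K (mult_ind \<omega> (u t)))"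
  unfolding dist_to_def by (intro continuous_on_norm continuous_on_lipschitz_comp[OF residual_lipschitz])

text \<open>Testing the variational inequality with \<open>0 \<in> K\<close> gives
  \<open>(norm (?x - ?p))\<^sup>2 \<le> inner (?x - ?p) ?x\<close>. By the commutation
  \<open>?x - ?p\<close> is supported in \<omega>, so the second argument may be replaced by
  \<open>u\<close>.\<close>

lemma feedback_dissipative:
  "inner (feedback K \<omega> lam u) u \<le> - (1 / lam * (dist_to K (mult_ind \<omega> u))\<^sup>2)"
proof -
  let ?x = "mult_ind \<omega> u"
  let ?p = "proj_on K ?x"
  have xp: "?x - ?p = mult_ind \<omega> (u - proj_on K u)" by (simp add: comm mult_ind_diff)
  have "inner (?x - ?p) (0 - ?p) \<le> 0" by (rule proj_on_variational[OF K(1,2) K_ne K(3)])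
  then have "(norm (?x - ?p))\<^sup>2 \<le> inner (?x - ?p) ?x"
    unfolding power2_norm_eq_inner inner_diff_right[of "?x - ?p" ?x] by simp
  also have "inner (?x - ?p) ?x = inner (?x - ?p) u" unfolding xp by (rule inner_mult_ind_left)
  finally have "1 / lam * (norm (?x - ?p))\<^sup>2 \<le> 1 / lam * inner (?x - ?p) u"
    using lam by (intro mult_left_mono) auto
  then show ?thesis unfolding feedback_eq dist_to_def inner_scaleR_left by linarith
qed

end

section \<open>The truncated and the original equation\<close>

context sabra
begin

text \<open>Truncating both arguments of \<open>B_low\<close> multiplies it by the scalar
  \<open>r\<close>, so the truncated nonlinearity will still be orthogonal to \<open>u\<close>. The
  bound \<open>C\<close> may depend on \<open>R\<close> and on \<open>Lg\<close>.\<close>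

lemma truncated_solution:
  fixes f :: "real \<Rightarrow> ell2" and g :: "ell2 \<Rightarrow> ell2"
  assumes T: "0 < T" and R: "0 < R" and f: "in_W1p 2 T f" and u0: "u0 \<in> dom_A k0 q"
    and g: "\<And>x y. norm (g x - g y) \<le> Lg * norm (x - y)"
  defines "r \<equiv> \<lambda>x :: ell2. (R / max R (norm x))\<^sup>2"
  shows "\<exists>u U C. continuous_on {0..T} u \<and> u 0 = u0 \<and> continuous_on {0..T} U \<and>
    evolves T u (\<lambda>t. inv_sqrt_A (f t + g (u t)) - r (u t) *\<^sub>R B_low a b (u t) (u t)) (\<lambda>_. 0) \<and>
    (\<forall>t\<in>{0..T}. u t \<in> dom_A k0 q \<and> norm (shell_A k0 q (u t)) \<le> C \<and>
      (\<forall>n. coord (U t) n = k n *\<^sub>R coord (u t) n))"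
proof -
  define F where "F x = B_low a b (retract R x) (retract R x)" for x
  have F_eq: "F x = r x *\<^sub>R B_low a b x x" for x
    unfolding F_def retract_def B_low_def shell_form_scaleR r_def by (simp add: power2_eq_square)
  obtain LB where LB: "LB \<ge> 0" "\<And>x y. norm (F x - F y) \<le> LB * norm (x - y)"
    using bilinear_retract_lipschitz[OF bounded_bilinear_shell_form R] unfolding F_def B_low_def by blast
  define N where "N t x = inv_sqrt_A (f t + g x) - F x" for t x
  have fc: "continuous_on {0..T} f" using W12_modulus(1)[OF f] T by simp
  have cont: "continuous_on {0..T} (\<lambda>t. N t (u t))" if "continuous_on {0..T} u" for u
    unfolding N_def
    by (intro continuous_intros bounded_linear.continuous_on[OF bounded_linear_inv_sqrt_A] fc
        continuous_on_lipschitz_comp[OF g] continuous_on_lipschitz_comp[OF LB(2)] that)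
  have isd: "inv_sqrt_A x - inv_sqrt_A y = inv_sqrt_A (x - y)" for x y
    using bounded_linear.linear[OF bounded_linear_inv_sqrt_A] by (simp add: linear_diff)
  have L: "norm (N t x - N t y) \<le> (1 / k0 * Lg + LB) * norm (x - y)" for t x y
  proof -
    have "N t x - N t y = inv_sqrt_A (g x - g y) - (F x - F y)"
      using isd[of "f t + g x" "f t + g y"] by (simp add: N_def algebra_simps)
    also have "norm \<dots> \<le> norm (inv_sqrt_A (g x - g y)) + norm (F x - F y)" by (rule norm_triangle_ineq4)
    also have "norm (inv_sqrt_A (g x - g y)) \<le> 1 / k0 * (Lg * norm (x - y))"
      using k0_pos by (intro order_trans[OF norm_inv_sqrt_A] mult_left_mono g) auto
    finally show ?thesis using LB(2)[of x y] by (simp add: algebra_simps)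
  qed
  obtain G where G: "continuous_on {0..T} G" "\<And>s t. 0 \<le> s \<Longrightarrow> s \<le> t \<Longrightarrow> t \<le> T \<Longrightarrow> G s \<le> G t"
    "\<And>s t. 0 \<le> s \<Longrightarrow> s \<le> t \<Longrightarrow> t \<le> T \<Longrightarrow> (norm (f t - f s))\<^sup>2 \<le> (t - s) * (G t - G s)"
    using W12_modulus(2)[OF f] T by auto
  \<comment> \<open>\<open>f\<close> enters \<open>N\<close> through \<open>inv_sqrt_A\<close>,
    whose norm is at most \<open>1 / k0\<close>; hence the modulus
    \<open>G / k0\<^sup>2\<close>.\<close>
  have NG: "(norm (N t x - N s x))\<^sup>2 \<le> (t - s) * (G t / k0\<^sup>2 - G s / k0\<^sup>2)" if "0 \<le> s" "s \<le> t" "t \<le> T" for s t x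
  proof -
    have "N t x - N s x = inv_sqrt_A (f t - f s)"
      using isd[of "f t + g x" "f s + g x"] by (simp add: N_def)
    then have "(norm (N t x - N s x))\<^sup>2 \<le> (1 / k0 * norm (f t - f s))\<^sup>2"
      using norm_inv_sqrt_A by (simp add: power_mono)
    also have "\<dots> = (norm (f t - f s))\<^sup>2 / k0\<^sup>2" by (simp add: power_mult_distrib power_divide)
    also have "\<dots> \<le> (t - s) * (G t - G s) / k0\<^sup>2" by (intro divide_right_mono G that) simp
    finally show ?thesis by (simp add: diff_divide_distrib right_diff_distrib)
  qed
  obtain u where u: "continuous_on {0..T} u" "u 0 = u0" "evolves T u (\<lambda>t. N t (u t)) (\<lambda>_. 0)"
    using lipschitz_solution_exists[OF _ cont L, of u0] T by auto
  obtain U0 where U0: "\<And>n. coord U0 n = k n *\<^sub>R coord u0 n" by (rule sqrt_A_exists[OF u0]) blast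
  \<comment> \<open>The velocity at the initial state with the forcing taken at time
    \<open>t\<close>. It is an element of \<open>H\<close> because \<open>u0\<close> lies in
    \<open>D(A)\<close>, which is why \<open>B_high\<close> can be used.\<close>
  define \<Gamma> where "\<Gamma> t = f t + g u0 - r u0 *\<^sub>R B_high a b U0 u0 - \<nu> *\<^sub>R shell_A k0 q u0" for t
  have \<Gamma>: "continuous_on {0..T} \<Gamma>" unfolding \<Gamma>_def by (intro continuous_intros fc)
  have compat: "coord (\<Gamma> t) n = k n *\<^sub>R coord (N t (u 0)) n - (\<nu> * (k n)\<^sup>2) *\<^sub>R coord (u 0) n" for t n
  proof -
    have "k n *\<^sub>R coord (N t u0) n = coord (f t + g u0) n - r u0 *\<^sub>R (k n *\<^sub>R coord (B_low a b u0 u0) n)"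
      unfolding N_def F_eq coord_diff scaleR_diff_right coord_inv_sqrt_A coord_scaleR
      by (simp add: mult.commute)
    then show ?thesis
      by (simp add: \<Gamma>_def u(2) coord_B_low coord_B_high[OF U0] coord_shell_A_scaleR[OF u0])
  qed
  obtain \<Lambda> where \<Lambda>: "0 \<le> \<Lambda>" "\<And>s t. s \<in> {0..T} \<Longrightarrow> t \<in> {0..T} \<Longrightarrow> norm (u t - u s) \<le> \<Lambda> * \<bar>t - s\<bar>"
  proof -
    have "continuous_on {0..T} (\<lambda>t. G t / k0\<^sup>2)"
      by (intro continuous_intros G) (use k0_pos in auto)
    moreover have "G s / k0\<^sup>2 \<le> G t / k0\<^sup>2" if "0 \<le> s" "s \<le> t" "t \<le> T" for s t
      by (intro divide_right_mono G that) simp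
    ultimately show ?thesis
      using lipschitz_in_time[OF u(3,1) cont L \<Gamma> compat _ _ NG] that by blast
  qed
  have ev: "evolves T u (\<lambda>t. inv_sqrt_A (f t + g (u t)) - r (u t) *\<^sub>R B_low a b (u t) (u t)) (\<lambda>_. 0)"
    using u(3) by (simp add: N_def F_eq)
  have rc: "continuous_on {0..T} (\<lambda>t. r (u t))"
    unfolding r_def using R by (intro continuous_intros u) (auto simp: max_def)
  have Fc: "continuous_on {0..T} (\<lambda>t. f t + g (u t))"
    by (intro continuous_intros fc continuous_on_lipschitz_comp[OF g] u)
  from spatial_regularity[OF T ev u(1) Fc rc \<Lambda>] show ?thesis using u ev by blast
qed

text \<open>Made of the data alone: neither \<lambda> nor a truncation radius occurs. The factor
  \<open>exp T\<close> is Gronwall's, for the constant 1 produced by \<open>2 * inner (f t) (u t)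
  \<le> (norm (f t))\<^sup>2 + (norm (u t))\<^sup>2\<close>.\<close>

definition energy_bound :: "real \<Rightarrow> (real \<Rightarrow> ell2) \<Rightarrow> ell2 \<Rightarrow> real" where
  "energy_bound T f u0 = ((norm u0)\<^sup>2 + integral {0..T} (\<lambda>t. (norm (f t))\<^sup>2)) * exp T"

text \<open>The nonlinearity is moved from \<beta> to \<gamma>, where its pairing with
  \<open>u\<close> is exactly 0; left in \<beta> it would cost a term of fourth order in
  \<open>u\<close>. The move needs \<open>A\<^sup>1\<^sup>/\<^sup>2 u\<close> in \<open>H\<close>,
  supplied as \<open>U\<close>. The function \<delta> stands for the penalty density.\<close>

lemma a_priori_estimate:
  fixes f :: "real \<Rightarrow> ell2" and g :: "ell2 \<Rightarrow> ell2"
  assumes T: "0 < T"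
    and u: "evolves T u (\<lambda>t. inv_sqrt_A (f t + g (u t)) - r t *\<^sub>R B_low a b (u t) (u t)) (\<lambda>_. 0)"
      "continuous_on {0..T} u"
    and U: "continuous_on {0..T} U" "\<And>t n. t \<in> {0..T} \<Longrightarrow> coord (U t) n = k n *\<^sub>R coord (u t) n"
    and f: "continuous_on {0..T} f" and g: "continuous_on {0..T} (\<lambda>t. g (u t))"
    and r: "continuous_on {0..T} r" and \<delta>: "continuous_on {0..T} \<delta>"
    and diss: "\<And>t. t \<in> {0..T} \<Longrightarrow> inner (g (u t)) (u t) \<le> - \<delta> t" "\<And>t. t \<in> {0..T} \<Longrightarrow> 0 \<le> \<delta> t"
  shows "\<And>t. t \<in> {0..T} \<Longrightarrow> (norm (u t))\<^sup>2 \<le> energy_bound T f (u 0)"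
    and "integral {0..T} \<delta> \<le> (T + 1) * energy_bound T f (u 0)"
proof -
  define \<gamma> where "\<gamma> t = f t + g (u t) - r t *\<^sub>R B_high a b (U t) (u t)" for t
  have \<gamma>: "continuous_on {0..T} \<gamma>"
    unfolding \<gamma>_def B_high_def
    by (intro continuous_intros f g r u bounded_bilinear.continuous_on[OF bounded_bilinear_shell_form] U)
  have ev: "evolves T u (\<lambda>_. 0) \<gamma>"
  proof (rule evolves_cong[OF u(1) refl])
    fix t n assume t: "t \<in> {0..T}"
    have "k n *\<^sub>R coord (inv_sqrt_A (f t + g (u t)) - r t *\<^sub>R B_low a b (u t) (u t)) n
        = coord (f t + g (u t)) n - r t *\<^sub>R (k n *\<^sub>R coord (B_low a b (u t) (u t)) n)"
      unfolding coord_diff scaleR_diff_right coord_inv_sqrt_A coord_scaleR by (simp add: mult.commute)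
    then show "k n *\<^sub>R coord (inv_sqrt_A (f t + g (u t)) - r t *\<^sub>R B_low a b (u t) (u t)) n + coord 0 n
        = k n *\<^sub>R coord 0 n + coord (\<gamma> t) n"
      by (simp add: \<gamma>_def coord_B_low coord_B_high[OF U(2)[OF t]])
  qed
  define C0 where "C0 = (norm (u 0))\<^sup>2 + integral {0..T} (\<lambda>t. (norm (f t))\<^sup>2)"
  have sub: "continuous_on {0..t} h" if "continuous_on {0..T} h" "t \<in> {0..T}" for t and h :: "real \<Rightarrow> 'b :: topological_space"
    using that(1) by (rule continuous_on_subset) (use that in auto)
  have main: "(norm (u t))\<^sup>2 + 2 * integral {0..t} \<delta> \<le> C0 + integral {0..t} (\<lambda>s. (norm (u s))\<^sup>2)" if t: "t \<in> {0..T}" for t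
  proof -
    note c = sub[OF _ t]
    have I: "\<delta> integrable_on {0..t}" "(\<lambda>s. (norm (u s))\<^sup>2) integrable_on {0..t}"
      "(\<lambda>s. (norm (f s))\<^sup>2) integrable_on {0..t}"
      by (intro integrable_continuous_real continuous_intros c \<delta> u f)+
    have "(norm (u t))\<^sup>2 \<le> (norm (u 0))\<^sup>2 + integral {0..t} (\<lambda>s. (norm (0 :: ell2))\<^sup>2 / (2 * \<nu>) + 2 * inner (\<gamma> s) (u s))"
      by (rule energy_estimate[OF evolves_subset[OF ev]]) (use t in \<open>auto intro!: c u \<gamma>\<close>)
    also have "integral {0..t} (\<lambda>s. (norm (0 :: ell2))\<^sup>2 / (2 * \<nu>) + 2 * inner (\<gamma> s) (u s))
        \<le> integral {0..t} (\<lambda>s. (norm (f s))\<^sup>2 + (norm (u s))\<^sup>2 - 2 * \<delta> s)"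
    proof (rule integral_le)
      show "(\<lambda>s. (norm (0 :: ell2))\<^sup>2 / (2 * \<nu>) + 2 * inner (\<gamma> s) (u s)) integrable_on {0..t}"
        using nu_pos by (intro integrable_continuous_real continuous_intros c \<gamma> u) auto
      show "(\<lambda>s. (norm (f s))\<^sup>2 + (norm (u s))\<^sup>2 - 2 * \<delta> s) integrable_on {0..t}"
        by (intro integrable_continuous_real continuous_intros c f u \<delta>)
      fix s assume "s \<in> {0..t}"
      then have s: "s \<in> {0..T}" using t by auto
      have "inner (\<gamma> s) (u s) = inner (f s) (u s) + inner (g (u s)) (u s)"
        by (simp add: \<gamma>_def inner_diff_left inner_add_left B_high_orthogonal[OF U(2)[OF s]])
      moreover have "2 * inner (f s) (u s) \<le> (norm (f s))\<^sup>2 + (norm (u s))\<^sup>2"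
        using norm_diff_sq[of "f s" "u s"] zero_le_power2[of "norm (f s - u s)"] by linarith
      ultimately have "2 * inner (\<gamma> s) (u s) \<le> (norm (f s))\<^sup>2 + (norm (u s))\<^sup>2 - 2 * \<delta> s"
        using diss(1)[OF s] by linarith
      then show "(norm (0 :: ell2))\<^sup>2 / (2 * \<nu>) + 2 * inner (\<gamma> s) (u s) \<le> (norm (f s))\<^sup>2 + (norm (u s))\<^sup>2 - 2 * \<delta> s"
        by simp
    qed
    also have "\<dots> = integral {0..t} (\<lambda>s. (norm (f s))\<^sup>2) + integral {0..t} (\<lambda>s. (norm (u s))\<^sup>2) - 2 * integral {0..t} \<delta>"
    proof -
      have "((\<lambda>s. (norm (f s))\<^sup>2 + (norm (u s))\<^sup>2 - 2 * \<delta> s) has_integral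
        integral {0..t} (\<lambda>s. (norm (f s))\<^sup>2) + integral {0..t} (\<lambda>s. (norm (u s))\<^sup>2) - 2 * integral {0..t} \<delta>) {0..t}"
        by (intro has_integral_diff has_integral_add has_integral_mult_right integrable_integral I)
      then show ?thesis by (rule integral_unique)
    qed
    also have "integral {0..t} (\<lambda>s. (norm (f s))\<^sup>2) \<le> integral {0..T} (\<lambda>s. (norm (f s))\<^sup>2)"
      by (rule integral_subset_le)
         (use t I in \<open>auto intro!: integrable_continuous_real continuous_intros f\<close>)
    finally show ?thesis unfolding C0_def by linarith
  qed
  have \<delta>0: "0 \<le> integral {0..t} \<delta>" if t: "t \<in> {0..T}" for t
    by (rule integral_nonneg) (use t diss(2) in \<open>auto intro!: integrable_continuous_real sub[OF \<delta>]\<close>)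
  have C0: "0 \<le> C0"
    unfolding C0_def by (intro add_nonneg_nonneg integral_nonneg integrable_continuous_real continuous_intros f) auto
  have bound: "(norm (u t))\<^sup>2 \<le> C0 * exp T" if t: "t \<in> {0..T}" for t
  proof -
    have "(norm (u t))\<^sup>2 \<le> C0 * exp (1 * t)"
    proof (rule gronwall[OF _ _ t])
      show "(norm (u s))\<^sup>2 \<le> C0 + 1 * integral {0..s} (\<lambda>s. (norm (u s))\<^sup>2)" if "s \<in> {0..T}" for s
        using main[OF that] \<delta>0[OF that] by linarith
    qed (auto intro!: continuous_intros u)
    also have "\<dots> \<le> C0 * exp T" using t C0 by (intro mult_left_mono) auto
    finally show ?thesis .
  qed
  then show "(norm (u t))\<^sup>2 \<le> energy_bound T f (u 0)" if "t \<in> {0..T}" for t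
    using that by (simp add: energy_bound_def C0_def)
  have "2 * integral {0..T} \<delta> \<le> C0 + integral {0..T} (\<lambda>s. (norm (u s))\<^sup>2)"
  proof -
    have "T \<in> {0..T}" using T by simp
    then show ?thesis using main[of T] zero_le_power2[of "norm (u T)"] by linarith
  qed
  also have "integral {0..T} (\<lambda>s. (norm (u s))\<^sup>2) \<le> integral {0..T} (\<lambda>s. C0 * exp T)"
    by (rule integral_le) (auto intro!: integrable_continuous_real continuous_intros u bound)
  \<comment> \<open>The integral is \<open>T * (C0 * exp T)\<close>; enlarging the summand
    \<open>C0\<close> to \<open>C0 * exp T\<close> produces the factor \<open>T + 1\<close>.\<close>
  also have "C0 + integral {0..T} (\<lambda>s. C0 * exp T) \<le> (T + 1) * (C0 * exp T)"
  proof -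
    have "C0 * 1 \<le> C0 * exp T" using T C0 by (intro mult_left_mono) auto
    then show ?thesis using T by (simp add: distrib_right)
  qed
  finally show "integral {0..T} \<delta> \<le> (T + 1) * energy_bound T f (u 0)"
    using \<delta>0[of T] T by (simp add: energy_bound_def C0_def)
qed

text \<open>The velocity \<open>V\<close> read off from the equation is known to be continuous only
  mode by mode, like \<open>A u\<close>. It is measurable and bounded, hence Bochner integrable; the
  fundamental theorem in each mode identifies \<open>u\<close> as its primitive, and
  differentiability in norm follows almost everywhere.\<close>

lemma strong_solution:
  fixes f :: "real \<Rightarrow> ell2" and g :: "ell2 \<Rightarrow> ell2"
  assumes T: "0 < T"
    and u: "evolves T u (\<lambda>t. inv_sqrt_A (f t + g (u t)) - B_low a b (u t) (u t)) (\<lambda>_. 0)"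
      "continuous_on {0..T} u"
    and f: "continuous_on {0..T} f" and g: "continuous_on {0..T} (\<lambda>t. g (u t))"
    and U: "continuous_on {0..T} U" "\<And>t n. t \<in> {0..T} \<Longrightarrow> coord (U t) n = k n *\<^sub>R coord (u t) n"
    and A: "\<And>t. t \<in> {0..T} \<Longrightarrow> u t \<in> dom_A k0 q" "\<And>t. t \<in> {0..T} \<Longrightarrow> norm (shell_A k0 q (u t)) \<le> C"
  shows "closed_loop_solution T \<nu> k0 q a b g f (u 0) u" "in_W1p \<infinity> T u" "in_Linf_dom_A k0 q T u"
proof -
  define F where "F t = f t + g (u t) - B_high a b (U t) (u t)" for t
  have F: "continuous_on {0..T} F"
    unfolding F_def B_high_def
    by (intro continuous_intros f g u bounded_bilinear.continuous_on[OF bounded_bilinear_shell_form] U)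
  define V where "V t = F t - \<nu> *\<^sub>R shell_A k0 q (u t)" for t
  have D: "((\<lambda>s. coord (u s) n) has_vector_derivative coord (V t) n) (at t within {0..T})"
    if t: "t \<in> {0..T}" for t n
  proof -
    have "k n *\<^sub>R coord (inv_sqrt_A (f t + g (u t)) - B_low a b (u t) (u t)) n
        = coord (f t + g (u t)) n - k n *\<^sub>R coord (B_low a b (u t) (u t)) n"
      unfolding coord_diff scaleR_diff_right coord_inv_sqrt_A ..
    then show ?thesis
      using evolvesD[OF u(1) t, of n]
      by (simp add: V_def F_def coord_B_low coord_B_high[OF U(2)[OF t]] coord_shell_A_scaleR[OF A(1)[OF t]]
          algebra_simps)
  qed
  have Ac: "continuous_on {0..T} (\<lambda>t. coord (shell_A k0 q (u t)) n)" for n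
  proof -
    have "continuous_on {0..T} (\<lambda>t. (k n)\<^sup>2 *\<^sub>R coord (u t) n)" by (intro continuous_intros u)
    then show ?thesis
      using continuous_on_cong[OF refl, of "{0..T}" "\<lambda>t. coord (shell_A k0 q (u t)) n" "\<lambda>t. (k n)\<^sup>2 *\<^sub>R coord (u t) n"]
        coord_shell_A_scaleR[OF A(1)] by blast
  qed
  have Vc: "continuous_on {0..T} (\<lambda>t. coord (V t) n)" for n
    unfolding V_def coord_diff coord_scaleR by (intro continuous_intros F Ac)
  have Vm: "V \<in> borel_measurable (lebesgue_on {0..T})" by (rule borel_measurable_coordwise[OF Vc])
  obtain CF where CF: "\<And>t. t \<in> {0..T} \<Longrightarrow> norm (F t) \<le> CF"
    by (rule continuous_on_Icc_bounded[OF F]) blast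
  have Vb: "norm (V t) \<le> CF + \<nu> * C" if t: "t \<in> {0..T}" for t
  proof -
    have "norm (V t) \<le> norm (F t) + \<nu> * norm (shell_A k0 q (u t))"
      unfolding V_def using norm_triangle_ineq4[of "F t" "\<nu> *\<^sub>R shell_A k0 q (u t)"] nu_pos by simp
    then show ?thesis
      using CF[OF t] mult_left_mono[OF A(2)[OF t], of \<nu>] nu_pos by linarith
  qed
  have fin: "finite_measure (lebesgue_on {0..T})"
    by (intro finite_measure_lebesgue_on) simp
  have "integrable (lebesgue_on {0..T}) V"
    by (rule finite_measure.integrable_const_bound[OF fin _ Vm, where B = "CF + \<nu> * C"]) (use Vb in auto)
  then have Vi: "set_integrable lebesgue {0..T} V"
    by (simp add: integrable_restrict_space set_integrable_def)
  have prim: "u t = u 0 + (LINT s:{0..t}|lebesgue. V s)" if t: "t \<in> {0..T}" for t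
  proof (rule ell2_eqI)
    fix n
    have Vit: "set_integrable lebesgue {0..t} V" by (rule set_integrable_Icc_subset[OF Vi]) (use t in auto)
    have "((\<lambda>s. coord (V s) n) has_integral coord (u t) n - coord (u 0) n) {0..t}"
    proof (rule fundamental_theorem_of_calculus)
      show "((\<lambda>s. coord (u s) n) has_vector_derivative coord (V s) n) (at s within {0..t})" if "s \<in> {0..t}" for s
        by (rule has_vector_derivative_within_subset[OF D]) (use that t in auto)
    qed (use t in simp)
    then have "integral {0..t} (\<lambda>s. coord (V s) n) = coord (u t) n - coord (u 0) n" by (rule integral_unique)
    moreover have "(LINT s:{0..t}|lebesgue. coord (V s) n) = integral {0..t} (\<lambda>s. coord (V s) n)"
      by (rule set_lebesgue_integral_eq_integral(2)[OF primitive_coord(1)[OF Vit]])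
    ultimately show "coord (u t) n = coord (u 0 + (LINT s:{0..t}|lebesgue. V s)) n"
      by (simp add: primitive_coord(2)[OF Vit])
  qed
  have ac: "ac_deriv T u V"
    unfolding ac_deriv_def using Vi prim primitive_differentiable_ae[OF Vi prim] by blast
  have um: "u \<in> borel_measurable (lebesgue_on {0..T})"
    by (intro borel_measurable_coordwise continuous_intros u)
  obtain Cu where Cu: "\<And>t. t \<in> {0..T} \<Longrightarrow> norm (u t) \<le> Cu"
    by (rule continuous_on_Icc_bounded[OF u(2)]) blast
  have AEI: "AE t in lebesgue_on {0..T}. P t" if "\<And>t. t \<in> {0..T} \<Longrightarrow> P t" for P
    by (rule AE_I2) (use that in simp)
  show "in_W1p \<infinity> T u"
    unfolding in_W1p_def in_Lp_def
    using ac um Vm AEI[of "\<lambda>t. norm (u t) \<le> Cu", OF Cu] AEI[of "\<lambda>t. norm (V t) \<le> CF + \<nu> * C", OF Vb] by auto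
  show "in_Linf_dom_A k0 q T u"
    unfolding in_Linf_dom_A_def in_Lp_def
    using AEI[of "\<lambda>t. u t \<in> dom_A k0 q", OF A(1)] AEI[of "\<lambda>t. norm (shell_A k0 q (u t)) \<le> C", OF A(2)]
      borel_measurable_coordwise[OF Ac] by auto
  have "V t + \<nu> *\<^sub>R shell_A k0 q (u t) + shell_B k0 q a b (u t) (u t) = f t + g (u t)" if t: "t \<in> {0..T}" for t
    by (simp add: V_def F_def shell_B_eq_B_high[OF U(2)[OF t]])
  then have "AE t in lebesgue_on {0..T}. u t \<in> dom_A k0 q \<and>
      V t + \<nu> *\<^sub>R shell_A k0 q (u t) + shell_B k0 q a b (u t) (u t) = f t + g (u t)"
    using A(1) by (intro AEI) auto
  then show "closed_loop_solution T \<nu> k0 q a b g f (u 0) u"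
    unfolding closed_loop_solution_def using ac by blast
qed

text \<open>The converse passage, for an arbitrary strong solution. The equation holds almost
  everywhere, but in each mode its right side \<open>\<rho> n\<close> is continuous, so the mode is
  the primitive of a continuous function and differentiable at every time.\<close>

lemma closed_loop_evolves:
  fixes f :: "real \<Rightarrow> ell2" and g :: "ell2 \<Rightarrow> ell2"
  assumes sol: "closed_loop_solution T \<nu> k0 q a b g f u0 u"
    and f: "continuous_on {0..T} f" and g: "\<And>x y. norm (g x - g y) \<le> Lg * norm (x - y)"
  shows "continuous_on {0..T} u" "u 0 = u0"
    "evolves T u (\<lambda>t. inv_sqrt_A (f t + g (u t)) - B_low a b (u t) (u t)) (\<lambda>_. 0)"
proof -
  obtain V where V: "set_integrable lebesgue {0..T} V"
    and prim: "\<And>t. t \<in> {0..T} \<Longrightarrow> u t = u 0 + (LINT s:{0..t}|lebesgue. V s)"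
    and ae: "AE t in lebesgue_on {0..T}. u t \<in> dom_A k0 q \<and>
      V t + \<nu> *\<^sub>R shell_A k0 q (u t) + shell_B k0 q a b (u t) (u t) = f t + g (u t)"
    using sol unfolding closed_loop_solution_def ac_deriv_def by blast
  show "u 0 = u0" using sol by (simp add: closed_loop_solution_def)
  show uc: "continuous_on {0..T} u" by (rule primitive_continuous[OF V prim])
  define \<rho> where "\<rho> n t = - (\<nu> * (k n)\<^sup>2) *\<^sub>R coord (u t) n
    + k n *\<^sub>R coord (inv_sqrt_A (f t + g (u t)) - B_low a b (u t) (u t)) n" for n t
  have \<rho>c: "continuous_on {0..T} (\<rho> n)" for n
    unfolding \<rho>_def B_low_def
    by (intro continuous_intros uc f continuous_on_lipschitz_comp[OF g] bounded_linear.continuous_on[OF bounded_linear_inv_sqrt_A]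
        bounded_bilinear.continuous_on[OF bounded_bilinear_shell_form])
  have eq: "coord w n = \<rho> n t" if A: "u t \<in> dom_A k0 q"
    and w: "w + \<nu> *\<^sub>R shell_A k0 q (u t) + shell_B k0 q a b (u t) (u t) = f t + g (u t)" for w t n
  proof -
    have "k n *\<^sub>R coord (inv_sqrt_A (f t + g (u t)) - B_low a b (u t) (u t)) n
        = coord (f t + g (u t)) n - coord (shell_B k0 q a b (u t) (u t)) n"
      unfolding coord_diff scaleR_diff_right coord_inv_sqrt_A coord_B_low coord_shell_B[OF k0_pos q_gt_1 A] ..
    moreover have "coord (f t + g (u t)) n
        = coord w n + \<nu> *\<^sub>R coord (shell_A k0 q (u t)) n + coord (shell_B k0 q a b (u t) (u t)) n"
      unfolding w[symmetric] by simp
    ultimately show ?thesis by (simp add: \<rho>_def coord_shell_A_scaleR[OF A])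
  qed
  have ae': "AE t in lebesgue. t \<in> {0..T} \<longrightarrow> (\<forall>n. coord (V t) n = \<rho> n t)"
  proof -
    have "AE t in lebesgue_on {0..T}. \<forall>n. coord (V t) n = \<rho> n t"
      using ae by eventually_elim (use eq in blast)
    then show ?thesis by (simp add: AE_restrict_space_iff)
  qed
  have int: "coord (u t) n = coord (u 0) n + integral {0..t} (\<rho> n)" if t: "t \<in> {0..T}" for t n
  proof -
    have Vt: "set_integrable lebesgue {0..t} V" by (rule set_integrable_Icc_subset[OF V]) (use t in auto)
    have \<rho>t: "set_integrable lebesgue {0..t} (\<rho> n)"
      by (rule absolutely_integrable_continuous_real, rule continuous_on_subset[OF \<rho>c]) (use t in auto)
    have "(LINT s:{0..t}|lebesgue. coord (V s) n) = (LINT s:{0..t}|lebesgue. \<rho> n s)"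
      unfolding set_lebesgue_integral_def
    proof (rule integral_cong_AE)
      show "AE s in lebesgue. indicat_real {0..t} s *\<^sub>R coord (V s) n = indicat_real {0..t} s *\<^sub>R \<rho> n s"
        using ae' by eventually_elim (use t in \<open>auto simp: indicator_def\<close>)
    qed (use primitive_coord(1)[OF Vt, of n] \<rho>t in \<open>auto simp: set_integrable_def\<close>)
    also have "\<dots> = integral {0..t} (\<rho> n)" by (rule set_lebesgue_integral_eq_integral(2)[OF \<rho>t])
    finally show ?thesis
      using arg_cong[OF prim[OF t], of "\<lambda>x. coord x n"] by (simp add: primitive_coord(2)[OF Vt])
  qed
  show "evolves T u (\<lambda>t. inv_sqrt_A (f t + g (u t)) - B_low a b (u t) (u t)) (\<lambda>_. 0)"
    unfolding evolves_def
  proof (intro allI ballI)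
    fix n t assume t: "t \<in> {0..T}"
    have "((\<lambda>s. coord (u 0) n + integral {0..s} (\<rho> n)) has_vector_derivative 0 + \<rho> n t) (at t within {0..T})"
      by (intro has_vector_derivative_add has_vector_derivative_const integral_has_vector_derivative \<rho>c t)
    then have "((\<lambda>s. coord (u s) n) has_vector_derivative 0 + \<rho> n t) (at t within {0..T})"
      by (rule has_vector_derivative_transform[where f = "\<lambda>s. coord (u 0) n + integral {0..s} (\<rho> n)"
          and x = t, OF t int, rotated])
    then show "((\<lambda>s. coord (u s) n) has_vector_derivative - (\<nu> * (k n)\<^sup>2) *\<^sub>R coord (u t) n
      + k n *\<^sub>R coord (inv_sqrt_A (f t + g (u t)) - B_low a b (u t) (u t)) n + coord 0 n) (at t within {0..T})"
      by (simp add: \<rho>_def)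
  qed
qed

text \<open>Both solutions are continuous, hence bounded. A radius above both bounds makes the
  truncation invisible, and uniqueness for Lipschitz \<open>N\<close> applies.\<close>

lemma closed_loop_unique:
  fixes f :: "real \<Rightarrow> ell2" and g :: "ell2 \<Rightarrow> ell2"
  assumes u: "closed_loop_solution T \<nu> k0 q a b g f u0 u" and v: "closed_loop_solution T \<nu> k0 q a b g f u0 v"
    and f: "continuous_on {0..T} f" and g: "\<And>x y. norm (g x - g y) \<le> Lg * norm (x - y)"
    and t: "t \<in> {0..T}"
  shows "u t = v t"
proof -
  note U = closed_loop_evolves[OF u f g] and V = closed_loop_evolves[OF v f g]
  obtain Cu where Cu: "\<And>t. t \<in> {0..T} \<Longrightarrow> norm (u t) \<le> Cu" by (rule continuous_on_Icc_bounded[OF U(1)]) blast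
  obtain Cv where Cv: "\<And>t. t \<in> {0..T} \<Longrightarrow> norm (v t) \<le> Cv" by (rule continuous_on_Icc_bounded[OF V(1)]) blast
  define R where "R = max 1 (max Cu Cv)"
  have R: "0 < R" by (simp add: R_def)
  have id: "retract R (u t) = u t" "retract R (v t) = v t" if "t \<in> {0..T}" for t
    using Cu[OF that] Cv[OF that] R by (auto intro!: retract_id simp: R_def)
  define F where "F x = B_low a b (retract R x) (retract R x)" for x
  obtain LB where LB: "\<And>x y. norm (F x - F y) \<le> LB * norm (x - y)"
    using bilinear_retract_lipschitz[OF bounded_bilinear_shell_form R] unfolding F_def B_low_def by blast
  define N where "N t x = inv_sqrt_A (f t + g x) - F x" for t x
  have cont: "continuous_on {0..T} (\<lambda>t. N t (w t))" if "continuous_on {0..T} w" for w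
    unfolding N_def
    by (intro continuous_intros bounded_linear.continuous_on[OF bounded_linear_inv_sqrt_A] f
        continuous_on_lipschitz_comp[OF g] continuous_on_lipschitz_comp[OF LB] that)
  have L: "norm (N t x - N t y) \<le> (1 / k0 * Lg + LB) * norm (x - y)" for t x y
  proof -
    have "inv_sqrt_A (f t + g x) - inv_sqrt_A (f t + g y) = inv_sqrt_A (g x - g y)"
      using bounded_linear.linear[OF bounded_linear_inv_sqrt_A] by (simp flip: linear_diff)
    then have "N t x - N t y = inv_sqrt_A (g x - g y) - (F x - F y)"
      by (simp add: N_def algebra_simps)
    also have "norm \<dots> \<le> norm (inv_sqrt_A (g x - g y)) + norm (F x - F y)" by (rule norm_triangle_ineq4)
    also have "norm (inv_sqrt_A (g x - g y)) \<le> 1 / k0 * (Lg * norm (x - y))"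
      using k0_pos by (intro order_trans[OF norm_inv_sqrt_A] mult_left_mono g) auto
    finally show ?thesis using LB[of x y] by (simp add: algebra_simps)
  qed
  have "evolves T u (\<lambda>t. N t (u t)) (\<lambda>_. 0)" "evolves T v (\<lambda>t. N t (v t)) (\<lambda>_. 0)"
    by (rule evolves_cong[OF U(3)] evolves_cong[OF V(3)]; simp add: N_def F_def id)+
  from lipschitz_solution_unique[OF this(1) U(1) this(2) V(1) _ cont L t] show ?thesis
    using U(2) V(2) by simp
qed

text \<open>A solution is determined on \<open>[0, T]\<close> only and is arbitrary elsewhere; this
  carries regularity from the constructed solution to any other one.\<close>

lemma regularity_class_cong:
  assumes eq: "\<And>t. t \<in> {0..T} \<Longrightarrow> u t = v t" and T: "0 \<le> T"
  shows "in_W1p p T u \<Longrightarrow> in_W1p p T v" "in_Linf_dom_A k0 q T u \<Longrightarrow> in_Linf_dom_A k0 q T v"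
proof -
  have Lp: "in_Lp p T w \<Longrightarrow> in_Lp p T w'" if ww: "\<And>t. t \<in> {0..T} \<Longrightarrow> w t = w' t" for p and w w' :: "real \<Rightarrow> ell2"
  proof -
    have m: "w \<in> borel_measurable (lebesgue_on {0..T}) \<longleftrightarrow> w' \<in> borel_measurable (lebesgue_on {0..T})"
      by (rule measurable_cong) (simp add: ww)
    have A: "(AE t in lebesgue_on {0..T}. norm (w t) \<le> M) \<longleftrightarrow> (AE t in lebesgue_on {0..T}. norm (w' t) \<le> M)" for M
      by (rule AE_cong) (simp add: ww)
    have I: "(\<integral>\<^sup>+ t. ennreal (norm (w t) powr r) \<partial>lebesgue_on {0..T}) = (\<integral>\<^sup>+ t. ennreal (norm (w' t) powr r) \<partial>lebesgue_on {0..T})" for r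
      by (rule nn_integral_cong) (simp add: ww)
    show "in_Lp p T w \<Longrightarrow> in_Lp p T w'" unfolding in_Lp_def m A I .
  qed
  have ac: "ac_deriv T v u'" if "ac_deriv T u u'" for u'
  proof -
    have "(u has_vector_derivative d) (at t within {0..T}) \<longleftrightarrow> (v has_vector_derivative d) (at t within {0..T})"
      if t: "t \<in> {0..T}" for t d
      using has_vector_derivative_transform[OF t, of v u] has_vector_derivative_transform[OF t, of u v] eq by auto
    then have AE: "(AE t in lebesgue_on {0..T}. (u has_vector_derivative u' t) (at t within {0..T})) \<longleftrightarrow>
        (AE t in lebesgue_on {0..T}. (v has_vector_derivative u' t) (at t within {0..T}))"
      by (intro AE_cong) simp
    have "v t = v 0 + (LINT s:{0..t}|lebesgue. u' s)" if t: "t \<in> {0..T}" for t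
    proof -
      have "u t = u 0 + (LINT s:{0..t}|lebesgue. u' s)"
        using \<open>ac_deriv T u u'\<close> t unfolding ac_deriv_def by blast
      moreover have "0 \<in> {0..T}" using T by simp
      ultimately show ?thesis by (simp only: eq t)
    qed
    then show ?thesis using that AE unfolding ac_deriv_def by blast
  qed
  show "in_W1p p T v" if "in_W1p p T u"
    using that ac Lp[of u v p] eq unfolding in_W1p_def by blast
  have "(AE t in lebesgue_on {0..T}. u t \<in> dom_A k0 q) \<longleftrightarrow> (AE t in lebesgue_on {0..T}. v t \<in> dom_A k0 q)"
    by (rule AE_cong) (simp add: eq)
  then show "in_Linf_dom_A k0 q T v" if "in_Linf_dom_A k0 q T u"
    using that Lp[of "\<lambda>t. shell_A k0 q (u t)" "\<lambda>t. shell_A k0 q (v t)" \<infinity>] eq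
    unfolding in_Linf_dom_A_def by auto
qed

text \<open>The radius is fixed in advance from a bound that holds for every truncation; hence the
  solution never leaves the ball on which the truncated and the original equation agree.\<close>

lemma closed_loop_exists:
  assumes T: "0 < T" and f: "in_W1p 2 T f" and u0: "u0 \<in> dom_A k0 q"
    and K: "closed K" "convex K" "0 \<in> K"
    and comm: "\<And>u. proj_on K (mult_ind \<omega> u) = mult_ind \<omega> (proj_on K u)"
    and lam: "0 < lam"
  shows "\<exists>u. closed_loop_solution T \<nu> k0 q a b (feedback K \<omega> lam) f u0 u \<and> in_W1p \<infinity> T u \<and>
    in_Linf_dom_A k0 q T u \<and>
    integral {0..T} (\<lambda>t. 1 / lam * (dist_to K (mult_ind \<omega> (u t)))\<^sup>2) \<le> (T + 1) * energy_bound T f u0"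
proof -
  note g = feedback_lipschitz[OF K comm lam]
  \<comment> \<open>The \<open>+ 1\<close> makes \<open>R\<close> positive even for zero
    data.\<close>
  define R where "R = sqrt (energy_bound T f u0) + 1"
  have fc: "continuous_on {0..T} f" using W12_modulus(1)[OF f] T by simp
  have "0 \<le> energy_bound T f u0"
    unfolding energy_bound_def
    by (intro mult_nonneg_nonneg add_nonneg_nonneg integral_nonneg integrable_continuous_real
        continuous_intros fc) auto
  then have R: "0 < R" by (simp add: R_def add_nonneg_pos)
  define r where "r x = (R / max R (norm x))\<^sup>2" for x :: ell2
  obtain u U C where u: "continuous_on {0..T} u" "u 0 = u0"
      "evolves T u (\<lambda>t. inv_sqrt_A (f t + feedback K \<omega> lam (u t)) - r (u t) *\<^sub>R B_low a b (u t) (u t)) (\<lambda>_. 0)"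
    and U: "continuous_on {0..T} U" "\<And>t n. t \<in> {0..T} \<Longrightarrow> coord (U t) n = k n *\<^sub>R coord (u t) n"
    and A: "\<And>t. t \<in> {0..T} \<Longrightarrow> u t \<in> dom_A k0 q" "\<And>t. t \<in> {0..T} \<Longrightarrow> norm (shell_A k0 q (u t)) \<le> C"
    using truncated_solution[OF T R f u0 g, of a b] unfolding r_def by blast
  have gc: "continuous_on {0..T} (\<lambda>t. feedback K \<omega> lam (u t))"
    by (rule continuous_on_lipschitz_comp[OF g u(1)])
  have rc: "continuous_on {0..T} (\<lambda>t. r (u t))"
    unfolding r_def using R by (intro continuous_intros u) (auto simp: max_def)
  have \<delta>: "continuous_on {0..T} (\<lambda>t. 1 / lam * (dist_to K (mult_ind \<omega> (u t)))\<^sup>2)"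
    by (intro continuous_intros continuous_on_dist_to[OF K comm lam] u)
  have pos: "0 \<le> 1 / lam * (dist_to K (mult_ind \<omega> (u t)))\<^sup>2" for t using lam by simp
  have diss: "inner (feedback K \<omega> lam (u t)) (u t) \<le> - (1 / lam * (dist_to K (mult_ind \<omega> (u t)))\<^sup>2)" for t
    by (rule feedback_dissipative[OF K comm lam])
  have est: "(norm (u t))\<^sup>2 \<le> energy_bound T f u0" if "t \<in> {0..T}" for t
    using a_priori_estimate(1)[OF T u(3,1) U(1) _ fc gc rc \<delta> diss pos that] U(2) u(2) by simp
  have pen: "integral {0..T} (\<lambda>t. 1 / lam * (dist_to K (mult_ind \<omega> (u t)))\<^sup>2) \<le> (T + 1) * energy_bound T f u0"
    using a_priori_estimate(2)[OF T u(3,1) U(1) _ fc gc rc \<delta> diss pos] U(2) unfolding u(2) by blast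
  have "r (u t) = 1" if t: "t \<in> {0..T}" for t
  proof -
    have "norm (u t) \<le> R" using real_le_rsqrt[OF est[OF t]] by (simp add: R_def)
    then show ?thesis using R by (simp add: r_def max_def)
  qed
  then have ev: "evolves T u (\<lambda>t. inv_sqrt_A (f t + feedback K \<omega> lam (u t)) - B_low a b (u t) (u t)) (\<lambda>_. 0)"
    by (intro evolves_cong[OF u(3)]) simp_all
  show ?thesis
    using strong_solution[OF T ev u(1) fc gc U A] pen unfolding u(2) by blast
qed

end

theorem theorem4p3:
  fixes T \<nu> k0 q a b c :: real
    and K :: "ell2 set" and \<omega> :: "nat set"
    and u0 :: ell2 and f :: "real \<Rightarrow> ell2"
  assumes "T > 0" "\<nu> > 0" "k0 > 0" "q > 1" "a + b + c = 0"
    and "closed K" "convex K" "0 \<in> K"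
    and "finite \<omega>"
    and "\<And>u. proj_on K (mult_ind \<omega> u) = mult_ind \<omega> (proj_on K u)"
    and "u0 \<in> dom_A k0 q" "mult_ind \<omega> u0 \<in> K"
    and "in_W1p 2 T f"
  shows
    "(\<forall>lam>0.
        (\<exists>u. closed_loop_solution T \<nu> k0 q a b (feedback K \<omega> lam) f u0 u) \<and>
        (\<forall>u v. closed_loop_solution T \<nu> k0 q a b (feedback K \<omega> lam) f u0 u \<longrightarrow>
               closed_loop_solution T \<nu> k0 q a b (feedback K \<omega> lam) f u0 v \<longrightarrow>
               (\<forall>t\<in>{0..T}. u t = v t)) \<and>
        (\<forall>u. closed_loop_solution T \<nu> k0 q a b (feedback K \<omega> lam) f u0 u \<longrightarrow>
               in_W1p \<infinity> T u \<and> in_Linf_dom_A k0 q T u)) \<and>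
     (\<exists>C>0. \<forall>lam>0. \<forall>u.
        closed_loop_solution T \<nu> k0 q a b (feedback K \<omega> lam) f u0 u \<longrightarrow>
          set_integrable lebesgue {0..T} (\<lambda>t. (dist_to K (mult_ind \<omega> (u t)))\<^sup>2) \<and>
          1 / lam * (LINT t:{0..T}|lebesgue. (dist_to K (mult_ind \<omega> (u t)))\<^sup>2) \<le> C)"
proof -
  interpret sabra k0 q \<nu> by unfold_locales (use assms in auto)
  note K = \<open>closed K\<close> \<open>convex K\<close> \<open>0 \<in> K\<close> and comm = assms(10)
  have fc: "continuous_on {0..T} f" using W12_modulus(1)[OF \<open>in_W1p 2 T f\<close>] \<open>T > 0\<close> by simp
  let ?sol = "\<lambda>lam. closed_loop_solution T \<nu> k0 q a b (feedback K \<omega> lam) f u0"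
  let ?d = "\<lambda>u t. (dist_to K (mult_ind \<omega> (u t)))\<^sup>2"
  define E where "E = (T + 1) * energy_bound T f u0"
  note ex = closed_loop_exists[OF \<open>T > 0\<close> \<open>in_W1p 2 T f\<close> \<open>u0 \<in> dom_A k0 q\<close> K comm, of _ a b, folded E_def]
  have uniq: "u t = v t" if "lam > 0" "?sol lam u" "?sol lam v" "t \<in> {0..T}" for lam u v t
    by (rule closed_loop_unique[OF that(2,3) fc feedback_lipschitz[OF K comm that(1)] that(4)])
  \<comment> \<open>The claims concern every solution, while the estimates are known for a
    constructed one, \<open>w\<close>; uniqueness transfers them, here and in
    \<open>pen\<close>.\<close>
  have reg: "in_W1p \<infinity> T u \<and> in_Linf_dom_A k0 q T u" if lam: "lam > 0" and u: "?sol lam u" for lam u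
  proof -
    obtain w where w: "?sol lam w" "in_W1p \<infinity> T w" "in_Linf_dom_A k0 q T w" using ex[OF lam] by blast
    show ?thesis
      using regularity_class_cong[of T w u] uniq[OF lam w(1) u] w(2,3) \<open>T > 0\<close> by simp
  qed
  have pen: "set_integrable lebesgue {0..T} (?d u) \<and> 1 / lam * (LINT t:{0..T}|lebesgue. ?d u t) \<le> E"
    if lam: "lam > 0" and u: "?sol lam u" for lam u
  proof -
    obtain w where w: "?sol lam w" "integral {0..T} (\<lambda>t. 1 / lam * ?d w t) \<le> E" using ex[OF lam] by blast
    have "continuous_on {0..T} u"
      by (rule closed_loop_evolves(1)[OF u fc feedback_lipschitz[OF K comm lam]])
    then have "continuous_on {0..T} (?d u)"
      by (intro continuous_intros continuous_on_dist_to[OF K comm lam])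
    then have int: "set_integrable lebesgue {0..T} (?d u)" by (rule absolutely_integrable_continuous_real)
    have "1 / lam * (LINT t:{0..T}|lebesgue. ?d u t) = integral {0..T} (\<lambda>t. 1 / lam * ?d u t)"
      unfolding set_lebesgue_integral_eq_integral(2)[OF int] by (simp only: integral_mult_right)
    also have "\<dots> = integral {0..T} (\<lambda>t. 1 / lam * ?d w t)"
      using uniq[OF lam w(1) u] by (intro integral_cong) simp
    finally have eq: "1 / lam * (LINT t:{0..T}|lebesgue. ?d u t) = integral {0..T} (\<lambda>t. 1 / lam * ?d w t)" .
    show ?thesis unfolding eq using int w(2) by blast
  qed
  have bound: "\<exists>C>0. \<forall>lam>0. \<forall>u. ?sol lam u \<longrightarrow>
      set_integrable lebesgue {0..T} (?d u) \<and> 1 / lam * (LINT t:{0..T}|lebesgue. ?d u t) \<le> C"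
  \<comment> \<open>\<open>E\<close> is free of \<lambda> but may vanish, and a positive constant is
    required.\<close>
  proof (intro exI[of _ "\<bar>E\<bar> + 1"] conjI allI impI)
    fix lam u assume "lam > (0 :: real)" "?sol lam u"
    note p = pen[OF this]
    show "set_integrable lebesgue {0..T} (?d u)" using p by blast
    show "1 / lam * (LINT t:{0..T}|lebesgue. ?d u t) \<le> \<bar>E\<bar> + 1"
      using conjunct2[OF p] abs_ge_self[of E] by linarith
  qed simp
  show ?thesis
  proof (intro conjI[OF _ bound] allI impI, intro conjI allI impI ballI)
    fix lam :: real assume lam: "lam > 0"
    show "\<exists>u. ?sol lam u" using ex[OF lam] by blast
    show "u t = v t" if "?sol lam u" "?sol lam v" "t \<in> {0..T}" for u v t by (rule uniq[OF lam that])
    show "in_W1p \<infinity> T u" "in_Linf_dom_A k0 q T u" if "?sol lam u" for u using reg[OF lam that] by simp_all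
  qed
qed

end
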